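(* Let $\mathbb G=(\mathbb V,\mathbb E)$ be a countably infinite, locally finite, connected graph with edge weights $\mathbf c_e\ge1$. For finite connected subgraphs $D_n$ of $\mathbb G$ let $h_n\sim\mathbb P^{\pm1}_{D_n}$, extended by the constant $1$ outside $D_n$. Then exactly one of the following holds: (Gibbs-loc) for every increasing sequence $D_n$ exhausting $\mathbb G$, $h_n$ converges weakly to a random Lipschitz Gibbs measure; (Gibbs-deloc) there is no increasing exhausting sequence $D_n$ and $x\in\mathbb V$ such that $(h_n(x))_n$ is tight. Moreover, (Gibbs-loc) holds iff for some (equivalently every) $x$, $\sup_D\mathbb E^{\pm1}_D[h(x)^2]<\infty$ over finite connected $D\ni x$ (Var-loc), and (Gibbs-deloc) holds iff this supremum is infinite (Var-deloc).
   Context: $\mathbb Z_{\rm odd}=2\mathbb Z+1$. For a finite connected subgraph $D=(V,E)$, a height function is $h:V\to\mathbb Z_{\rm odd}$ with $|h(v)-h(w)|\le2$ along edges, weight $W(h)=\prod_{e=\langle v,w\rangle\in E}\mathbf c_e^{\mathbb 1\{h(v)=h(w)\}}$; for an admissible boundary condition $\xi$ on $\Delta$ (finite nonempty subsets of $\mathbb Z_{\rm odd}$), $\mathbb P^\xi_D[\{h\}]\propto\mathbb 1\{h(x)\in\xi(x)\,\forall x\in\Delta\}W(h)$; $\partial D$ is the set of vertices of $D$ incident to an edge of $\mathbb E\setminus E$, and $\mathbb P^{\pm1}_D$ uses $\xi\equiv\{-1,1\}$ on $\partial D$. Functions $\mathbb V\to\mathbb Z$ carry the topology of pointwise convergence.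 A random Lipschitz Gibbs measure is a probability measure $\mu$ supported on maps $h:\mathbb V\to\mathbb Z_{\rm odd}$ with $|h(v)-h(w)|\le2$ on all edges of $\mathbb G$, such that for every finite connected subgraph $D=(V,E)$ generated by $V$ (i.e. $E$ consists of all edges of $\mathbb G$ within $V$) and every $\mu$-possible $\xi$, the conditional law of $h|_V$ given $h|_{\partial D}=\xi$ is $\mathbb P^\xi_D$. *)

theory Defs
  imports "HOL-Probability.Probability"
begin

text \<open>Simple graph on vertex type 'v given by an adjacency relation adj.
  Edges are represented as two-element sets. A subgraph D is a pair (vertex set, edge set).\<close>

definition G_edges :: "('v \<Rightarrow> 'v \<Rightarrow> bool) \<Rightarrow> 'v set set" where
  "G_edges adj = {{v, w} | v w. adj v w}"

definition fin_conn_subgraph :: "('v \<Rightarrow> 'v \<Rightarrow> bool) \<Rightarrow> 'v set \<times> 'v set set \<Rightarrow> bool" where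
  "fin_conn_subgraph adj D \<longleftrightarrow>
     finite (fst D) \<and> fst D \<noteq> {} \<and> snd D \<subseteq> G_edges adj \<and> (\<forall>e\<in>snd D. e \<subseteq> fst D) \<and>
     (\<forall>v\<in>fst D. \<forall>w\<in>fst D. (\<lambda>a b. {a, b} \<in> snd D)\<^sup>*\<^sup>* v w)"

definition induced :: "('v \<Rightarrow> 'v \<Rightarrow> bool) \<Rightarrow> 'v set \<Rightarrow> 'v set \<times> 'v set set" where
  "induced adj V = (V, {e \<in> G_edges adj. e \<subseteq> V})"

definition bdry :: "('v \<Rightarrow> 'v \<Rightarrow> bool) \<Rightarrow> 'v set \<times> 'v set set \<Rightarrow> 'v set" where
  "bdry adj D = {v \<in> fst D. \<exists>w. adj v w \<and> {v, w} \<notin> snd D}"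

definition hconfs :: "('v \<Rightarrow> 'v \<Rightarrow> bool) \<Rightarrow> 'v set \<times> 'v set set \<Rightarrow> ('v \<Rightarrow> int set) \<Rightarrow> ('v \<Rightarrow> int) set" where
  "hconfs adj D B = {h. (\<forall>v\<in>fst D. odd (h v)) \<and> (\<forall>v. v \<notin> fst D \<longrightarrow> h v = 1) \<and>
      (\<forall>e\<in>snd D. \<forall>v\<in>e. \<forall>w\<in>e. \<bar>h v - h w\<bar> \<le> 2) \<and> (\<forall>v\<in>bdry adj D. h v \<in> B v)}"

definition hweight :: "('v set \<Rightarrow> real) \<Rightarrow> 'v set \<times> 'v set set \<Rightarrow> ('v \<Rightarrow> int) \<Rightarrow> real" where
  "hweight c D h = (\<Prod>e\<in>snd D. if (\<forall>v\<in>e. \<forall>w\<in>e. h v = h w) then c e else 1)"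

definition hexp :: "('v \<Rightarrow> 'v \<Rightarrow> bool) \<Rightarrow> ('v set \<Rightarrow> real) \<Rightarrow> 'v set \<times> 'v set set \<Rightarrow> ('v \<Rightarrow> int set)
    \<Rightarrow> (('v \<Rightarrow> int) \<Rightarrow> real) \<Rightarrow> real" where
  "hexp adj c D B f = (\<Sum>h\<in>hconfs adj D B. hweight c D h * f h) / (\<Sum>h\<in>hconfs adj D B. hweight c D h)"

definition hprob :: "('v \<Rightarrow> 'v \<Rightarrow> bool) \<Rightarrow> ('v set \<Rightarrow> real) \<Rightarrow> 'v set \<times> 'v set set \<Rightarrow> ('v \<Rightarrow> int set)
    \<Rightarrow> (('v \<Rightarrow> int) \<Rightarrow> bool) \<Rightarrow> real" where
  "hprob adj c D B P = hexp adj c D B (\<lambda>h. if P h then 1 else 0)"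

definition pm1 :: "'v \<Rightarrow> int set" where
  "pm1 = (\<lambda>_. {-1, 1})"

text \<open>Weak convergence (product topology on 'v => int): expectations of bounded
  continuous functionals converge.\<close>
definition weak_conv_to :: "(nat \<Rightarrow> (('v \<Rightarrow> int) \<Rightarrow> real) \<Rightarrow> real) \<Rightarrow> ('v \<Rightarrow> int) measure \<Rightarrow> bool" where
  "weak_conv_to E \<mu> \<longleftrightarrow>
     (\<forall>f. continuous_on UNIV f \<and> bounded (range f) \<longrightarrow> (\<lambda>n. E n f) \<longlonglongrightarrow> integral\<^sup>L \<mu> f)"

definition lipschitz_gibbs :: "('v \<Rightarrow> 'v \<Rightarrow> bool) \<Rightarrow> ('v set \<Rightarrow> real) \<Rightarrow> ('v \<Rightarrow> int) measure \<Rightarrow> bool" where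
  "lipschitz_gibbs adj c \<mu> \<longleftrightarrow>
     prob_space \<mu> \<and> sets \<mu> = sets borel \<and>
     (AE h in \<mu>. (\<forall>v. odd (h v)) \<and> (\<forall>v w. adj v w \<longrightarrow> \<bar>h v - h w\<bar> \<le> 2)) \<and>
     (\<forall>V (\<xi> :: 'v \<Rightarrow> int). fin_conn_subgraph adj (induced adj V) \<and>
        measure \<mu> {h \<in> space \<mu>. \<forall>v\<in>bdry adj (induced adj V). h v = \<xi> v} > 0 \<longrightarrow>
        (\<forall>\<eta> :: 'v \<Rightarrow> int.
           measure \<mu> {h \<in> space \<mu>. (\<forall>v\<in>V. h v = \<eta> v) \<and> (\<forall>v\<in>bdry adj (induced adj V). h v = \<xi> v)}
           = measure \<mu> {h \<in> space \<mu>. \<forall>v\<in>bdry adj (induced adj V). h v = \<xi> v}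
             * hprob adj c (induced adj V) (\<lambda>v. {\<xi> v}) (\<lambda>h. \<forall>v\<in>V. h v = \<eta> v)))"

definition increasing_exhaustion :: "('v \<Rightarrow> 'v \<Rightarrow> bool) \<Rightarrow> (nat \<Rightarrow> 'v set \<times> 'v set set) \<Rightarrow> bool" where
  "increasing_exhaustion adj D \<longleftrightarrow>
     (\<forall>n. fin_conn_subgraph adj (D n)) \<and>
     (\<forall>n. fst (D n) \<subseteq> fst (D (Suc n)) \<and> snd (D n) \<subseteq> snd (D (Suc n))) \<and>
     (\<Union>n. fst (D n)) = UNIV \<and> (\<Union>n. snd (D n)) = G_edges adj"

definition gibbs_loc :: "('v \<Rightarrow> 'v \<Rightarrow> bool) \<Rightarrow> ('v set \<Rightarrow> real) \<Rightarrow> bool" where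
  "gibbs_loc adj c \<longleftrightarrow>
     (\<forall>D. increasing_exhaustion adj D \<longrightarrow>
        (\<exists>\<mu>. lipschitz_gibbs adj c \<mu> \<and> weak_conv_to (\<lambda>n. hexp adj c (D n) pm1) \<mu>))"

definition tight_at :: "('v \<Rightarrow> 'v \<Rightarrow> bool) \<Rightarrow> ('v set \<Rightarrow> real) \<Rightarrow> (nat \<Rightarrow> 'v set \<times> 'v set set) \<Rightarrow> 'v \<Rightarrow> bool" where
  "tight_at adj c D x \<longleftrightarrow>
     (\<forall>\<epsilon>>0. \<exists>K::int. \<forall>n. hprob adj c (D n) pm1 (\<lambda>h. \<bar>h x\<bar> > K) \<le> \<epsilon>)"

definition gibbs_deloc :: "('v \<Rightarrow> 'v \<Rightarrow> bool) \<Rightarrow> ('v set \<Rightarrow> real) \<Rightarrow> bool" where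
  "gibbs_deloc adj c \<longleftrightarrow> \<not> (\<exists>D x. increasing_exhaustion adj D \<and> tight_at adj c D x)"

definition var_loc :: "('v \<Rightarrow> 'v \<Rightarrow> bool) \<Rightarrow> ('v set \<Rightarrow> real) \<Rightarrow> 'v \<Rightarrow> bool" where
  "var_loc adj c x \<longleftrightarrow>
     bdd_above {hexp adj c D pm1 (\<lambda>h. (real_of_int (h x))\<^sup>2) | D. fin_conn_subgraph adj D \<and> x \<in> fst D}"

end

theory Submission
  imports Defs
begin

text \<open>
  Everything rests on a monotonicity in the domain. Write a height function as \<open>h = a * \<sigma>\<close> with
  \<open>a = \<bar>h\<bar>\<close>. Given \<open>a\<close>, the signs form a ferromagnetic Ising model, whose couplings grow with \<open>a\<close>
  and with the set of edges. Ginibre's inequality for the signs and the four functions theorem for \<open>a\<close>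
  show that the expectation of a product of signs times a nonnegative increasing function of \<open>a\<close>
  increases with the domain. Indicators of cylinder events are linear combinations of such
  observables, so their probabilities converge along every exhaustion; a limit measure exists as soon as
  the heights are tight, and it inherits the Markov property of the finite-volume measures.

  Tightness at one vertex bounds the second moment there: the four functions theorem applied to a
  height function and a second one lowered by \<open>2 * j\<close> makes the tail of \<open>h x\<close> decay geometrically
  once it is small. By monotonicity the bound holds in all domains, and by the Lipschitz property it
  passes to all vertices.
\<close>

section \<open>The four functions theorem\<close>

text \<open>The symmetric condition \<open>{-1, 1}\<close> leaves nothing monotone in the height
  itself: its mean is 0 at every vertex of every domain. Increasing functions of \<open>a\<close> do
  grow with the domain but cannot tell the sign of a height, so cylinder events need the sign
  products as well. Given \<open>a\<close>, opposite signs at the ends of an edge are possible only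
  if \<open>a = 1\<close> at both ends. An edge thus carries one of three ordered couplings (none,
  finite, infinite), with ratio \<open>q / p\<close> equal to 0, (c - 1) / (c + 1) or 1. An absent
  edge is the lowest of them, so changing the domain and changing \<open>a\<close> both move these
  levels, and one lattice inequality in the levels handles both. The bound c >= 1 makes the finite
  coupling ferromagnetic, and it makes the edge weights log-supermodular where two height functions
  cross along an edge. The threshold 1/4 for the tail T comes from the symmetry T(1) = 1/2: the
  comparison with a lowered copy reads T(d) <= 2 T(1 + 2j) T(d - 2j), so the tail is halved at every
  step of length 2j once T(1 + 2j) <= 1/4.\<close>

lemma four_functions_two_points:
  fixes p q P Q :: real
  assumes "0 \<le> p" "0 \<le> q" "0 \<le> Q" "p \<le> P" "q \<le> P" "p * q \<le> P * Q"
  shows "p + q \<le> P + Q"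
proof (cases "P = 0")
  case True
  then show ?thesis using assms by auto
next
  case False
  then have "P > 0" using assms by auto
  have "0 \<le> (P - p) * (P - q)" using assms by simp
  then have "P * (p + q) \<le> P * (P + Q)"
    using assms(6) by (simp add: algebra_simps)
  then show ?thesis using \<open>P > 0\<close> by simp
qed

text \<open>After symmetrising the double sums, each pair x \<le> y is a two-point problem in which
  \<open>f3 y * f4 x\<close> dominates both products on the left; the bound on the product of the
  two comes from the diagonal cases of the hypothesis.\<close>

lemma four_functions_chain:
  fixes f1 f2 f3 f4 :: "'a::linorder \<Rightarrow> real"
  assumes nonneg: "\<And>x. x \<in> C \<Longrightarrow> 0 \<le> f1 x" "\<And>x. x \<in> C \<Longrightarrow> 0 \<le> f2 x"
      "\<And>x. x \<in> C \<Longrightarrow> 0 \<le> f3 x" "\<And>x. x \<in> C \<Longrightarrow> 0 \<le> f4 x"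
    and le: "\<And>x y. x \<in> C \<Longrightarrow> y \<in> C \<Longrightarrow> f1 x * f2 y \<le> f3 (max x y) * f4 (min x y)"
  shows "sum f1 C * sum f2 C \<le> sum f3 C * sum f4 C"
proof -
  have pair: "f1 x * f2 y + f1 y * f2 x \<le> f3 x * f4 y + f3 y * f4 x"
    if xy: "x \<in> C" "y \<in> C" "x \<le> y" for x y
  proof -
    have "f1 x * f2 y + f1 y * f2 x \<le> f3 y * f4 x + f3 x * f4 y"
    proof (rule four_functions_two_points)
      have "(f1 x * f2 x) * (f1 y * f2 y) \<le> (f3 x * f4 x) * (f3 y * f4 y)"
        by (rule mult_mono) (use le[of x x] le[of y y] xy nonneg in auto)
      then show "f1 x * f2 y * (f1 y * f2 x) \<le> f3 y * f4 x * (f3 x * f4 y)"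
        by (simp add: mult_ac)
    qed (use le[of x y] le[of y x] xy nonneg in \<open>auto simp: max_def min_def split: if_splits\<close>)
    then show ?thesis by simp
  qed
  have "2 * (sum f1 C * sum f2 C) = (\<Sum>x\<in>C. \<Sum>y\<in>C. f1 x * f2 y) + (\<Sum>x\<in>C. \<Sum>y\<in>C. f1 y * f2 x)"
    using sum.swap[of "\<lambda>x y. f1 x * f2 y" C C] by (simp add: sum_product)
  also have "\<dots> = (\<Sum>x\<in>C. \<Sum>y\<in>C. f1 x * f2 y + f1 y * f2 x)"
    by (simp add: sum.distrib)
  also have "\<dots> \<le> (\<Sum>x\<in>C. \<Sum>y\<in>C. f3 x * f4 y + f3 y * f4 x)"
  proof (intro sum_mono)
    fix x y assume "x \<in> C" "y \<in> C"
    then show "f1 x * f2 y + f1 y * f2 x \<le> f3 x * f4 y + f3 y * f4 x"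
      using pair[of x y] pair[of y x] by (cases "x \<le> y") (auto simp: add.commute)
  qed
  also have "\<dots> = (\<Sum>x\<in>C. \<Sum>y\<in>C. f3 x * f4 y) + (\<Sum>x\<in>C. \<Sum>y\<in>C. f3 y * f4 x)"
    by (simp add: sum.distrib)
  also have "\<dots> = 2 * (sum f3 C * sum f4 C)"
    using sum.swap[of "\<lambda>x y. f3 x * f4 y" C C] by (simp add: sum_product)
  finally show ?thesis by simp
qed

lemma sum_PiE_dflt_insert:
  assumes "v \<notin> V"
  shows "(\<Sum>a\<in>PiE_dflt (insert v V) d B. f a) = (\<Sum>x\<in>B v. \<Sum>a\<in>PiE_dflt V d B. f (a(v := x)))"
proof -
  have "(\<Sum>a\<in>PiE_dflt (insert v V) d B. f a)
      = (\<Sum>(x, a)\<in>B v \<times> PiE_dflt V d B. f (a(v := x)))"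
    by (rule sum.reindex_bij_witness[where j = "\<lambda>a. (a v, a(v := d))" and i = "\<lambda>(x, a). a(v := x)"])
      (use assms in \<open>auto simp: PiE_dflt_def fun_eq_iff\<close>)
  then show ?thesis by (simp add: sum.cartesian_product)
qed

text \<open>Ahlswede-Daykin on a finite product of chains, one coordinate at a time: the induction
  hypothesis says that the fibre sums over the remaining coordinates satisfy the hypothesis for a
  single chain. The default \<open>d\<close> keeps configurations total, as height functions are 1
  outside their domain.\<close>

theorem four_functions:
  fixes f1 f2 f3 f4 :: "('v \<Rightarrow> 'a::linorder) \<Rightarrow> real"
  assumes "finite V"
    and "\<And>a. 0 \<le> f1 a" "\<And>a. 0 \<le> f2 a" "\<And>a. 0 \<le> f3 a" "\<And>a. 0 \<le> f4 a"
    and "\<And>a b. a \<in> PiE_dflt V d B \<Longrightarrow> b \<in> PiE_dflt V d B \<Longrightarrow>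
      f1 a * f2 b \<le> f3 (\<lambda>v. max (a v) (b v)) * f4 (\<lambda>v. min (a v) (b v))"
  shows "sum f1 (PiE_dflt V d B) * sum f2 (PiE_dflt V d B)
    \<le> sum f3 (PiE_dflt V d B) * sum f4 (PiE_dflt V d B)"
  using assms
proof (induction V arbitrary: f1 f2 f3 f4 rule: finite_induct)
  case empty
  have "PiE_dflt {} d B = {\<lambda>_. d}" by (auto simp: PiE_dflt_def)
  then show ?case using empty.prems(5)[of "\<lambda>_. d" "\<lambda>_. d"] by simp
next
  case (insert v V)
  let ?P = "PiE_dflt V d B"
  let ?g = "\<lambda>f x. \<Sum>a\<in>?P. f (a(v := x))"
  have "sum (?g f1) (B v) * sum (?g f2) (B v) \<le> sum (?g f3) (B v) * sum (?g f4) (B v)"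
  proof (rule four_functions_chain)
    fix x y assume xy: "x \<in> B v" "y \<in> B v"
    show "?g f1 x * ?g f2 y \<le> ?g f3 (max x y) * ?g f4 (min x y)"
    proof (rule insert.IH)
      fix a b assume ab: "a \<in> ?P" "b \<in> ?P"
      have "f1 (a(v := x)) * f2 (b(v := y))
        \<le> f3 (\<lambda>w. max ((a(v := x)) w) ((b(v := y)) w)) * f4 (\<lambda>w. min ((a(v := x)) w) ((b(v := y)) w))"
        by (rule insert.prems(5)) (use ab xy in \<open>auto simp: PiE_dflt_def\<close>)
      also have "(\<lambda>w. max ((a(v := x)) w) ((b(v := y)) w)) = (\<lambda>w. max (a w) (b w))(v := max x y)"
        by auto
      also have "(\<lambda>w. min ((a(v := x)) w) ((b(v := y)) w)) = (\<lambda>w. min (a w) (b w))(v := min x y)"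
        by auto
      finally show "f1 (a(v := x)) * f2 (b(v := y))
        \<le> f3 ((\<lambda>w. max (a w) (b w))(v := max x y)) * f4 ((\<lambda>w. min (a w) (b w))(v := min x y))" .
    qed (use insert.prems in auto)
  qed (use insert.prems in \<open>auto intro!: sum_nonneg\<close>)
  then show ?case
    by (simp add: sum_PiE_dflt_insert[OF insert.hyps(2)])
qed

section \<open>Ginibre's inequality\<close>

abbreviation signs :: "'v set \<Rightarrow> ('v \<Rightarrow> int) set" where
  "signs V \<equiv> PiE_dflt V 1 (\<lambda>_. {-1, 1})"

text \<open>Only the parity of an exponent matters on signs, but exponents are left unreduced so
  that a product of monomials is literally a monomial; \<open>cong\<close> identifies functions that
  agree on sign vectors.\<close>

inductive character_cone :: "'v set \<Rightarrow> (('v \<Rightarrow> int) \<Rightarrow> real) \<Rightarrow> bool" for V where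
  monomial: "character_cone V (\<lambda>\<sigma>. \<Prod>v\<in>V. real_of_int (\<sigma> v) ^ n v)"
| scale: "0 \<le> r \<Longrightarrow> character_cone V f \<Longrightarrow> character_cone V (\<lambda>\<sigma>. r * f \<sigma>)"
| add: "character_cone V f \<Longrightarrow> character_cone V g \<Longrightarrow> character_cone V (\<lambda>\<sigma>. f \<sigma> + g \<sigma>)"
| cong: "character_cone V f \<Longrightarrow> (\<And>\<sigma>. \<sigma> \<in> signs V \<Longrightarrow> f \<sigma> = g \<sigma>) \<Longrightarrow> character_cone V g"

lemma character_cone_mult:
  assumes "character_cone V f" "character_cone V g"
  shows "character_cone V (\<lambda>\<sigma>. f \<sigma> * g \<sigma>)"
  using assms(1)
proof induction
  case (monomial n)
  show ?case using assms(2)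
  proof induction
    case (monomial m)
    have "character_cone V (\<lambda>\<sigma>. \<Prod>v\<in>V. real_of_int (\<sigma> v) ^ (n v + m v))"
      by (rule character_cone.monomial)
    then show ?case by (simp add: power_add prod.distrib)
  next
    case (scale r f)
    from character_cone.scale[OF scale(1) scale(3)] show ?case by (simp add: mult_ac)
  next
    case (add f g)
    from character_cone.add[OF add(3) add(4)] show ?case by (simp add: algebra_simps)
  next
    case (cong f g)
    show ?case by (rule character_cone.cong[OF cong(3)]) (use cong(2) in auto)
  qed
next
  case (scale r f)
  from character_cone.scale[OF scale(1) scale(3)] show ?case by (simp add: mult_ac)
next
  case (add f g)
  from character_cone.add[OF add(3) add(4)] show ?case by (simp add: algebra_simps)
next
  case (cong f g)
  show ?case by (rule character_cone.cong[OF cong(3)]) (use cong(2) in auto)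
qed

lemma character_cone_const: "0 \<le> r \<Longrightarrow> character_cone V (\<lambda>_. r)"
  using character_cone.scale[OF _ character_cone.monomial[of V "\<lambda>_. 0"], of r] by simp

lemma character_cone_character:
  assumes "finite V" "A \<subseteq> V"
  shows "character_cone V (\<lambda>\<sigma>. \<Prod>v\<in>A. real_of_int (\<sigma> v))"
proof -
  have "(\<Prod>v\<in>V. real_of_int (\<sigma> v) ^ (if v \<in> A then 1 else 0)) = (\<Prod>v\<in>A. real_of_int (\<sigma> v))" for \<sigma>
    using assms by (intro prod.mono_neutral_cong_right) auto
  then show ?thesis
    using character_cone.monomial[of V "\<lambda>v. if v \<in> A then 1 else 0"] by simp
qed

lemma character_cone_affine:
  assumes "finite V" "e \<subseteq> V" "0 \<le> p" "0 \<le> q"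
  shows "character_cone V (\<lambda>\<sigma>. p + q * (\<Prod>v\<in>e. real_of_int (\<sigma> v)))"
  using assms by (intro character_cone.add character_cone.scale character_cone_const
      character_cone_character) auto

text \<open>A monomial with an odd exponent sums to 0, by flipping that one sign; with even
  exponents only it is nonnegative.\<close>

lemma character_cone_sum_nonneg:
  assumes "finite V" "character_cone V f"
  shows "0 \<le> (\<Sum>\<sigma>\<in>signs V. f \<sigma>)"
  using assms(2)
proof induction
  case (monomial n)
  show ?case
  proof (cases "\<forall>v\<in>V. even (n v)")
    case True
    then show ?thesis by (intro sum_nonneg prod_nonneg) (auto simp: zero_le_even_power)
  next
    case False
    then obtain v where v: "v \<in> V" "odd (n v)" by auto
    let ?m = "\<lambda>\<sigma>. \<Prod>v\<in>V. real_of_int (\<sigma> v) ^ n v"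
    have flip: "?m (\<sigma>(v := - \<sigma> v)) = - ?m \<sigma>" for \<sigma> :: "'a \<Rightarrow> int"
    proof -
      have "(\<Prod>w\<in>V - {v}. real_of_int ((\<sigma>(v := - \<sigma> v)) w) ^ n w)
          = (\<Prod>w\<in>V - {v}. real_of_int (\<sigma> w) ^ n w)"
        by (rule prod.cong) auto
      then show ?thesis
        using v assms(1) by (simp add: prod.remove[of V v])
    qed
    have "sum ?m (signs V) = (\<Sum>\<sigma>\<in>signs V. ?m (\<sigma>(v := - \<sigma> v)))"
      by (rule sum.reindex_bij_witness[where i = "\<lambda>\<sigma>. \<sigma>(v := - \<sigma> v)" and j = "\<lambda>\<sigma>. \<sigma>(v := - \<sigma> v)"])
        (use v in \<open>auto simp: PiE_dflt_def\<close>)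
    also have "\<dots> = - sum ?m (signs V)"
      unfolding flip by (simp add: sum_negf)
    finally show ?thesis by simp
  qed
next
  case (scale r f)
  then show ?case by (simp add: sum_distrib_left[symmetric])
next
  case (add f g)
  then show ?case by (simp add: sum.distrib)
next
  case (cong f g)
  have "sum g (signs V) = sum f (signs V)" by (rule sum.cong) (use cong(2) in auto)
  then show ?case using cong by simp
qed

text \<open>uU + wW and uU - wW are half a sum of products of u + w, u - w with U + W, U - W, all of
  which lie in the cone. A comparison edge by edge therefore extends to products over all
  edges.\<close>

lemma character_cone_prod_pm:
  assumes "finite I"
    and "\<And>i. i \<in> I \<Longrightarrow> character_cone V (\<lambda>\<sigma>. u i \<sigma> + w i \<sigma>)"
    and "\<And>i. i \<in> I \<Longrightarrow> character_cone V (\<lambda>\<sigma>. u i \<sigma> - w i \<sigma>)"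
  shows "character_cone V (\<lambda>\<sigma>. (\<Prod>i\<in>I. u i \<sigma>) + (\<Prod>i\<in>I. w i \<sigma>))
       \<and> character_cone V (\<lambda>\<sigma>. (\<Prod>i\<in>I. u i \<sigma>) - (\<Prod>i\<in>I. w i \<sigma>))"
  using assms
proof (induction I rule: finite_induct)
  case empty
  then show ?case using character_cone_const[of 2 V] character_cone_const[of 0 V] by simp
next
  case (insert i I)
  let ?U = "\<lambda>\<sigma>. \<Prod>i\<in>I. u i \<sigma>" and ?W = "\<lambda>\<sigma>. \<Prod>i\<in>I. w i \<sigma>"
  have IH: "character_cone V (\<lambda>\<sigma>. ?U \<sigma> + ?W \<sigma>)" "character_cone V (\<lambda>\<sigma>. ?U \<sigma> - ?W \<sigma>)"
    using insert by auto
  have i: "character_cone V (\<lambda>\<sigma>. u i \<sigma> + w i \<sigma>)" "character_cone V (\<lambda>\<sigma>. u i \<sigma> - w i \<sigma>)"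
    using insert.prems by auto
  have "character_cone V (\<lambda>\<sigma>. 1/2 * ((u i \<sigma> + w i \<sigma>) * (?U \<sigma> + ?W \<sigma>) + (u i \<sigma> - w i \<sigma>) * (?U \<sigma> - ?W \<sigma>)))"
       "character_cone V (\<lambda>\<sigma>. 1/2 * ((u i \<sigma> + w i \<sigma>) * (?U \<sigma> - ?W \<sigma>) + (u i \<sigma> - w i \<sigma>) * (?U \<sigma> + ?W \<sigma>)))"
    by (intro character_cone.scale character_cone.add character_cone_mult IH i; simp)+
  moreover have "(\<lambda>\<sigma>. 1/2 * ((u i \<sigma> + w i \<sigma>) * (?U \<sigma> + ?W \<sigma>) + (u i \<sigma> - w i \<sigma>) * (?U \<sigma> - ?W \<sigma>)))
      = (\<lambda>\<sigma>. u i \<sigma> * ?U \<sigma> + w i \<sigma> * ?W \<sigma>)"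
     "(\<lambda>\<sigma>. 1/2 * ((u i \<sigma> + w i \<sigma>) * (?U \<sigma> - ?W \<sigma>) + (u i \<sigma> - w i \<sigma>) * (?U \<sigma> + ?W \<sigma>)))
      = (\<lambda>\<sigma>. u i \<sigma> * ?U \<sigma> - w i \<sigma> * ?W \<sigma>)"
    by (auto simp: field_simps)
  ultimately show ?case using insert.hyps by simp
qed

section \<open>Ising correlations of the signs and duplicated variables\<close>

text \<open>Unnormalised Ising correlation, the partition function being the case
  \<open>A = {}\<close>. Couplings enter through labels \<open>l e\<close> in a linear order, so
  that two fields of couplings have a maximum and a minimum.\<close>

definition sign_corr :: "'v set \<Rightarrow> 'v set set \<Rightarrow> ('v set \<Rightarrow> 'l \<Rightarrow> real) \<Rightarrow> ('v set \<Rightarrow> 'l \<Rightarrow> real)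
    \<Rightarrow> ('v set \<Rightarrow> 'l) \<Rightarrow> 'v set \<Rightarrow> real" where
  "sign_corr V I p q l A = (\<Sum>\<sigma>\<in>signs V. (\<Prod>v\<in>A. real_of_int (\<sigma> v))
     * (\<Prod>e\<in>I. p e (l e) + q e (l e) * (\<Prod>v\<in>e. real_of_int (\<sigma> v))))"

lemma character_cone_prod:
  assumes "finite I" "\<And>i. i \<in> I \<Longrightarrow> character_cone V (u i)"
  shows "character_cone V (\<lambda>\<sigma>. \<Prod>i\<in>I. u i \<sigma>)"
  using assms
  by (induction I rule: finite_induct) (auto intro: character_cone_const character_cone_mult)

lemma sign_corr_nonneg:
  assumes "finite V" "finite I" "\<And>e. e \<in> I \<Longrightarrow> e \<subseteq> V" "A \<subseteq> V"
    and "\<And>e. e \<in> I \<Longrightarrow> 0 \<le> p e (l e)" "\<And>e. e \<in> I \<Longrightarrow> 0 \<le> q e (l e)"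
  shows "0 \<le> sign_corr V I p q l A"
  unfolding sign_corr_def
  by (intro character_cone_sum_nonneg character_cone_mult character_cone_character
      character_cone_prod character_cone_affine assms)

lemma signs_prod_cases:
  assumes "\<sigma> \<in> signs V"
  shows "(\<Prod>v\<in>e. real_of_int (\<sigma> v)) = 1 \<or> (\<Prod>v\<in>e. real_of_int (\<sigma> v)) = -1"
proof (cases "finite e")
  case True
  have "\<sigma> v = 1 \<or> \<sigma> v = -1" for v using assms by (auto simp: PiE_dflt_def)
  then have sq: "real_of_int (\<sigma> v) * real_of_int (\<sigma> v) = 1" for v
    by (metis mult_minus_left mult_minus_right mult_1 of_int_1 of_int_minus minus_minus)
  have "(\<Prod>v\<in>e. real_of_int (\<sigma> v)) * (\<Prod>v\<in>e. real_of_int (\<sigma> v)) = 1"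
    by (simp add: prod.distrib[symmetric] sq)
  then show ?thesis by (simp add: square_eq_1_iff)
qed auto

text \<open>One edge of the duplicated system: \<alpha>, \<beta> are the coefficients at the higher
  level, \<gamma>, \<delta> those at the lower one, and \<open>t\<close> is the relative sign of the
  two copies on the edge. As \<open>x \<sigma>\<close> squares to 1, each expression is affine in
  it, and the order of the ratios makes the coefficients nonnegative. The third claim serves edges
  on which taking maximum and minimum changes nothing.\<close>

lemma ginibre_factor:
  fixes \<alpha> \<beta> \<gamma> \<delta> t :: real
  assumes V: "finite V" "e \<subseteq> V" and t: "t = 1 \<or> t = -1"
    and "0 \<le> \<beta>" "\<beta> \<le> \<alpha>" "0 \<le> \<delta>" "\<delta> \<le> \<gamma>" "\<delta> * \<alpha> \<le> \<beta> * \<gamma>"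
  defines "x \<equiv> \<lambda>\<sigma>. \<Prod>v\<in>e. real_of_int (\<sigma> v)"
  shows "character_cone V (\<lambda>\<sigma>. (\<alpha> + \<beta> * x \<sigma>) * (\<gamma> + \<delta> * (x \<sigma> * t)) + (\<gamma> + \<delta> * x \<sigma>) * (\<alpha> + \<beta> * (x \<sigma> * t)))"
    and "character_cone V (\<lambda>\<sigma>. (\<alpha> + \<beta> * x \<sigma>) * (\<gamma> + \<delta> * (x \<sigma> * t)) - (\<gamma> + \<delta> * x \<sigma>) * (\<alpha> + \<beta> * (x \<sigma> * t)))"
    and "character_cone V (\<lambda>\<sigma>. (\<alpha> + \<beta> * x \<sigma>) * (\<gamma> + \<delta> * (x \<sigma> * t)))"
proof -
  have le: "\<delta> * \<beta> \<le> \<gamma> * \<alpha>" using assms by (intro mult_mono) auto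
  have xx: "x \<sigma> = 1 \<or> x \<sigma> = -1" if "\<sigma> \<in> signs V" for \<sigma>
    unfolding x_def using that by (rule signs_prod_cases)
  have *: "character_cone V g" if "0 \<le> p" "0 \<le> q" "\<And>\<sigma>. \<sigma> \<in> signs V \<Longrightarrow> g \<sigma> = p + q * x \<sigma>" for p q g
    by (rule character_cone.cong[OF character_cone_affine[OF V that(1,2)]])
      (use that(3) in \<open>simp add: x_def\<close>)
  have nn: "0 \<le> \<gamma> * \<alpha>" "0 \<le> \<delta> * \<beta>" "0 \<le> \<delta> * \<alpha>" "0 \<le> \<gamma> * \<beta>" using assms by auto
  from t show "character_cone V (\<lambda>\<sigma>. (\<alpha> + \<beta> * x \<sigma>) * (\<gamma> + \<delta> * (x \<sigma> * t)) + (\<gamma> + \<delta> * x \<sigma>) * (\<alpha> + \<beta> * (x \<sigma> * t)))"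
  proof
    assume [simp]: "t = 1"
    show ?thesis
      by (rule *[of "2 * (\<gamma> * \<alpha> + \<delta> * \<beta>)" "2 * (\<delta> * \<alpha> + \<gamma> * \<beta>)"])
        (use nn in \<open>auto simp: algebra_simps dest!: xx\<close>)
  next
    assume [simp]: "t = -1"
    show ?thesis
      by (rule *[of "2 * (\<gamma> * \<alpha> - \<delta> * \<beta>)" "0"])
        (use nn le in \<open>auto simp: algebra_simps dest!: xx\<close>)
  qed
  from t show "character_cone V (\<lambda>\<sigma>. (\<alpha> + \<beta> * x \<sigma>) * (\<gamma> + \<delta> * (x \<sigma> * t)) - (\<gamma> + \<delta> * x \<sigma>) * (\<alpha> + \<beta> * (x \<sigma> * t)))"
  proof
    assume [simp]: "t = 1"
    show ?thesis
      by (rule *[of 0 0]) (auto simp: algebra_simps)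
  next
    assume [simp]: "t = -1"
    show ?thesis
      by (rule *[of 0 "2 * (\<beta> * \<gamma> - \<delta> * \<alpha>)"])
        (use assms(8) in \<open>auto simp: algebra_simps dest!: xx\<close>)
  qed
  from t show "character_cone V (\<lambda>\<sigma>. (\<alpha> + \<beta> * x \<sigma>) * (\<gamma> + \<delta> * (x \<sigma> * t)))"
  proof
    assume [simp]: "t = 1"
    show ?thesis
      by (rule *[of "\<gamma> * \<alpha> + \<delta> * \<beta>" "\<delta> * \<alpha> + \<gamma> * \<beta>"])
        (use nn in \<open>auto simp: algebra_simps dest!: xx\<close>)
  next
    assume [simp]: "t = -1"
    show ?thesis
      by (rule *[of "\<gamma> * \<alpha> - \<delta> * \<beta>" "\<beta> * \<gamma> - \<delta> * \<alpha>"])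
        (use nn le assms(8) in \<open>auto simp: algebra_simps dest!: xx\<close>)
  qed
qed

lemma sum_signs_twist:
  assumes "\<sigma> \<in> signs V"
  shows "(\<Sum>\<tau>\<in>signs V. f \<tau>) = (\<Sum>s\<in>signs V. f (\<lambda>v. \<sigma> v * s v))"
proof -
  have sq: "\<sigma> v * \<sigma> v = 1" for v
    using assms by (cases "v \<in> V") (auto simp: PiE_dflt_def)
  have mem: "(\<lambda>v. \<sigma> v * s v) \<in> signs V" if "s \<in> signs V" for s
    using assms that by (fastforce simp: PiE_dflt_def)
  show ?thesis
  by (rule sum.reindex_bij_witness[where i = "\<lambda>s v. \<sigma> v * s v" and j = "\<lambda>s v. \<sigma> v * s v"])
    (use mem sq in \<open>auto simp: mult.assoc[symmetric]\<close>)
qed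

text \<open>Ginibre's argument: the second copy \<tau> is written as \<sigma> times s. For each
  fixed s the difference of the two products over edges lies in the cone as a function of \<sigma>,
  and so does its product with the signs on \<open>A\<close>, which only the first copy
  carries.\<close>

theorem sign_corr_lattice:
  fixes l1 l2 :: "'v set \<Rightarrow> 'l::linorder"
  assumes V: "finite V" "finite I" "\<And>e. e \<in> I \<Longrightarrow> e \<subseteq> V" "A \<subseteq> V"
    and q: "\<And>e l. e \<in> I \<Longrightarrow> 0 \<le> q e l" "\<And>e l. e \<in> I \<Longrightarrow> q e l \<le> p e l"
    and ratio: "\<And>e l m. e \<in> I \<Longrightarrow> l \<le> m \<Longrightarrow> q e l * p e m \<le> q e m * p e l"
  shows "sign_corr V I p q l1 A * sign_corr V I p q l2 {}
    \<le> sign_corr V I p q (\<lambda>e. max (l1 e) (l2 e)) A * sign_corr V I p q (\<lambda>e. min (l1 e) (l2 e)) {}"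
proof -
  define x where "x e \<sigma> = (\<Prod>v\<in>e. real_of_int (\<sigma> v))" for e and \<sigma> :: "'v \<Rightarrow> int"
  define F where "F l \<sigma> = (\<lambda>e. p e (l e) + q e (l e) * x e \<sigma>)" for l :: "'v set \<Rightarrow> 'l" and \<sigma>
  define G where "G l m s \<sigma> = (\<lambda>e. (p e (l e) + q e (l e) * x e \<sigma>) * (p e (m e) + q e (m e) * (x e \<sigma> * x e s)))"
    for l m :: "'v set \<Rightarrow> 'l" and s \<sigma>
  have prod: "sign_corr V I p q l A * sign_corr V I p q m {}
      = (\<Sum>s\<in>signs V. \<Sum>\<sigma>\<in>signs V. x A \<sigma> * (\<Prod>e\<in>I. G l m s \<sigma> e))" for l m
  proof -
    have "sign_corr V I p q l A * sign_corr V I p q m {}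
       = (\<Sum>\<sigma>\<in>signs V. \<Sum>\<tau>\<in>signs V. x A \<sigma> * (\<Prod>e\<in>I. F l \<sigma> e) * (\<Prod>e\<in>I. F m \<tau> e))"
      by (simp add: sign_corr_def x_def F_def sum_product)
    also have "\<dots> = (\<Sum>\<sigma>\<in>signs V. \<Sum>s\<in>signs V. x A \<sigma> * (\<Prod>e\<in>I. F l \<sigma> e) * (\<Prod>e\<in>I. F m (\<lambda>v. \<sigma> v * s v) e))"
      by (intro sum.cong refl sum_signs_twist)
    also have "\<dots> = (\<Sum>\<sigma>\<in>signs V. \<Sum>s\<in>signs V. x A \<sigma> * (\<Prod>e\<in>I. G l m s \<sigma> e))"
      by (simp add: F_def G_def x_def prod.distrib mult.assoc)
    finally show ?thesis by (subst sum.swap)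
  qed
  have "0 \<le> (\<Sum>\<sigma>\<in>signs V. x A \<sigma> * ((\<Prod>e\<in>I. G (\<lambda>e. max (l1 e) (l2 e)) (\<lambda>e. min (l1 e) (l2 e)) s \<sigma> e)
      - (\<Prod>e\<in>I. G l1 l2 s \<sigma> e)))" if s: "s \<in> signs V" for s
  proof (intro character_cone_sum_nonneg character_cone_mult V(1))
    show "character_cone V (x A)"
      unfolding x_def using V by (intro character_cone_character)
    have "character_cone V (\<lambda>\<sigma>. G (\<lambda>e. max (l1 e) (l2 e)) (\<lambda>e. min (l1 e) (l2 e)) s \<sigma> e + G l1 l2 s \<sigma> e)
      \<and> character_cone V (\<lambda>\<sigma>. G (\<lambda>e. max (l1 e) (l2 e)) (\<lambda>e. min (l1 e) (l2 e)) s \<sigma> e - G l1 l2 s \<sigma> e)"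
      if e: "e \<in> I" for e
    proof -
      have t: "x e s = 1 \<or> x e s = -1" unfolding x_def using s by (rule signs_prod_cases)
      note gf = ginibre_factor[OF V(1) V(3)[OF e] t q(1)[OF e] q(2)[OF e] q(1)[OF e] q(2)[OF e] ratio[OF e],
          folded x_def]
      show ?thesis
      proof (cases "l1 e \<le> l2 e")
        case True
        then show ?thesis using gf(1,2)[OF True] by (simp add: G_def max_def min_def)
      next
        case False
        then have le: "l2 e \<le> l1 e" by simp
        have "character_cone V (\<lambda>\<sigma>. 2 * G l1 l2 s \<sigma> e)"
          unfolding G_def using gf(3)[OF le] by (intro character_cone.scale) auto
        then show ?thesis using le False character_cone_const[of 0 V]
          by (simp add: G_def max_def min_def)
      qed
    qed
    then show "character_cone V (\<lambda>\<sigma>. (\<Prod>e\<in>I. G (\<lambda>e. max (l1 e) (l2 e)) (\<lambda>e. min (l1 e) (l2 e)) s \<sigma> e)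
      - (\<Prod>e\<in>I. G l1 l2 s \<sigma> e))"
      using character_cone_prod_pm[OF V(2), of V
          "\<lambda>e \<sigma>. G (\<lambda>e. max (l1 e) (l2 e)) (\<lambda>e. min (l1 e) (l2 e)) s \<sigma> e" "\<lambda>e \<sigma>. G l1 l2 s \<sigma> e"]
      by blast
  qed
  then have "(\<Sum>\<sigma>\<in>signs V. x A \<sigma> * (\<Prod>e\<in>I. G l1 l2 s \<sigma> e))
    \<le> (\<Sum>\<sigma>\<in>signs V. x A \<sigma> * (\<Prod>e\<in>I. G (\<lambda>e. max (l1 e) (l2 e)) (\<lambda>e. min (l1 e) (l2 e)) s \<sigma> e))"
    if "s \<in> signs V" for s
    using that by (simp add: right_diff_distrib sum_subtractf)
  then show ?thesis unfolding prod by (rule sum_mono)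
qed

section \<open>Edge weights\<close>

text \<open>The Lipschitz constraint is included as weight 0, so that sums can run over full product
  boxes, the setting of the four functions theorem.\<close>

definition edge_weight :: "('v set \<Rightarrow> real) \<Rightarrow> 'v set \<Rightarrow> ('v \<Rightarrow> int) \<Rightarrow> real" where
  "edge_weight c e h = (if \<forall>v\<in>e. \<forall>w\<in>e. h v = h w then c e
     else if \<forall>v\<in>e. \<forall>w\<in>e. \<bar>h v - h w\<bar> \<le> 2 then 1 else 0)"

lemma edge_weight_pair:
  "edge_weight c {v, w} h = (if h v = h w then c {v, w} else if \<bar>h v - h w\<bar> \<le> 2 then 1 else 0)"
  by (auto simp: edge_weight_def abs_minus_commute)

lemma edge_weight_nonneg: "0 \<le> c e \<Longrightarrow> 0 \<le> edge_weight c e h"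
  by (simp add: edge_weight_def)

text \<open>If h and k are ordered alike at both ends, the two pairs are merely renamed. If they
  cross, oddness makes both gaps at least 2, and two Lipschitz functions can then cross only by an
  exact exchange, \<open>h v = k w\<close> and \<open>k v = h w\<close>. Maximum and minimum are
  constant on the edge in that case, so the right side is the square of c and the left side is
  1.\<close>

lemma edge_weight_supermodular:
  assumes "1 \<le> c {v, w}" "odd (h v)" "odd (h w)" "odd (k v)" "odd (k w)"
  shows "edge_weight c {v, w} h * edge_weight c {v, w} k
    \<le> edge_weight c {v, w} (\<lambda>u. max (h u) (k u)) * edge_weight c {v, w} (\<lambda>u. min (h u) (k u))"
proof -
  have c: "1 \<le> c {v, w} * c {v, w}" using assms(1) mult_mono[of 1 "c {v, w}" 1 "c {v, w}"] by simp
  have sq: "0 \<le> c {v, w}" using assms by auto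
  consider "h v \<le> k v" "h w \<le> k w" | "k v \<le> h v" "k w \<le> h w"
    | "h v < k v" "k w < h w" | "k v < h v" "h w < k w" by linarith
  then show ?thesis
  proof cases
    case 1
    then show ?thesis by (simp add: edge_weight_pair max_def min_def)
  next
    case 2
    then have "max (h v) (k v) = h v" "min (h v) (k v) = k v" "max (h w) (k w) = h w" "min (h w) (k w) = k w"
      by auto
    then show ?thesis by (simp add: edge_weight_pair)
  next
    case 3
    from 3 assms have *: "h v + 2 \<le> k v" "k w + 2 \<le> h w" by presburger+
    show ?thesis
    proof (cases "\<bar>h v - h w\<bar> \<le> 2 \<and> \<bar>k v - k w\<bar> \<le> 2")
      case True
      with * have "k v = h w" "h v = k w" by linarith+
      moreover from this * have "h v \<noteq> h w" "k v \<noteq> k w" by linarith+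
      ultimately show ?thesis using 3 c by (simp add: edge_weight_pair max_def min_def)
    next
      case False
      then have "edge_weight c {v, w} h * edge_weight c {v, w} k = 0"
        by (auto simp: edge_weight_pair)
      then show ?thesis using edge_weight_nonneg[of c, OF sq] by (simp only: mult_nonneg_nonneg)
    qed
  next
    case 4
    from 4 assms have *: "k v + 2 \<le> h v" "h w + 2 \<le> k w" by presburger+
    show ?thesis
    proof (cases "\<bar>h v - h w\<bar> \<le> 2 \<and> \<bar>k v - k w\<bar> \<le> 2")
      case True
      with * have "h v = k w" "k v = h w" by linarith+
      moreover from this * have "h v \<noteq> h w" "k v \<noteq> k w" by linarith+
      ultimately show ?thesis using 4 c by (simp add: edge_weight_pair max_def min_def)
    next
      case False
      then have "edge_weight c {v, w} h * edge_weight c {v, w} k = 0"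
        by (auto simp: edge_weight_pair)
      then show ?thesis using edge_weight_nonneg[of c, OF sq] by (simp only: mult_nonneg_nonneg)
    qed
  qed
qed

text \<open>Given the absolute values \<open>a\<close> of a height function, its signs interact along an edge through
  the factor \<open>level_p + level_q * x\<close>, where \<open>x\<close> is the product of the two signs: level 0 stands for
  an absent edge, level 1 for an edge on which \<open>a = 1\<close>, and on level 2 the two signs must agree.\<close>

definition level_p :: "real \<Rightarrow> nat \<Rightarrow> real" where
  "level_p r l = (if l = 0 then 1 / r else if l = 1 then (1 + 1 / r) / 2 else 1 / 2)"

definition level_q :: "real \<Rightarrow> nat \<Rightarrow> real" where
  "level_q r l = (if l = 0 then 0 else if l = 1 then (1 - 1 / r) / 2 else 1 / 2)"

definition level :: "('v \<Rightarrow> int) \<Rightarrow> 'v set \<Rightarrow> nat" where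
  "level a e = (if \<forall>v\<in>e. a v = 1 then 1 else 2)"

lemma level_q_nonneg: "1 \<le> r \<Longrightarrow> 0 \<le> level_q r l"
  by (simp add: level_q_def)

lemma level_q_le_p: "1 \<le> r \<Longrightarrow> level_q r l \<le> level_p r l"
  by (simp add: level_q_def level_p_def field_simps)

text \<open>The ratio q / p is 0 at level 0, (r - 1) / (r + 1) at level 1 and 1 from level 2 on; its
  growth is expressed without division.\<close>

lemma level_ratio:
  assumes "1 \<le> r" "l \<le> m"
  shows "level_q r l * level_p r m \<le> level_q r m * level_p r l"
proof -
  consider "l = 0" | "l = 1" "m = 1" | "l = 1" "m \<ge> 2" | "l \<ge> 2" "m \<ge> 2"
    using assms(2) by linarith
  then show ?thesis
    using assms(1) level_q_nonneg[OF assms(1), of m]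
    by cases (auto simp: level_q_def level_p_def divide_simps)
qed

text \<open>Opposite signs put the heights at distance \<open>a v + a w\<close>, which is at most 2
  only if both values are 1. The weight then drops from c to 1, which is the factor p - q = 1 / c of
  level 1; otherwise it drops to 0, which is p - q at level 2.\<close>

lemma edge_weight_signs:
  assumes "v \<noteq> w" "1 \<le> c {v, w}"
    and "odd (a v)" "odd (a w)" "1 \<le> a v" "1 \<le> a w"
    and "\<sigma> v \<in> {-1, 1}" "\<sigma> w \<in> {-1, 1}"
  shows "edge_weight c {v, w} (\<lambda>u. a u * \<sigma> u) = edge_weight c {v, w} a
    * (level_p (c {v, w}) (level a {v, w}) + level_q (c {v, w}) (level a {v, w}) * (\<Prod>u\<in>{v, w}. real_of_int (\<sigma> u)))"
proof -
  have pq: "level_p r (level a {v, w}) + level_q r (level a {v, w}) = 1" for r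
    by (auto simp: level_p_def level_q_def level_def field_simps)
  show ?thesis
  proof (cases "\<sigma> v = \<sigma> w")
    case True
    then consider "\<sigma> v = 1" "\<sigma> w = 1" | "\<sigma> v = -1" "\<sigma> w = -1" using assms(7) by auto
    then have "edge_weight c {v, w} (\<lambda>u. a u * \<sigma> u) = edge_weight c {v, w} a"
      by cases (simp_all add: edge_weight_pair abs_minus_commute)
    moreover have "(\<Prod>u\<in>{v, w}. real_of_int (\<sigma> u)) = 1"
      using assms(1,7) True by auto
    ultimately show ?thesis using pq by simp
  next
    case False
    then have opp: "\<sigma> w = - \<sigma> v" and prod: "(\<Prod>u\<in>{v, w}. real_of_int (\<sigma> u)) = -1"
      using assms(1,7,8) by auto
    have diff: "\<bar>a v * \<sigma> v - a w * \<sigma> w\<bar> = a v + a w"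
      using assms(5-7) opp by auto
    have ne: "a v * \<sigma> v \<noteq> a w * \<sigma> w" using diff assms(5,6) by auto
    show ?thesis
    proof (cases "a v = 1 \<and> a w = 1")
      case True
      then have lev: "level a {v, w} = 1" by (simp add: level_def)
      have "c {v, w} * ((1 + 1 / c {v, w}) / 2 - (1 - 1 / c {v, w}) / 2) = 1"
        using assms(2) by (simp add: field_simps)
      then show ?thesis using True diff ne unfolding prod lev edge_weight_pair
        by (simp add: level_p_def level_q_def)
    next
      case False
      then have "2 < a v + a w" "level a {v, w} = 2" using assms(5,6) by (auto simp: level_def)
      then show ?thesis using diff ne unfolding prod edge_weight_pair
        by (simp add: level_p_def level_q_def)
    qed
  qed
qed

section \<open>Height functions on finite subgraphs\<close>

text \<open>Connectedness is dropped: domains are compared through intermediate ones with isolated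
  vertices, and exhaustions have to absorb arbitrary finite sets of vertices and edges.\<close>

definition fin_subgraph :: "('v \<Rightarrow> 'v \<Rightarrow> bool) \<Rightarrow> 'v set \<times> 'v set set \<Rightarrow> bool" where
  "fin_subgraph adj D \<longleftrightarrow> finite (fst D) \<and> snd D \<subseteq> G_edges adj \<and> (\<forall>e\<in>snd D. e \<subseteq> fst D)"

locale lipschitz_graph =
  fixes adj :: "'v \<Rightarrow> 'v \<Rightarrow> bool" and c :: "'v set \<Rightarrow> real"
  assumes countable_V: "countable (UNIV :: 'v set)" and infinite_V: "infinite (UNIV :: 'v set)"
    and adj_sym: "adj v w \<Longrightarrow> adj w v" and adj_irrefl: "\<not> adj v v"
    and locally_finite: "finite {w. adj v w}"
    and connected: "adj\<^sup>*\<^sup>* v w"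
    and c_ge_1: "e \<in> G_edges adj \<Longrightarrow> 1 \<le> c e"
begin

section \<open>Boundedness and finiteness of height functions\<close>

lemma edge_cases:
  assumes "e \<in> G_edges adj"
  obtains v w where "e = {v, w}" "v \<noteq> w" "adj v w"
proof -
  from assms obtain v w where "e = {v, w}" "adj v w" by (auto simp: G_edges_def)
  then show thesis using that[of v w] adj_irrefl[of v] by auto
qed

lemma fin_subgraph_edges: "fin_subgraph adj D \<Longrightarrow> finite (snd D)"
  unfolding fin_subgraph_def by (meson finite_Pow_iff finite_subset PowI subsetI)

lemma fin_conn_imp_fin_subgraph: "fin_conn_subgraph adj D \<Longrightarrow> fin_subgraph adj D"
  by (simp add: fin_conn_subgraph_def fin_subgraph_def)

lemma neighbour_exists: "\<exists>w. adj v w"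
proof -
  obtain w where "w \<noteq> v" using infinite_V by (metis (full_types) UNIV_eq_I finite.simps insert_iff)
  then show ?thesis using connected[of v w] by (metis converse_rtranclpE)
qed

text \<open>A component that avoids the boundary would contain all edges at its vertices, hence, the
  graph being connected, the whole infinite vertex set.\<close>

lemma bdry_reachable:
  assumes D: "fin_subgraph adj D" and v: "v \<in> fst D"
  shows "\<exists>b\<in>bdry adj D. (\<lambda>a b. {a, b} \<in> snd D)\<^sup>*\<^sup>* v b"
proof (rule ccontr)
  assume no: "\<not> ?thesis"
  let ?R = "(\<lambda>a b. {a, b} \<in> snd D)\<^sup>*\<^sup>*"
  have inV: "u \<in> fst D" if "?R v u" for u
    using that v D by (induction) (auto simp: fin_subgraph_def)
  have "?R v u" if "adj\<^sup>*\<^sup>* v u" for u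
    using that
  proof induction
    case (step u w)
    then have "{u, w} \<in> snd D" using no inV[OF step.IH] by (auto simp: bdry_def)
    then show ?case using step.IH by (simp add: rtranclp.rtrancl_into_rtrancl)
  qed auto
  then have "UNIV \<subseteq> fst D" using connected inV by auto
  then show False using D infinite_V finite_subset by (auto simp: fin_subgraph_def)
qed

text \<open>Every vertex of the domain is joined inside it to the boundary, where only finitely many
  values are allowed. Stating the bound for all larger M lets two domains share one box.\<close>

lemma hconfs_bounded:
  assumes D: "fin_subgraph adj D" and B: "\<And>v. v \<in> bdry adj D \<Longrightarrow> finite (B v)"
  shows "\<exists>N. \<forall>M\<ge>N. \<forall>h\<in>hconfs adj D B. \<forall>v. \<bar>h v\<bar> \<le> M"
proof -
  have lip: "\<exists>k. \<forall>h\<in>hconfs adj D B. \<bar>h v - h u\<bar> \<le> k" if "(\<lambda>a b. {a, b} \<in> snd D)\<^sup>*\<^sup>* v u" for v u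
    using that
  proof induction
    case base
    then show ?case by (intro exI[of _ 0]) auto
  next
    case (step u w)
    then obtain k where k: "\<forall>h\<in>hconfs adj D B. \<bar>h v - h u\<bar> \<le> k" by blast
    have "\<bar>h v - h w\<bar> \<le> k + 2" if h: "h \<in> hconfs adj D B" for h
    proof -
      have "\<bar>h u - h w\<bar> \<le> 2" using h step(2) unfolding hconfs_def by blast
      then show ?thesis using k h by fastforce
    qed
    then show ?case by blast
  qed
  have "\<exists>k. \<forall>h\<in>hconfs adj D B. \<bar>h v\<bar> \<le> k" for v
  proof (cases "v \<in> fst D")
    case True
    from bdry_reachable[OF D True] obtain b where b: "b \<in> bdry adj D" "(\<lambda>a b. {a, b} \<in> snd D)\<^sup>*\<^sup>* v b"
      by blast
    obtain k where k: "\<forall>h\<in>hconfs adj D B. \<bar>h v - h b\<bar> \<le> k" using lip[OF b(2)] by blast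
    have "\<bar>h v\<bar> \<le> k + (\<Sum>x\<in>B b. \<bar>x\<bar>)" if h: "h \<in> hconfs adj D B" for h
    proof -
      have "h b \<in> B b" using h b by (auto simp: hconfs_def)
      then have "\<bar>h b\<bar> \<le> (\<Sum>x\<in>B b. \<bar>x\<bar>)"
        using B[OF b(1)] by (intro member_le_sum) auto
      then show ?thesis using k h by fastforce
    qed
    then show ?thesis by blast
  next
    case False
    then show ?thesis by (intro exI[of _ 1]) (auto simp: hconfs_def)
  qed
  then obtain k where k: "\<And>v h. h \<in> hconfs adj D B \<Longrightarrow> \<bar>h v\<bar> \<le> k v" by metis
  have "\<bar>h v\<bar> \<le> 1 + (\<Sum>u\<in>fst D. \<bar>k u\<bar>)" if h: "h \<in> hconfs adj D B" for h v
  proof (cases "v \<in> fst D")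
    case True
    then have "\<bar>k v\<bar> \<le> (\<Sum>u\<in>fst D. \<bar>k u\<bar>)"
      using D by (intro member_le_sum) (auto simp: fin_subgraph_def)
    then show ?thesis using k[OF h, of v] by linarith
  next
    case False
    then show ?thesis using h by (auto simp: hconfs_def sum_nonneg)
  qed
  then show ?thesis by (metis order_trans)
qed

lemma finite_hconfs:
  assumes D: "fin_subgraph adj D" and B: "\<And>v. v \<in> bdry adj D \<Longrightarrow> finite (B v)"
  shows "finite (hconfs adj D B)"
proof -
  obtain N where N: "\<forall>h\<in>hconfs adj D B. \<forall>v. \<bar>h v\<bar> \<le> N" using hconfs_bounded[where D = D and B = B] D B by (metis order_refl)
  have "hconfs adj D B \<subseteq> PiE_dflt (fst D) 1 (\<lambda>_. {-N..N})"
  proof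
    fix h assume h: "h \<in> hconfs adj D B"
    have "h v \<in> {-N..N}" for v using N[rule_format, OF h, of v] by (auto simp: abs_le_iff)
    then show "h \<in> PiE_dflt (fst D) 1 (\<lambda>_. {-N..N})" using h by (auto simp: hconfs_def PiE_dflt_def)
  qed
  then show ?thesis using D finite_subset
    by (metis finite_PiE_dflt finite_atLeastAtMost_int fin_subgraph_def)
qed

lemma finite_hconfs_pm1: "fin_subgraph adj D \<Longrightarrow> finite (hconfs adj D pm1)"
  by (rule finite_hconfs) (auto simp: pm1_def)

lemma hweight_pos: "fin_subgraph adj D \<Longrightarrow> 0 < hweight c D h"
  unfolding hweight_def by (intro prod_pos) (auto simp: fin_subgraph_def dest!: c_ge_1 subsetD)

lemma partition_pos:
  assumes D: "fin_subgraph adj D"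
  shows "0 < (\<Sum>h\<in>hconfs adj D pm1. hweight c D h)"
proof -
  have "(\<lambda>_. 1) \<in> hconfs adj D pm1" by (auto simp: hconfs_def pm1_def)
  then show ?thesis
    using finite_hconfs_pm1[OF D] hweight_pos[OF D] by (intro sum_pos2[of _ "\<lambda>_. 1"]) (auto intro: less_imp_le)
qed

section \<open>Summing out the signs\<close>

definition box_weight :: "'v set \<times> 'v set set \<Rightarrow> ('v \<Rightarrow> int set) \<Rightarrow> ('v \<Rightarrow> int) \<Rightarrow> real" where
  "box_weight D B h = (if (\<forall>v\<in>fst D. odd (h v)) \<and> (\<forall>v\<in>bdry adj D. h v \<in> B v)
     then \<Prod>e\<in>snd D. edge_weight c e h else 0)"

lemma box_weight_nonneg: "fin_subgraph adj D \<Longrightarrow> 0 \<le> box_weight D B h"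
  unfolding box_weight_def fin_subgraph_def
  by (auto intro!: prod_nonneg simp: edge_weight_def dest!: c_ge_1 subsetD)

lemma sum_hconfs_eq_sum_box:
  assumes D: "fin_subgraph adj D" and C: "finite C" "\<And>h v. h \<in> hconfs adj D B \<Longrightarrow> h v \<in> C"
  shows "(\<Sum>h\<in>hconfs adj D B. hweight c D h * f h)
    = (\<Sum>h\<in>PiE_dflt (fst D) 1 (\<lambda>_. C). box_weight D B h * f h)"
proof (rule sum.mono_neutral_cong_left)
  show "finite (PiE_dflt (fst D) 1 (\<lambda>_. C))"
    using D C by (auto simp: fin_subgraph_def)
  show "hconfs adj D B \<subseteq> PiE_dflt (fst D) 1 (\<lambda>_. C)"
    using C(2) by (auto simp: PiE_dflt_def) (auto simp: hconfs_def)
  show "\<forall>h\<in>PiE_dflt (fst D) 1 (\<lambda>_. C) - hconfs adj D B. box_weight D B h * f h = 0"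
  proof
    fix h assume h: "h \<in> PiE_dflt (fst D) 1 (\<lambda>_. C) - hconfs adj D B"
    show "box_weight D B h * f h = 0"
    proof (cases "(\<forall>v\<in>fst D. odd (h v)) \<and> (\<forall>v\<in>bdry adj D. h v \<in> B v)")
      case True
      with h have "\<not> (\<forall>e\<in>snd D. \<forall>v\<in>e. \<forall>w\<in>e. \<bar>h v - h w\<bar> \<le> 2)"
        by (auto simp: hconfs_def PiE_dflt_def)
      then obtain e where e: "e \<in> snd D" "\<not> (\<forall>v\<in>e. \<forall>w\<in>e. \<bar>h v - h w\<bar> \<le> 2)" by blast
      then have ne: "\<not> (\<forall>v\<in>e. \<forall>w\<in>e. h v = h w)"
        by (metis abs_zero diff_self zero_le_numeral)
      have "edge_weight c e h = 0" unfolding edge_weight_def if_not_P[OF ne] if_not_P[OF e(2)] ..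
      then have "(\<Prod>e\<in>snd D. edge_weight c e h) = 0"
        using e(1) fin_subgraph_edges[OF D] by (intro prod_zero) auto
      then show ?thesis by (simp add: box_weight_def)
    next
      case False
      then show ?thesis unfolding box_weight_def by (simp only: if_False mult_zero_left)
    qed
  qed
  fix h assume h: "h \<in> hconfs adj D B"
  have "hweight c D h = (\<Prod>e\<in>snd D. edge_weight c e h)"
    unfolding hweight_def
  proof (rule prod.cong)
    fix e assume "e \<in> snd D"
    with h have lip: "\<forall>v\<in>e. \<forall>w\<in>e. \<bar>h v - h w\<bar> \<le> 2" unfolding hconfs_def by blast
    show "(if \<forall>v\<in>e. \<forall>w\<in>e. h v = h w then c e else 1) = edge_weight c e h"
      unfolding edge_weight_def if_P[OF lip] ..
  qed simp
  then show "hweight c D h * f h = box_weight D B h * f h"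
    using h by (simp add: box_weight_def hconfs_def)
qed

text \<open>The sign product over \<open>A\<close> summed against the weights of all height
  functions with absolute value \<open>a\<close>; for \<open>A = {}\<close> this is the law of the
  absolute value up to normalisation. The condition \<open>{-1, 1}\<close> on the boundary becomes
  \<open>a = 1\<close>.\<close>

definition abs_weight :: "'v set \<times> 'v set set \<Rightarrow> ('v \<Rightarrow> int) \<Rightarrow> 'v set \<Rightarrow> real" where
  "abs_weight D a A = (if (\<forall>v\<in>fst D. odd (a v)) \<and> (\<forall>v\<in>bdry adj D. a v = 1)
     then (\<Prod>e\<in>snd D. edge_weight c e a)
       * sign_corr (fst D) (snd D) (\<lambda>e. level_p (c e)) (\<lambda>e. level_q (c e)) (level a) A
     else 0)"

lemma box_weight_signs:
  assumes D: "fin_subgraph adj D" and a: "a \<in> PiE_dflt (fst D) 1 (\<lambda>_. {1..N})" and s: "\<sigma> \<in> signs (fst D)"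
  shows "box_weight D pm1 (\<lambda>v. a v * \<sigma> v)
    = (if (\<forall>v\<in>fst D. odd (a v)) \<and> (\<forall>v\<in>bdry adj D. a v = 1)
       then (\<Prod>e\<in>snd D. edge_weight c e a)
         * (\<Prod>e\<in>snd D. level_p (c e) (level a e) + level_q (c e) (level a e) * (\<Prod>v\<in>e. real_of_int (\<sigma> v)))
       else 0)"
proof -
  have \<sigma>: "\<sigma> v = -1 \<or> \<sigma> v = 1" for v using s by (auto simp: PiE_dflt_def)
  have a1: "1 \<le> a v" for v using a by (cases "v \<in> fst D") (auto simp: PiE_dflt_def)
  have odd: "\<not> even (\<sigma> v)" for v using \<sigma>[of v] by auto
  have pm: "a v * \<sigma> v \<in> pm1 v \<longleftrightarrow> a v = 1" for v using \<sigma>[of v] a1[of v] by (auto simp: pm1_def)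
  have "(\<Prod>e\<in>snd D. edge_weight c e (\<lambda>v. a v * \<sigma> v)) = (\<Prod>e\<in>snd D. edge_weight c e a *
     (level_p (c e) (level a e) + level_q (c e) (level a e) * (\<Prod>v\<in>e. real_of_int (\<sigma> v))))"
    if "\<forall>v\<in>fst D. odd (a v)"
  proof (rule prod.cong)
    fix e assume e: "e \<in> snd D"
    then have eG: "e \<in> G_edges adj" and eV: "e \<subseteq> fst D" using D by (auto simp: fin_subgraph_def)
    from eG obtain v w where vw: "e = {v, w}" "v \<noteq> w" "adj v w" by (rule edge_cases)
    show "edge_weight c e (\<lambda>v. a v * \<sigma> v) = edge_weight c e a *
     (level_p (c e) (level a e) + level_q (c e) (level a e) * (\<Prod>v\<in>e. real_of_int (\<sigma> v)))"
      unfolding vw(1)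
      by (rule edge_weight_signs) (use vw that eV a1 \<sigma> c_ge_1[OF eG] in auto)
  qed auto
  then show ?thesis by (auto simp: box_weight_def odd pm prod.distrib)
qed

lemma sum_hconfs_eq_sum_abs:
  assumes D: "fin_subgraph adj D" and N: "\<forall>h\<in>hconfs adj D pm1. \<forall>v. \<bar>h v\<bar> \<le> N"
  shows "(\<Sum>h\<in>hconfs adj D pm1. hweight c D h * ((\<Prod>v\<in>A. real_of_int (sgn (h v))) * \<phi> (\<lambda>v. \<bar>h v\<bar>)))
    = (\<Sum>a\<in>PiE_dflt (fst D) 1 (\<lambda>_. {1..N}). \<phi> a * abs_weight D a A)"
proof -
  let ?f = "\<lambda>h. (\<Prod>v\<in>A. real_of_int (sgn (h v))) * \<phi> (\<lambda>v. \<bar>h v\<bar>)"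
  let ?P = "PiE_dflt (fst D) (1::int) (\<lambda>_. {-N..N})"
  let ?Q = "PiE_dflt (fst D) (1::int) (\<lambda>_. {1..N})"
  let ?F = "\<lambda>a \<sigma>. \<Prod>e\<in>snd D. level_p (c e) (level a e) + level_q (c e) (level a e) * (\<Prod>v\<in>e. real_of_int (\<sigma> v))"
  have fin: "finite (fst D)" using D by (simp add: fin_subgraph_def)
  have "(\<Sum>h\<in>hconfs adj D pm1. hweight c D h * ?f h) = (\<Sum>h\<in>?P. box_weight D pm1 h * ?f h)"
  proof (rule sum_hconfs_eq_sum_box[OF D])
    fix h v assume "h \<in> hconfs adj D pm1"
    with N have "\<bar>h v\<bar> \<le> N" by blast
    then show "h v \<in> {-N..N}" by auto
  qed simp
  \<comment> \<open>Odd heights do not vanish, so the splitting into absolute value and sign is a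
    bijection on the configurations that are kept.\<close>
  also have "\<dots> = (\<Sum>h\<in>{h \<in> ?P. \<forall>v. h v \<noteq> 0}. box_weight D pm1 h * ?f h)"
  proof (rule sum.mono_neutral_right)
    show "\<forall>h\<in>?P - {h \<in> ?P. \<forall>v. h v \<noteq> 0}. box_weight D pm1 h * ?f h = 0"
    proof
      fix h assume "h \<in> ?P - {h \<in> ?P. \<forall>v. h v \<noteq> 0}"
      then obtain v where "h v = 0" "h \<in> ?P" by auto
      then have "v \<in> fst D \<and> even (h v)" by (cases "v \<in> fst D") (auto simp: PiE_dflt_def)
      then show "box_weight D pm1 h * ?f h = 0" by (auto simp: box_weight_def)
    qed
  qed (use fin in auto)
  also have "\<dots> = (\<Sum>(a, \<sigma>)\<in>?Q \<times> signs (fst D). box_weight D pm1 (\<lambda>v. a v * \<sigma> v) * ?f (\<lambda>v. a v * \<sigma> v))"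
  proof (rule sum.reindex_bij_witness[where j = "\<lambda>h. (\<lambda>v. \<bar>h v\<bar>, \<lambda>v. sgn (h v))"
        and i = "\<lambda>(a, \<sigma>) v. a v * \<sigma> v"], goal_cases)
    case (2 h)
    have "\<bar>h v\<bar> \<in> {1..N} \<and> sgn (h v) \<in> {-1, 1}" if "v \<in> fst D" for v
    proof -
      have "h v \<in> {-N..N}" "h v \<noteq> 0" using 2 that by (auto simp: PiE_dflt_def)
      then show ?thesis by (auto simp: sgn_if)
    qed
    moreover have "h v = 1" if "v \<notin> fst D" for v using 2 that by (auto simp: PiE_dflt_def)
    ultimately show ?case by (simp add: PiE_dflt_def)
  next
    case (3 p)
    obtain a \<sigma> where p: "p = (a, \<sigma>)" "a \<in> ?Q" "\<sigma> \<in> signs (fst D)" using 3 by auto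
    have "\<sigma> v = -1 \<or> \<sigma> v = 1" "1 \<le> a v" for v
      using p by (cases "v \<in> fst D"; auto simp: PiE_dflt_def)+
    note * = this
    have "\<bar>a v * \<sigma> v\<bar> = a v \<and> sgn (a v * \<sigma> v) = \<sigma> v" for v
      using *(1)[of v] *(2)[of v] by auto
    then show ?case using p by auto
  next
    case (4 p)
    obtain a \<sigma> where p: "p = (a, \<sigma>)" "a \<in> ?Q" "\<sigma> \<in> signs (fst D)" using 4 by auto
    have "a v * \<sigma> v \<noteq> 0" for v
      using p by (cases "v \<in> fst D") (auto simp: PiE_dflt_def)
    moreover have "a v * \<sigma> v \<in> {-N..N}" if "v \<in> fst D" for v
    proof -
      have "a v \<in> {1..N}" "\<sigma> v \<in> {-1,1}" using p that by (auto simp: PiE_dflt_def)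
      then show ?thesis by auto
    qed
    moreover have "a v * \<sigma> v = 1" if "v \<notin> fst D" for v
      using p that by (auto simp: PiE_dflt_def)
    ultimately show ?case using p(1) by (auto simp: PiE_dflt_def)
  qed (auto simp: abs_mult_sgn)
  also have "\<dots> = (\<Sum>a\<in>?Q. \<Sum>\<sigma>\<in>signs (fst D). box_weight D pm1 (\<lambda>v. a v * \<sigma> v) * ?f (\<lambda>v. a v * \<sigma> v))"
    by (simp add: sum.cartesian_product)
  also have "\<dots> = (\<Sum>a\<in>?Q. \<phi> a * abs_weight D a A)"
  proof (rule sum.cong)
    fix a assume a: "a \<in> ?Q"
    have "(\<Sum>\<sigma>\<in>signs (fst D). box_weight D pm1 (\<lambda>v. a v * \<sigma> v) * ?f (\<lambda>v. a v * \<sigma> v))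
      = (\<Sum>\<sigma>\<in>signs (fst D). (if (\<forall>v\<in>fst D. odd (a v)) \<and> (\<forall>v\<in>bdry adj D. a v = 1)
       then (\<Prod>e\<in>snd D. edge_weight c e a) * ?F a \<sigma> else 0) * ((\<Prod>v\<in>A. real_of_int (\<sigma> v)) * \<phi> a))"
    proof (rule sum.cong)
      fix \<sigma> assume s: "\<sigma> \<in> signs (fst D)"
      have \<sigma>: "\<sigma> v = -1 \<or> \<sigma> v = 1" for v using s by (auto simp: PiE_dflt_def)
      have a1: "1 \<le> a v" for v using a by (cases "v \<in> fst D") (auto simp: PiE_dflt_def)
      have "\<bar>a v * \<sigma> v\<bar> = a v" "sgn (a v * \<sigma> v) = \<sigma> v" for v
        using \<sigma>[of v] a1[of v] by auto
      then show "box_weight D pm1 (\<lambda>v. a v * \<sigma> v) * ?f (\<lambda>v. a v * \<sigma> v)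
        = (if (\<forall>v\<in>fst D. odd (a v)) \<and> (\<forall>v\<in>bdry adj D. a v = 1)
       then (\<Prod>e\<in>snd D. edge_weight c e a) * ?F a \<sigma> else 0) * ((\<Prod>v\<in>A. real_of_int (\<sigma> v)) * \<phi> a)"
        unfolding box_weight_signs[OF D a s] by simp
    qed simp
    also have "\<dots> = \<phi> a * abs_weight D a A"
      unfolding abs_weight_def sign_corr_def
      by (cases "(\<forall>v\<in>fst D. odd (a v)) \<and> (\<forall>v\<in>bdry adj D. a v = 1)")
        (simp_all only: if_P if_not_P if_True if_False sum_distrib_left mult_ac mult_zero_left mult_zero_right sum.neutral_const)
    finally show "(\<Sum>\<sigma>\<in>signs (fst D). box_weight D pm1 (\<lambda>v. a v * \<sigma> v) * ?f (\<lambda>v. a v * \<sigma> v))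
      = \<phi> a * abs_weight D a A" .
  qed simp
  finally show ?thesis .
qed


section \<open>Comparing the weights of absolute values for two edge sets\<close>

lemma level_corr_nonneg:
  assumes "fin_subgraph adj D" "A \<subseteq> fst D"
  shows "0 \<le> sign_corr (fst D) (snd D) (\<lambda>e. level_p (c e)) (\<lambda>e. level_q (c e)) l A"
proof (rule sign_corr_nonneg)
  fix e assume "e \<in> snd D"
  then have c: "1 \<le> c e" using assms(1) c_ge_1 by (auto simp: fin_subgraph_def)
  show "0 \<le> level_q (c e) (l e)" by (rule level_q_nonneg[OF c])
  then show "0 \<le> level_p (c e) (l e)" using level_q_le_p[OF c, of "l e"] by linarith
qed (use assms fin_subgraph_edges[OF assms(1)] in \<open>auto simp: fin_subgraph_def\<close>)

text \<open>Rewriting the weight of the smaller edge set over the larger one: every additional edge has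
  both ends on the boundary, where \<open>a = 1\<close>, so it contributes \<open>c e\<close> to the edge weights and
  \<open>1 / c e\<close> to the sign correlation.\<close>

lemma abs_weight_extend:
  assumes D': "fin_subgraph adj (V, E')" and E: "E \<subseteq> E'"
  shows "abs_weight (V, E) a A = (if (\<forall>v\<in>V. odd (a v)) \<and> (\<forall>v\<in>bdry adj (V, E). a v = 1)
     then (\<Prod>e\<in>E'. edge_weight c e a)
       * sign_corr V E' (\<lambda>e. level_p (c e)) (\<lambda>e. level_q (c e)) (\<lambda>e. if e \<in> E then level a e else 0) A
     else 0)"
proof (cases "(\<forall>v\<in>V. odd (a v)) \<and> (\<forall>v\<in>bdry adj (V, E). a v = 1)")
  case True
  have fin: "finite E'" using fin_subgraph_edges[OF D'] by simp
  have "edge_weight c e a = c e" if "e \<in> E' - E" for e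
  proof -
    have "e \<in> G_edges adj" "e \<subseteq> V" using that D' by (auto simp: fin_subgraph_def)
    then obtain v w where vw: "e = {v, w}" "v \<noteq> w" "adj v w" "v \<in> V" "w \<in> V" by (metis edge_cases insert_subset)
    then have "v \<in> bdry adj (V, E)" "w \<in> bdry adj (V, E)"
      using that adj_sym[OF vw(3)] by (auto simp: bdry_def insert_commute)
    then show ?thesis using True vw(1) by (simp add: edge_weight_pair)
  qed
  then have "(\<Prod>e\<in>E' - E. edge_weight c e a) = (\<Prod>e\<in>E' - E. c e)" by (rule prod.cong[OF refl])
  then have w: "(\<Prod>e\<in>E'. edge_weight c e a) = (\<Prod>e\<in>E' - E. c e) * (\<Prod>e\<in>E. edge_weight c e a)"
    using prod.subset_diff[OF E fin, of "\<lambda>e. edge_weight c e a"] by simp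
  have "(\<Prod>e\<in>E'. level_p (c e) (if e \<in> E then level a e else 0) + level_q (c e) (if e \<in> E then level a e else 0) * x e)
     = (\<Prod>e\<in>E' - E. 1 / c e) * (\<Prod>e\<in>E. level_p (c e) (level a e) + level_q (c e) (level a e) * x e)" for x
    using prod.subset_diff[OF E fin, of "\<lambda>e. level_p (c e) (if e \<in> E then level a e else 0)
      + level_q (c e) (if e \<in> E then level a e else 0) * x e"]
    by (simp add: level_p_def[of _ 0] level_q_def[of _ 0])
  then have s: "sign_corr V E' (\<lambda>e. level_p (c e)) (\<lambda>e. level_q (c e)) (\<lambda>e. if e \<in> E then level a e else 0) A
     = (\<Prod>e\<in>E' - E. 1 / c e) * sign_corr V E (\<lambda>e. level_p (c e)) (\<lambda>e. level_q (c e)) (level a) A"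
    unfolding sign_corr_def by (simp add: sum_distrib_left mult_ac)
  have one: "(\<Prod>e\<in>E' - E. c e) * (\<Prod>e\<in>E' - E. 1 / c e) = (\<Prod>e\<in>E' - E. 1)"
    unfolding prod.distrib[symmetric]
  proof (rule prod.cong)
    fix e assume "e \<in> E' - E"
    then have "1 \<le> c e" using c_ge_1 D' by (auto simp: fin_subgraph_def)
    then show "c e * (1 / c e) = 1" by simp
  qed simp
  have "(\<Prod>e\<in>E' - E. c e) * P * ((\<Prod>e\<in>E' - E. 1 / c e) * S) = P * S" for P S
  proof -
    have "(\<Prod>e\<in>E' - E. c e) * P * ((\<Prod>e\<in>E' - E. 1 / c e) * S)
        = ((\<Prod>e\<in>E' - E. c e) * (\<Prod>e\<in>E' - E. 1 / c e)) * (P * S)" by (simp only: mult_ac)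
    then show ?thesis unfolding one by simp
  qed
  then show ?thesis unfolding abs_weight_def w s using True by simp
next
  case False
  then show ?thesis unfolding abs_weight_def fst_conv snd_conv by (simp only: if_False)
qed

lemma edge_weights_supermodular:
  assumes D: "fin_subgraph adj D" and "\<And>v. v \<in> fst D \<Longrightarrow> odd (a v)" "\<And>v. v \<in> fst D \<Longrightarrow> odd (b v)"
  shows "(\<Prod>e\<in>snd D. edge_weight c e a) * (\<Prod>e\<in>snd D. edge_weight c e b)
    \<le> (\<Prod>e\<in>snd D. edge_weight c e (\<lambda>v. max (a v) (b v))) * (\<Prod>e\<in>snd D. edge_weight c e (\<lambda>v. min (a v) (b v)))"
  unfolding prod.distrib[symmetric]
proof (rule prod_mono)
  fix e assume "e \<in> snd D"
  then have e: "e \<in> G_edges adj" "e \<subseteq> fst D" using D by (auto simp: fin_subgraph_def)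
  from e(1) obtain v w where vw: "e = {v, w}" "v \<noteq> w" "adj v w" by (rule edge_cases)
  have c1: "1 \<le> c e" by (rule c_ge_1[OF e(1)])
  have nn: "0 \<le> edge_weight c e h" for h using c1 by (intro edge_weight_nonneg) simp
  have "edge_weight c e a * edge_weight c e b
      \<le> edge_weight c e (\<lambda>v. max (a v) (b v)) * edge_weight c e (\<lambda>v. min (a v) (b v))"
    unfolding vw(1) by (rule edge_weight_supermodular) (use assms vw e c1 in auto)
  then show "0 \<le> edge_weight c e a * edge_weight c e b \<and> edge_weight c e a * edge_weight c e b
      \<le> edge_weight c e (\<lambda>v. max (a v) (b v)) * edge_weight c e (\<lambda>v. min (a v) (b v))"
    using nn by simp
qed

text \<open>This is the hypothesis of the four functions theorem for E against E'. Written over E',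
  each weight is a product of edge weights times a sign correlation with level 0 outside E. The edge
  weights are supermodular and the correlations obey Ginibre's inequality; it remains to compare the
  maximum and minimum of the levels with the levels of the maximum and minimum.\<close>

lemma abs_weight_lattice:
  assumes D': "fin_subgraph adj (V, E')" and E: "E \<subseteq> E'" and A: "A \<subseteq> V"
    and a1: "\<And>v. 1 \<le> a v" and b1: "\<And>v. 1 \<le> b v"
  shows "abs_weight (V, E) a A * abs_weight (V, E') b {}
    \<le> abs_weight (V, E') (\<lambda>v. max (a v) (b v)) A * abs_weight (V, E) (\<lambda>v. min (a v) (b v)) {}"
proof -
  let ?M = "\<lambda>v. max (a v) (b v)" and ?m = "\<lambda>v. min (a v) (b v)"
  let ?adm = "\<lambda>E a. (\<forall>v\<in>V. odd (a v)) \<and> (\<forall>v\<in>bdry adj (V, E). a v = 1)"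
  let ?p = "\<lambda>e. level_p (c e)" and ?q = "\<lambda>e. level_q (c e)"
  let ?S = "sign_corr V E' ?p ?q"
  let ?W = "\<lambda>a. \<Prod>e\<in>E'. edge_weight c e a"
  let ?l = "\<lambda>a e. if e \<in> E then level a e else 0"
  have D: "fin_subgraph adj (V, E)" using D' E by (auto simp: fin_subgraph_def)
  have fin: "finite V" "finite E'" using D' fin_subgraph_edges[OF D'] by (auto simp: fin_subgraph_def)
  have c1: "1 \<le> c e" if "e \<in> E'" for e using that D' c_ge_1 by (auto simp: fin_subgraph_def)
  have W0: "0 \<le> ?W a" for a
    by (intro prod_nonneg edge_weight_nonneg) (use c1 in \<open>force intro: order_trans[of 0 1]\<close>)
  have S0: "0 \<le> ?S l B" if "B \<subseteq> V" for l B
    using level_corr_nonneg[OF D', of B l] that by simp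
  have ext': "abs_weight (V, E') a A = (if ?adm E' a then ?W a * ?S (level a) A else 0)" for a A
    unfolding abs_weight_def by simp
  have aw0: "0 \<le> abs_weight (V, E') a A" "0 \<le> abs_weight (V, E) a {}" for a
    unfolding ext' abs_weight_extend[OF D' E] using W0 S0 A by auto
  show ?thesis
  proof (cases "?adm E a \<and> ?adm E' b")
    case False
    then consider "abs_weight (V, E) a A = 0" | "abs_weight (V, E') b {} = 0"
      unfolding abs_weight_def fst_conv snd_conv by meson
    then show ?thesis using aw0 by cases simp_all
  next
    case True
    have bd: "bdry adj (V, E') \<subseteq> bdry adj (V, E)" using E by (auto simp: bdry_def)
    have M: "?adm E' ?M" using True bd by (auto simp: max_def)
    have "b v \<ge> 1" "a v \<ge> 1" for v using a1 b1 by auto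
    then have m: "?adm E ?m" using True by (auto simp: min_def)
    \<comment> \<open>On an edge of E' outside E both ends lie on the boundary of
      \<open>(V, E)\<close>; there \<open>a = 1\<close>, so the maximum equals
      \<open>b\<close>.\<close>
    have maxl: "?S (\<lambda>e. max (?l a e) (level b e)) A = ?S (level ?M) A"
    proof -
      have "max (?l a e) (level b e) = level ?M e" if "e \<in> E'" for e
      proof -
        have M1: "max (a v) (b v) = 1 \<longleftrightarrow> a v = 1 \<and> b v = 1" for v using a1[of v] b1[of v] by auto
        show ?thesis
        proof (cases "e \<in> E")
          case True
          then show ?thesis unfolding level_def M1 by (auto simp: max_def)
        next
          case False
          have "e \<in> G_edges adj" "e \<subseteq> V" using that D' by (auto simp: fin_subgraph_def)
          then obtain v w where vw: "e = {v, w}" "v \<noteq> w" "adj v w" "v \<in> V" "w \<in> V" by (metis edge_cases insert_subset)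
          then have "v \<in> bdry adj (V, E)" "w \<in> bdry adj (V, E)"
            using False adj_sym[OF vw(3)] by (auto simp: bdry_def insert_commute)
          then have "\<forall>u\<in>e. a u = 1" using True vw by auto
          then show ?thesis using False unfolding level_def M1 by auto
        qed
      qed
      then show ?thesis unfolding sign_corr_def by simp
    qed
    \<comment> \<open>Equality can fail: if \<open>a\<close> exceeds 1 at one end only and
      \<open>b\<close> only at the other, both levels are 2 while the minimum is 1 at both ends and
      has level 1. Passing from level 2 to level 1 lowers no edge factor, and since no sign product
      is present, a comparison term by term suffices.\<close>
    have minl: "?S (\<lambda>e. min (?l a e) (level b e)) {} \<le> ?S (?l ?m) {}"
      unfolding sign_corr_def
    proof (intro sum_mono mult_left_mono prod_mono conjI)
      fix \<sigma> e assume s: "\<sigma> \<in> signs V" and e: "e \<in> E'"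
      let ?x = "\<Prod>v\<in>e. real_of_int (\<sigma> v)"
      have x: "?x = 1 \<or> ?x = -1" by (rule signs_prod_cases[OF s])
      have "0 \<le> ?p e l + ?q e l * ?x" for l
        using x level_q_le_p[OF c1[OF e], of l] level_q_nonneg[OF c1[OF e], of l] by auto
      then show "0 \<le> ?p e (min (?l a e) (level b e)) + ?q e (min (?l a e) (level b e)) * ?x" .
      have "min (?l a e) (level b e) = ?l ?m e \<or> (?l ?m e = 1 \<and> min (?l a e) (level b e) = 2)"
      proof -
        have m1: "min (a v) (b v) = 1 \<longleftrightarrow> a v = 1 \<or> b v = 1" for v using a1[of v] b1[of v] by auto
        show ?thesis unfolding level_def m1 by auto
      qed
      moreover have "?p e 2 + ?q e 2 * ?x \<le> ?p e 1 + ?q e 1 * ?x"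
        using x c1[OF e] by (auto simp: level_p_def level_q_def field_simps)
      ultimately show "?p e (min (?l a e) (level b e)) + ?q e (min (?l a e) (level b e)) * ?x
         \<le> ?p e (?l ?m e) + ?q e (?l ?m e) * ?x" by auto
    qed auto
    have W: "?W a * ?W b \<le> ?W ?M * ?W ?m"
      using edge_weights_supermodular[OF D', of a b] True by auto
    have "?S (?l a) A * ?S (level b) {}
       \<le> ?S (\<lambda>e. max (?l a e) (level b e)) A * ?S (\<lambda>e. min (?l a e) (level b e)) {}"
      by (rule sign_corr_lattice)
        (use fin A D' in \<open>auto simp: fin_subgraph_def intro!: level_q_nonneg level_q_le_p level_ratio c1\<close>)
    also have "\<dots> \<le> ?S (level ?M) A * ?S (?l ?m) {}"
      unfolding maxl using S0 A by (intro mult_left_mono minl) auto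
    finally have S: "?S (?l a) A * ?S (level b) {} \<le> ?S (level ?M) A * ?S (?l ?m) {}" .
    have "abs_weight (V, E) a A * abs_weight (V, E') b {} = (?W a * ?W b) * (?S (?l a) A * ?S (level b) {})"
      unfolding ext' abs_weight_extend[OF D' E] using True by (simp add: mult_ac)
    also have "\<dots> \<le> (?W ?M * ?W ?m) * (?S (level ?M) A * ?S (?l ?m) {})"
      by (rule mult_mono[OF W S]) (use W0 S0 A in auto)
    also have "\<dots> = abs_weight (V, E') ?M A * abs_weight (V, E) ?m {}"
      unfolding ext' abs_weight_extend[OF D' E] using M m by (simp add: mult_ac)
    finally show ?thesis .
  qed
qed

section \<open>Monotonicity of expectations in the domain\<close>

definition char_obs :: "'v set \<Rightarrow> (('v \<Rightarrow> int) \<Rightarrow> real) \<Rightarrow> ('v \<Rightarrow> int) \<Rightarrow> real" where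
  "char_obs A \<phi> h = (\<Prod>v\<in>A. real_of_int (sgn (h v))) * \<phi> (\<lambda>v. \<bar>h v\<bar>)"

text \<open>With denominators cleared this is the four functions inequality for the absolute values:
  the factor \<phi> and the sign product pass from \<open>a\<close> to the maximum, and \<phi> can
  only grow.\<close>

lemma hexp_mono_edges:
  assumes D': "fin_subgraph adj (V, E')" and E: "E \<subseteq> E'" and A: "A \<subseteq> V"
    and \<phi>: "mono \<phi>" "\<And>a. 0 \<le> \<phi> a"
  shows "hexp adj c (V, E) pm1 (char_obs A \<phi>) \<le> hexp adj c (V, E') pm1 (char_obs A \<phi>)"
proof -
  have D: "fin_subgraph adj (V, E)" using D' E by (auto simp: fin_subgraph_def)
  have "\<exists>N. \<forall>M\<ge>N. \<forall>h\<in>hconfs adj (V, E) pm1. \<forall>v. \<bar>h v\<bar> \<le> M"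
       "\<exists>N. \<forall>M\<ge>N. \<forall>h\<in>hconfs adj (V, E') pm1. \<forall>v. \<bar>h v\<bar> \<le> M"
    by (rule hconfs_bounded; use D D' in \<open>auto simp: pm1_def\<close>)+
  then obtain N1 N2 where "\<forall>M\<ge>N1. \<forall>h\<in>hconfs adj (V, E) pm1. \<forall>v. \<bar>h v\<bar> \<le> M"
    "\<forall>M\<ge>N2. \<forall>h\<in>hconfs adj (V, E') pm1. \<forall>v. \<bar>h v\<bar> \<le> M" by auto
  then have N: "\<forall>h\<in>hconfs adj (V, E) pm1. \<forall>v. \<bar>h v\<bar> \<le> max N1 N2"
    "\<forall>h\<in>hconfs adj (V, E') pm1. \<forall>v. \<bar>h v\<bar> \<le> max N1 N2" by (meson max.cobounded1 max.cobounded2)+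
  let ?N = "max N1 N2"
  let ?Q = "PiE_dflt V (1::int) (\<lambda>_. {1..?N})"
  have num: "(\<Sum>h\<in>hconfs adj (V, F) pm1. hweight c (V, F) h * char_obs B \<psi> h)
     = (\<Sum>a\<in>?Q. \<psi> a * abs_weight (V, F) a B)" if "F = E \<or> F = E'" for F B \<psi>
    using sum_hconfs_eq_sum_abs[of "(V, F)" ?N B \<psi>] that N D D' unfolding char_obs_def by auto
  have den: "(\<Sum>h\<in>hconfs adj (V, F) pm1. hweight c (V, F) h) = (\<Sum>a\<in>?Q. abs_weight (V, F) a {})"
    if "F = E \<or> F = E'" for F
    using num[OF that, of "{}" "\<lambda>_. 1"] by (simp add: char_obs_def)
  have aw0: "0 \<le> abs_weight (V, F) a B" if "F = E \<or> F = E'" "B \<subseteq> V" for F a B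
  proof -
    have F: "fin_subgraph adj (V, F)" using that D D' by auto
    have "0 \<le> (\<Prod>e\<in>F. edge_weight c e a)"
    proof (intro prod_nonneg edge_weight_nonneg)
      fix e assume "e \<in> F"
      then have "1 \<le> c e" using F c_ge_1 by (auto simp: fin_subgraph_def)
      then show "0 \<le> c e" by simp
    qed
    then show ?thesis
      using level_corr_nonneg[OF F, of B "level a"] that(2) unfolding abs_weight_def by simp
  qed
  have "(\<Sum>a\<in>?Q. \<phi> a * abs_weight (V, E) a A) * (\<Sum>a\<in>?Q. abs_weight (V, E') a {})
    \<le> (\<Sum>a\<in>?Q. \<phi> a * abs_weight (V, E') a A) * (\<Sum>a\<in>?Q. abs_weight (V, E) a {})"
  proof (rule four_functions)
    show "finite V" using D by (simp add: fin_subgraph_def)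
    fix a b assume ab: "a \<in> ?Q" "b \<in> ?Q"
    have 1: "1 \<le> a v" "1 \<le> b v" for v using ab by (cases "v \<in> V"; auto simp: PiE_dflt_def)+
    let ?M = "\<lambda>v. max (a v) (b v)" and ?m = "\<lambda>v. min (a v) (b v)"
    have "\<phi> a \<le> \<phi> ?M" by (rule monoD[OF \<phi>(1)]) (auto simp: le_fun_def)
    then have "\<phi> a * (abs_weight (V, E) a A * abs_weight (V, E') b {})
       \<le> \<phi> ?M * (abs_weight (V, E') ?M A * abs_weight (V, E) ?m {})"
      by (rule mult_mono[OF _ abs_weight_lattice[OF D' E A 1]])
        (use \<phi> A in \<open>auto intro!: mult_nonneg_nonneg aw0\<close>)
    then show "\<phi> a * abs_weight (V, E) a A * abs_weight (V, E') b {}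
       \<le> \<phi> ?M * abs_weight (V, E') ?M A * abs_weight (V, E) ?m {}" by (simp add: mult_ac)
  qed (use \<phi> A in \<open>auto intro!: mult_nonneg_nonneg aw0\<close>)
  then show ?thesis
    using partition_pos[OF D] partition_pos[OF D']
    unfolding hexp_def num[OF disjI1[OF refl]] num[OF disjI2[OF refl]] den[OF disjI1[OF refl]] den[OF disjI2[OF refl]]
    by (simp add: divide_simps mult.commute)
qed

text \<open>A new vertex is isolated in the enlarged subgraph but has a neighbour in the graph, so
  it is a boundary vertex with a free value in \<open>{-1, 1}\<close>. Numerator and denominator are
  multiplied by the same number of sign patterns.\<close>

lemma hexp_extend_vertices:
  assumes D: "fin_subgraph adj (V, E)" and V': "finite V'" "V \<subseteq> V'"
    and f: "\<And>h k. (\<And>v. v \<in> V \<Longrightarrow> h v = k v) \<Longrightarrow> f h = f k"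
  shows "hexp adj c (V', E) pm1 f = hexp adj c (V, E) pm1 f"
proof -
  have EV: "e \<subseteq> V" if "e \<in> E" for e using that D by (auto simp: fin_subgraph_def)
  have bd: "bdry adj (V', E) = bdry adj (V, E) \<union> (V' - V)"
    using neighbour_exists EV V'(2) by (fastforce simp: bdry_def)
  have key: "(\<Sum>h\<in>hconfs adj (V', E) pm1. hweight c (V', E) h * g h)
     = real (card (signs (V' - V))) * (\<Sum>h\<in>hconfs adj (V, E) pm1. hweight c (V, E) h * g h)"
    if g: "\<And>h k. (\<And>v. v \<in> V \<Longrightarrow> h v = k v) \<Longrightarrow> g h = g k" for g :: "('v \<Rightarrow> int) \<Rightarrow> real"
  proof -
    have "(\<Sum>h\<in>hconfs adj (V', E) pm1. hweight c (V', E) h * g h)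
      = (\<Sum>(s, h)\<in>signs (V' - V) \<times> hconfs adj (V, E) pm1. hweight c (V, E) h * g h)"
    proof (rule sum.reindex_bij_witness[where
          j = "\<lambda>h. (\<lambda>v. if v \<in> V' - V then h v else 1, \<lambda>v. if v \<in> V then h v else 1)"
          and i = "\<lambda>(s, h) v. if v \<in> V then h v else s v"], goal_cases)
      case (1 h)
      then show ?case using V' by (auto simp: hconfs_def fun_eq_iff)
    next
      case (2 h)
      then show ?case using bd EV unfolding hconfs_def PiE_dflt_def pm1_def
        by (auto simp: subset_iff)
    next
      case (3 p)
      then show ?case by (auto simp: PiE_dflt_def hconfs_def fun_eq_iff)
    next
      case (4 p)
      obtain s h where p: "p = (s, h)" "s \<in> signs (V' - V)" "h \<in> hconfs adj (V, E) pm1" using 4 by auto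
      let ?h = "\<lambda>v. if v \<in> V then h v else s v"
      have "odd (?h v)" for v using p(2,3) by (cases "v \<in> V"; cases "v \<in> V'") (auto simp: PiE_dflt_def hconfs_def)
      moreover have "?h v = 1" if "v \<notin> V'" for v using that V' p by (auto simp: PiE_dflt_def)
      moreover have "\<bar>?h v - ?h w\<bar> \<le> 2" if "e \<in> E" "v \<in> e" "w \<in> e" for e v w
        using EV[OF that(1)] that p(3) unfolding hconfs_def by auto
      moreover have "?h v \<in> pm1 v" if "v \<in> bdry adj (V', E)" for v
        using that p(2,3) unfolding bd by (auto simp: PiE_dflt_def hconfs_def pm1_def bdry_def)
      ultimately show ?case using p(1) by (simp add: hconfs_def)
    next
      case (5 h)
      have "hweight c (V, E) (\<lambda>v. if v \<in> V then h v else 1) = hweight c (V', E) h"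
        unfolding hweight_def snd_conv
      proof (rule prod.cong)
        fix e assume "e \<in> E"
        then have "e \<subseteq> V" by (rule EV)
        then have "(\<forall>v\<in>e. \<forall>w\<in>e. (if v \<in> V then h v else 1) = (if w \<in> V then h w else 1))
          \<longleftrightarrow> (\<forall>v\<in>e. \<forall>w\<in>e. h v = h w)"
          by (intro ball_cong) (auto simp: subset_iff)
        then show "(if \<forall>v\<in>e. \<forall>w\<in>e. (if v \<in> V then h v else 1) = (if w \<in> V then h w else 1) then c e else 1)
          = (if \<forall>v\<in>e. \<forall>w\<in>e. h v = h w then c e else 1)" by (simp only:)
      qed simp
      moreover have "g (\<lambda>v. if v \<in> V then h v else 1) = g h" by (rule g) simp
      ultimately show ?case by simp
    qed
    then show ?thesis by (simp add: sum.cartesian_product[symmetric])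
  qed
  have "card (signs (V' - V)) > 0" using V' by (simp add: card_gt_0_iff finite_PiE_dflt)
  then show ?thesis unfolding hexp_def using key[OF f] key[of "\<lambda>_. 1"] by simp
qed

theorem hexp_mono:
  assumes D: "fin_subgraph adj D" and D': "fin_subgraph adj D'"
    and sub: "fst D \<subseteq> fst D'" "snd D \<subseteq> snd D'" and A: "A \<subseteq> fst D"
    and \<phi>: "mono \<phi>" "\<And>a. 0 \<le> \<phi> a"
    and dep: "\<And>a b. (\<And>v. v \<in> fst D \<Longrightarrow> a v = b v) \<Longrightarrow> \<phi> a = \<phi> b"
  shows "hexp adj c D pm1 (char_obs A \<phi>) \<le> hexp adj c D' pm1 (char_obs A \<phi>)"
proof -
  obtain V E where [simp]: "D = (V, E)" by (cases D)
  obtain V' E' where [simp]: "D' = (V', E')" by (cases D')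
  have "hexp adj c (V, E) pm1 (char_obs A \<phi>) = hexp adj c (V', E) pm1 (char_obs A \<phi>)"
  proof (rule hexp_extend_vertices[symmetric])
    fix h k :: "'v \<Rightarrow> int" assume eq: "\<And>v. v \<in> V \<Longrightarrow> h v = k v"
    have "\<phi> (\<lambda>v. \<bar>h v\<bar>) = \<phi> (\<lambda>v. \<bar>k v\<bar>)" by (rule dep) (use eq in auto)
    moreover have "(\<Prod>v\<in>A. real_of_int (sgn (h v))) = (\<Prod>v\<in>A. real_of_int (sgn (k v)))"
      by (rule prod.cong) (use eq A in auto)
    ultimately show "char_obs A \<phi> h = char_obs A \<phi> k" by (simp add: char_obs_def)
  qed (use D D' sub in \<open>auto simp: fin_subgraph_def\<close>)
  also have "\<dots> \<le> hexp adj c (V', E') pm1 (char_obs A \<phi>)"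
    by (rule hexp_mono_edges) (use D' sub A \<phi> in auto)
  finally show ?thesis by simp
qed

end

section \<open>Exponential decay of the height at a vertex\<close>

context lipschitz_graph
begin

lemma hexp_le:
  assumes "fin_subgraph adj D" "\<And>h. h \<in> hconfs adj D pm1 \<Longrightarrow> f h \<le> g h"
  shows "hexp adj c D pm1 f \<le> hexp adj c D pm1 g"
  unfolding hexp_def using partition_pos[OF assms(1)] hweight_pos[OF assms(1)] assms(2)
  by (intro divide_right_mono sum_mono mult_left_mono) (auto intro: less_imp_le)

lemma hexp_cong:
  assumes "\<And>h. h \<in> hconfs adj D B \<Longrightarrow> f h = g h"
  shows "hexp adj c D B f = hexp adj c D B g"
  unfolding hexp_def using assms by (simp cong: sum.cong)

lemma hexp_const: "fin_subgraph adj D \<Longrightarrow> hexp adj c D pm1 (\<lambda>_. r) = r"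
  using partition_pos[of D] by (simp add: hexp_def sum_distrib_right[symmetric])

lemma hexp_add: "hexp adj c D B (\<lambda>h. f h + g h) = hexp adj c D B f + hexp adj c D B g"
  by (simp add: hexp_def distrib_left sum.distrib add_divide_distrib)

lemma hexp_scale: "hexp adj c D B (\<lambda>h. r * f h) = r * hexp adj c D B f"
  by (simp add: hexp_def sum_distrib_left mult_ac)

lemma hexp_sum: "hexp adj c D B (\<lambda>h. \<Sum>i\<in>I. f i h) = (\<Sum>i\<in>I. hexp adj c D B (f i))"
  by (simp add: hexp_def sum_distrib_left sum_divide_distrib)
    (rule sum.swap)

lemma hexp_nonneg:
  "fin_subgraph adj D \<Longrightarrow> (\<And>h. h \<in> hconfs adj D pm1 \<Longrightarrow> 0 \<le> f h) \<Longrightarrow> 0 \<le> hexp adj c D pm1 f"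
  using hexp_le[of D "\<lambda>_. 0" f] hexp_const[of D 0] by simp

lemma hprob_le:
  assumes "fin_subgraph adj D" "\<And>h. h \<in> hconfs adj D pm1 \<Longrightarrow> P h \<Longrightarrow> Q h"
  shows "hprob adj c D pm1 P \<le> hprob adj c D pm1 Q"
  unfolding hprob_def by (rule hexp_le[OF assms(1)]) (use assms(2) in auto)

lemma hprob_nonneg: "fin_subgraph adj D \<Longrightarrow> 0 \<le> hprob adj c D pm1 P"
  unfolding hprob_def by (rule hexp_nonneg) auto

lemma hexp_flip:
  assumes D: "fin_subgraph adj D"
  shows "hexp adj c D pm1 f = hexp adj c D pm1 (\<lambda>h. f (\<lambda>v. if v \<in> fst D then - h v else 1))"
proof -
  \<comment> \<open>The flip spares the vertices outside the domain, where heights are pinned to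
    1.\<close>
  let ?F = "\<lambda>h v. if v \<in> fst D then - h v else 1 :: int"
  have EV: "e \<subseteq> fst D" if "e \<in> snd D" for e using that D by (auto simp: fin_subgraph_def)
  have mem: "?F h \<in> hconfs adj D pm1" if h: "h \<in> hconfs adj D pm1" for h
  proof -
    have "\<bar>?F h v - ?F h w\<bar> \<le> 2" if "e \<in> snd D" "v \<in> e" "w \<in> e" for e v w
    proof -
      have "\<bar>h v - h w\<bar> \<le> 2" using h that unfolding hconfs_def by blast
      then show ?thesis using EV[OF that(1)] that by (auto simp: abs_le_iff)
    qed
    then show ?thesis using h by (auto simp: hconfs_def pm1_def bdry_def)
  qed
  have w: "hweight c D (?F h) = hweight c D h" for h
    unfolding hweight_def
  proof (rule prod.cong)
    fix e assume "e \<in> snd D"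
    then have "e \<subseteq> fst D" by (rule EV)
    then have "(\<forall>v\<in>e. \<forall>w\<in>e. ?F h v = ?F h w) \<longleftrightarrow> (\<forall>v\<in>e. \<forall>w\<in>e. h v = h w)"
      by (intro ball_cong) (auto simp: subset_iff)
    then show "(if \<forall>v\<in>e. \<forall>w\<in>e. ?F h v = ?F h w then c e else 1)
          = (if \<forall>v\<in>e. \<forall>w\<in>e. h v = h w then c e else 1)" by (simp only:)
  qed simp
  have "?F (?F h) = h" if "h \<in> hconfs adj D pm1" for h
    using that by (auto simp: hconfs_def)
  then have "(\<Sum>h\<in>hconfs adj D pm1. hweight c D h * f h) = (\<Sum>h\<in>hconfs adj D pm1. hweight c D h * f (?F h))"
    by (intro sum.reindex_bij_witness[where i = ?F and j = ?F]) (use mem w in auto)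
  then show ?thesis by (simp add: hexp_def)
qed

section \<open>Tails of the height at one vertex\<close>

definition tail :: "'v set \<times> 'v set set \<Rightarrow> 'v \<Rightarrow> int \<Rightarrow> real" where
  "tail D x d = hprob adj c D pm1 (\<lambda>h. h x \<ge> d)"

lemma hprob_lower_tail:
  assumes D: "fin_subgraph adj D" and x: "x \<in> fst D"
  shows "hprob adj c D pm1 (\<lambda>h. h x \<le> - d) = tail D x d"
  unfolding tail_def hprob_def
  by (subst hexp_flip[OF D]) (use x in \<open>simp add: le_minus_iff\<close>)

lemma tail_1:
  assumes D: "fin_subgraph adj D" and x: "x \<in> fst D"
  shows "tail D x 1 = 1 / 2"
proof -
  have "tail D x 1 + hprob adj c D pm1 (\<lambda>h. h x \<le> -1) = hexp adj c D pm1 (\<lambda>_. 1)"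
    unfolding tail_def hprob_def hexp_add[symmetric]
  proof (rule hexp_cong)
    fix h assume "h \<in> hconfs adj D pm1"
    then have "odd (h x)" using x by (auto simp: hconfs_def)
    then have "h x \<noteq> 0" by auto
    then show "(if 1 \<le> h x then 1 else 0) + (if h x \<le> - 1 then 1 else 0) = (1::real)" by auto
  qed
  then show ?thesis using hprob_lower_tail[OF D x, of 1] hexp_const[OF D, of 1] by simp
qed

text \<open>The four functions theorem is applied to a height function and a second one lowered by \<open>2 j\<close>;
  since \<open>j \<ge> 1\<close>, the lowered one lies below the first on the boundary, so that the maximum satisfies
  the original boundary condition and the minimum the lowered one.\<close>

lemma tail_log_concave:
  assumes D: "fin_subgraph adj D" and x: "x \<in> fst D" and j: "1 \<le> j" and d: "1 + 2 * j \<le> d"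
  shows "tail D x 1 * tail D x d \<le> tail D x (d - 2 * j) * tail D x (1 + 2 * j)"
proof -
  obtain N where N: "\<And>h v. h \<in> hconfs adj D pm1 \<Longrightarrow> \<bar>h v\<bar> \<le> N"
    using hconfs_bounded[of D pm1] D by (force simp: pm1_def)
  \<comment> \<open>Large enough for heights within N and for the same heights lowered by
    2j.\<close>
  define M where "M = N + 2 * j"
  let ?P = "PiE_dflt (fst D) (1::int) (\<lambda>_. {-M..M})"
  \<comment> \<open>The second configuration is stored in lowered form; \<open>sh\<close> raises it
    back to an actual height function.\<close>
  define sh where "sh h = (\<lambda>v. if v \<in> fst D then h v + 2 * j else h v)" for h :: "'v \<Rightarrow> int"
  let ?bw = "box_weight D pm1"
  let ?i = "\<lambda>d h. if d \<le> h x then 1 else 0 :: real"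
  let ?Z = "\<Sum>h\<in>hconfs adj D pm1. hweight c D h"
  have bd: "bdry adj D \<subseteq> fst D" by (auto simp: bdry_def)
  have Z: "?Z > 0" by (rule partition_pos[OF D])
  have T: "?Z * tail D x d = (\<Sum>h\<in>?P. ?bw h * ?i d h)" for d
  proof -
    have "?Z * tail D x d = (\<Sum>h\<in>hconfs adj D pm1. hweight c D h * ?i d h)"
      using Z by (simp add: tail_def hprob_def hexp_def)
    also have "\<dots> = (\<Sum>h\<in>?P. ?bw h * ?i d h)"
    proof (rule sum_hconfs_eq_sum_box[OF D])
      fix h v assume "h \<in> hconfs adj D pm1"
      from N[OF this, of v] j show "h v \<in> {-M..M}" by (auto simp: M_def)
    qed simp
    finally show ?thesis .
  qed
  have T': "?Z * tail D x d = (\<Sum>h\<in>?P. ?bw (sh h) * ?i (d - 2 * j) h)" for d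
  proof -
    have "?Z * tail D x d = (\<Sum>h\<in>hconfs adj D pm1. hweight c D h * ?i d h)"
      using Z by (simp add: tail_def hprob_def hexp_def)
    also have "\<dots> = (\<Sum>h\<in>PiE_dflt (fst D) 1 (\<lambda>_. insert 1 {-M + 2 * j..M + 2 * j}). ?bw h * ?i d h)"
    proof (rule sum_hconfs_eq_sum_box[OF D])
      fix h v assume "h \<in> hconfs adj D pm1"
      from N[OF this, of v] j show "h v \<in> insert 1 {-M + 2 * j..M + 2 * j}" by (auto simp: M_def)
    qed simp
    \<comment> \<open>The inserted 1 is the value outside the domain; it already lies in the
      interval because the constant height 1 forces N >= 1.\<close>
    also have "insert 1 {-M + 2 * j..M + 2 * j} = {-M + 2 * j..M + 2 * j}"
    proof -
      have "(\<lambda>_. 1) \<in> hconfs adj D pm1" by (auto simp: hconfs_def pm1_def)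
      from N[OF this] j show ?thesis by (auto simp: M_def)
    qed
    also have "(\<Sum>h\<in>PiE_dflt (fst D) 1 (\<lambda>_. {-M + 2 * j..M + 2 * j}). ?bw h * ?i d h)
       = (\<Sum>h\<in>?P. ?bw (sh h) * ?i (d - 2 * j) h)"
    proof (rule sum.reindex_bij_witness[where i = sh and
          j = "\<lambda>h v. if v \<in> fst D then h v - 2 * j else h v"])
      fix h assume "h \<in> PiE_dflt (fst D) 1 (\<lambda>_. {-M + 2 * j..M + 2 * j})"
      then show "(\<lambda>v. if v \<in> fst D then h v - 2 * j else h v) \<in> ?P"
        by (force simp: PiE_dflt_def)
    next
      fix h assume "h \<in> ?P"
      then show "sh h \<in> PiE_dflt (fst D) 1 (\<lambda>_. {-M + 2 * j..M + 2 * j})"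
        by (force simp: PiE_dflt_def sh_def)
    next
      fix h assume "h \<in> PiE_dflt (fst D) 1 (\<lambda>_. {-M + 2 * j..M + 2 * j})"
      have "sh (\<lambda>v. if v \<in> fst D then h v - 2 * j else h v) = h" by (auto simp: sh_def)
      then show "?bw (sh (\<lambda>v. if v \<in> fst D then h v - 2 * j else h v))
          * ?i (d - 2 * j) (\<lambda>v. if v \<in> fst D then h v - 2 * j else h v) = ?bw h * ?i d h"
        using x by simp
    qed (auto simp: sh_def)
    finally show ?thesis .
  qed
  have sw: "(\<Prod>e\<in>snd D. edge_weight c e (sh h)) = (\<Prod>e\<in>snd D. edge_weight c e h)" for h
  proof (rule prod.cong)
    fix e assume "e \<in> snd D"
    then have e: "e \<in> G_edges adj" "e \<subseteq> fst D" using D by (auto simp: fin_subgraph_def)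
    from e(1) obtain v w where vw: "e = {v, w}" "v \<noteq> w" "adj v w" by (rule edge_cases)
    have "sh h v = h v + 2 * j" "sh h w = h w + 2 * j" using e(2) vw(1) by (auto simp: sh_def)
    then show "edge_weight c e (sh h) = edge_weight c e h" unfolding vw(1) edge_weight_pair by simp
  qed simp
  \<comment> \<open>The maximum inherits \<open>d - 2 * j \<le> b x\<close>. As
    \<open>d - 2 * j \<ge> 1\<close>, the minimum is at least 1 at \<open>x\<close>, which means at
    least 1 + 2j once it is raised.\<close>
  have "(\<Sum>h\<in>?P. ?bw h * ?i 1 h) * (\<Sum>h\<in>?P. ?bw (sh h) * ?i (d - 2 * j) h)
    \<le> (\<Sum>h\<in>?P. ?bw h * ?i (d - 2 * j) h) * (\<Sum>h\<in>?P. ?bw (sh h) * ?i 1 h)"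
  proof (rule four_functions)
    show "finite (fst D)" using D by (simp add: fin_subgraph_def)
    fix a b assume "a \<in> ?P" "b \<in> ?P"
    let ?M = "\<lambda>v. max (a v) (b v)" and ?m = "\<lambda>v. min (a v) (b v)"
    let ?W = "\<lambda>h. \<Prod>e\<in>snd D. edge_weight c e h"
    show "?bw a * ?i 1 a * (?bw (sh b) * ?i (d - 2 * j) b)
       \<le> ?bw ?M * ?i (d - 2 * j) ?M * (?bw (sh ?m) * ?i 1 ?m)"
    proof (cases "(\<forall>v\<in>fst D. odd (a v)) \<and> (\<forall>v\<in>bdry adj D. a v \<in> pm1 v) \<and> 1 \<le> a x
        \<and> (\<forall>v\<in>fst D. odd (sh b v)) \<and> (\<forall>v\<in>bdry adj D. sh b v \<in> pm1 v) \<and> d - 2 * j \<le> b x")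
      case True
      have bo: "odd (b v)" if "v \<in> fst D" for v using True that by (auto simp: sh_def)
      have le: "b v \<le> a v" if "v \<in> bdry adj D" for v
      proof -
        have "v \<in> fst D" "a v \<in> pm1 v" "sh b v \<in> pm1 v" using True that bd by auto
        then show ?thesis using j by (auto simp: sh_def pm1_def)
      qed
      have "(\<forall>v\<in>fst D. odd (?M v)) \<and> (\<forall>v\<in>bdry adj D. ?M v \<in> pm1 v)"
        using True bo le by (auto simp: max_absorb1) (auto simp: max_def split: if_splits)
      then have M: "?bw ?M = ?W ?M"
        unfolding box_weight_def by simp
      have "sh ?m v = sh b v" if "v \<in> bdry adj D" for v
        using le[OF that] by (simp add: sh_def min_absorb2)
      moreover have "odd (sh ?m v)" if "v \<in> fst D" for v
        using True bo that by (auto simp: sh_def min_def)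
      ultimately have m: "?bw (sh ?m) = ?W ?m"
        using True unfolding box_weight_def sw by simp
      have "?bw a * ?i 1 a * (?bw (sh b) * ?i (d - 2 * j) b) = ?W a * ?W b"
        using True unfolding box_weight_def sw by simp
      also have "\<dots> \<le> ?W ?M * ?W ?m"
        by (rule edge_weights_supermodular[OF D]) (use True bo in auto)
      also have "\<dots> = ?bw ?M * ?i (d - 2 * j) ?M * (?bw (sh ?m) * ?i 1 ?m)"
      proof -
        have "d - 2 * j \<le> ?M x" "1 \<le> ?m x" using True d by linarith+
        then show ?thesis unfolding M m by simp
      qed
      finally show ?thesis .
    next
      case False
      then have "?bw a * ?i 1 a * (?bw (sh b) * ?i (d - 2 * j) b) = 0"
        unfolding box_weight_def by auto
      then show ?thesis by (simp only:) (simp add: box_weight_nonneg[OF D])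
    qed
  qed (simp_all add: box_weight_nonneg[OF D])
  then have "(?Z * tail D x 1) * (?Z * tail D x d) \<le> (?Z * tail D x (d - 2 * j)) * (?Z * tail D x (1 + 2 * j))"
    unfolding T'[of d] T'[of "1 + 2 * j"] T[of 1] T[of "d - 2 * j"] by simp
  then have "?Z\<^sup>2 * (tail D x 1 * tail D x d) \<le> ?Z\<^sup>2 * (tail D x (d - 2 * j) * tail D x (1 + 2 * j))"
    by (simp add: power2_eq_square mult_ac)
  then show ?thesis using Z by simp
qed

lemma tail_geometric:
  assumes D: "fin_subgraph adj D" and x: "x \<in> fst D" and j: "1 \<le> j" and "tail D x (1 + 2 * j) \<le> 1 / 4"
  shows "tail D x (1 + 2 * j * int m) \<le> (1 / 2) ^ m"
proof (induction m)
  case 0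
  then show ?case using tail_1[OF D x] by simp
next
  case (Suc m)
  have "tail D x 1 * tail D x (1 + 2 * j * int (Suc m))
      \<le> tail D x (1 + 2 * j * int (Suc m) - 2 * j) * tail D x (1 + 2 * j)"
    by (rule tail_log_concave[OF D x j]) (use j in \<open>simp add: algebra_simps\<close>)
  also have "1 + 2 * j * int (Suc m) - 2 * j = 1 + 2 * j * int m" by (simp add: algebra_simps)
  also have "tail D x (1 + 2 * j * int m) * tail D x (1 + 2 * j) \<le> (1 / 2) ^ m * (1 / 4)"
    by (intro mult_mono Suc assms) (auto simp: tail_def hprob_nonneg[OF D])
  finally show ?case by (simp add: tail_1[OF D x])
qed

lemma summable_square_geometric: "summable (\<lambda>m. (real m + 1)\<^sup>2 * (1 / 2) ^ m)"
proof (rule summable_ratio_test[where c = "3/4" and N = 4])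
  fix m :: nat assume "4 \<le> m"
  then have m: "4 \<le> real m" by simp
  \<comment> \<open>A ratio of at most 3/4 amounts to m^2 - 2m - 5 >= 0, and the left side is (m -
    4)(m + 2) + 3; hence the start at 4.\<close>
  have "2 * (real m + 2)\<^sup>2 \<le> 3 * (real m + 1)\<^sup>2"
  proof -
    have "0 \<le> (real m - 4) * (real m + 2) + 3" using m by simp
    then show ?thesis by (simp add: power2_eq_square algebra_simps)
  qed
  then have "2 * (real m + 2)\<^sup>2 * (1/2) ^ m \<le> 3 * (real m + 1)\<^sup>2 * (1/2) ^ m"
    by (rule mult_right_mono) simp
  then show "norm ((real (Suc m) + 1)\<^sup>2 * (1 / 2) ^ Suc m) \<le> 3 / 4 * norm ((real m + 1)\<^sup>2 * (1 / 2) ^ m)"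
    by (simp add: abs_mult add.commute)
qed simp

text \<open>Depends on j alone, so one bound serves all domains. Absolute values are cut into layers
  of length 2j: layer m starts at 1 + 2jm and stays below (1 + 2j)(m + 1) or reaches it, and the
  factor 2 accounts for the two tails.\<close>

definition moment_bound :: "int \<Rightarrow> real" where
  "moment_bound j = (\<Sum>m. 2 * (1 + 2 * real_of_int j)\<^sup>2 * ((real m + 1)\<^sup>2 * (1 / 2) ^ m))"

lemma second_moment_bound:
  assumes D: "fin_subgraph adj D" and x: "x \<in> fst D" and j: "1 \<le> j" and t: "tail D x (1 + 2 * j) \<le> 1 / 4"
  shows "hexp adj c D pm1 (\<lambda>h. (real_of_int (h x))\<^sup>2) \<le> moment_bound j"
proof -
  obtain N where N: "\<And>h v. h \<in> hconfs adj D pm1 \<Longrightarrow> \<bar>h v\<bar> \<le> N"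
    using hconfs_bounded[of D pm1] D by (force simp: pm1_def)
  let ?M = "nat N"
  let ?I = "\<lambda>m h. if 1 + 2 * j * int m \<le> \<bar>h x\<bar> then 1 else 0 :: real"
  let ?C = "2 * (1 + 2 * real_of_int j)\<^sup>2"
  have "hexp adj c D pm1 (\<lambda>h. (real_of_int (h x))\<^sup>2)
     \<le> hexp adj c D pm1 (\<lambda>h. \<Sum>m\<le>?M. (1 + 2 * real_of_int j)\<^sup>2 * (real m + 1)\<^sup>2 * ?I m h)"
  proof (rule hexp_le[OF D])
    fix h assume h: "h \<in> hconfs adj D pm1"
    then have "odd (h x)" using x by (auto simp: hconfs_def)
    then have h1: "1 \<le> \<bar>h x\<bar>" by (cases "h x = 0") auto
    define m where "m = nat ((\<bar>h x\<bar> - 1) div (2 * j))"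
    have im: "int m = (\<bar>h x\<bar> - 1) div (2 * j)"
      unfolding m_def using h1 j by (simp add: pos_imp_zdiv_nonneg_iff)
    have lo: "1 + 2 * j * int m \<le> \<bar>h x\<bar>"
      using j mult_div_mod_eq[of "2 * j" "\<bar>h x\<bar> - 1"] pos_mod_sign[of "2 * j" "\<bar>h x\<bar> - 1"] unfolding im by linarith
    have hi: "\<bar>h x\<bar> \<le> 1 + 2 * j * (int m + 1)"
      using j mult_div_mod_eq[of "2 * j" "\<bar>h x\<bar> - 1"] pos_mod_bound[of "2 * j" "\<bar>h x\<bar> - 1"] unfolding im distrib_left
      by linarith
    have "int m \<le> 2 * j * int m" using j mult_right_mono[of 1 "2 * j" "int m"] by simp
    then have mM: "m \<le> ?M" using lo N[OF h, of x] by linarith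
    have "\<bar>h x\<bar> \<le> (1 + 2 * j) * (int m + 1)"
      using hi by (simp add: algebra_simps)
    then have "real_of_int \<bar>h x\<bar> \<le> real_of_int ((1 + 2 * j) * (int m + 1))" by (simp only: of_int_le_iff)
    then have "(real_of_int \<bar>h x\<bar>)\<^sup>2 \<le> ((1 + 2 * real_of_int j) * (real m + 1))\<^sup>2"
      by (intro power_mono) auto
    then have "(real_of_int (h x))\<^sup>2 \<le> (1 + 2 * real_of_int j)\<^sup>2 * (real m + 1)\<^sup>2 * ?I m h"
      using lo by (simp add: power_mult_distrib)
    also have "\<dots> \<le> (\<Sum>m\<le>?M. (1 + 2 * real_of_int j)\<^sup>2 * (real m + 1)\<^sup>2 * ?I m h)"
      by (rule member_le_sum) (use mM in auto)
    finally show "(real_of_int (h x))\<^sup>2 \<le> (\<Sum>m\<le>?M. (1 + 2 * real_of_int j)\<^sup>2 * (real m + 1)\<^sup>2 * ?I m h)" .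
  qed
  also have "\<dots> = (\<Sum>m\<le>?M. (1 + 2 * real_of_int j)\<^sup>2 * (real m + 1)\<^sup>2 * hexp adj c D pm1 (?I m))"
    by (simp add: hexp_sum hexp_scale)
  also have "\<dots> \<le> (\<Sum>m\<le>?M. ?C * ((real m + 1)\<^sup>2 * (1 / 2) ^ m))"
  proof (rule sum_mono)
    fix m
    have "hexp adj c D pm1 (?I m) \<le> hexp adj c D pm1 (\<lambda>h. (if 1 + 2 * j * int m \<le> h x then 1 else 0)
       + (if h x \<le> - (1 + 2 * j * int m) then 1 else 0))"
      by (rule hexp_le[OF D]) auto
    also have "\<dots> = 2 * tail D x (1 + 2 * j * int m)"
      using hprob_lower_tail[OF D x, of "1 + 2 * j * int m"] unfolding hexp_add tail_def hprob_def by simp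
    also have "\<dots> \<le> 2 * (1 / 2) ^ m" using tail_geometric[OF D x j t, of m] by simp
    finally have "(1 + 2 * real_of_int j)\<^sup>2 * (real m + 1)\<^sup>2 * hexp adj c D pm1 (?I m)
       \<le> (1 + 2 * real_of_int j)\<^sup>2 * (real m + 1)\<^sup>2 * (2 * (1 / 2) ^ m)"
      by (intro mult_left_mono) auto
    then show "(1 + 2 * real_of_int j)\<^sup>2 * (real m + 1)\<^sup>2 * hexp adj c D pm1 (?I m)
       \<le> ?C * ((real m + 1)\<^sup>2 * (1 / 2) ^ m)" by (simp add: mult_ac)
  qed
  also have "\<dots> \<le> moment_bound j"
    unfolding moment_bound_def
    by (rule sum_le_suminf) (auto intro!: summable_mult summable_square_geometric)
  finally show ?thesis .
qed

end

section \<open>The Markov property\<close>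

context lipschitz_graph
begin

text \<open>All edges at \<open>V\<close> belong to the domain, so an edge not inside
  \<open>V\<close> meets \<open>V\<close> only in boundary vertices, where the height is fixed to
  \<xi>. The configurations inside and outside can thus be chosen independently and the weight
  factorises. Both probabilities on the domain contain the same outer factor and differ only by the
  inner ratio.\<close>

lemma hprob_markov:
  fixes \<xi> \<eta> :: "'v \<Rightarrow> int"
  assumes D: "fin_subgraph adj D" and V: "V \<subseteq> fst D"
    and inner: "\<And>v w. v \<in> V \<Longrightarrow> adj v w \<Longrightarrow> {v, w} \<in> snd D"
  shows "hprob adj c D pm1 (\<lambda>h. (\<forall>v\<in>V. h v = \<eta> v) \<and> (\<forall>v\<in>bdry adj (induced adj V). h v = \<xi> v))
    = hprob adj c D pm1 (\<lambda>h. \<forall>v\<in>bdry adj (induced adj V). h v = \<xi> v)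
      * hprob adj c (induced adj V) (\<lambda>v. {\<xi> v}) (\<lambda>h. \<forall>v\<in>V. h v = \<eta> v)"
proof -
  let ?I = "induced adj V"
  let ?b = "bdry adj ?I"
  let ?E = "{e \<in> G_edges adj. e \<subseteq> V}"
  define R where "R = {h \<in> hconfs adj D pm1. \<forall>v\<in>?b. h v = \<xi> v}"
  define inn where "inn h = (\<lambda>v. if v \<in> V then h v else 1)" for h :: "'v \<Rightarrow> int"
  define out where "out h = (\<lambda>v. if v \<in> V then 1 else h v)" for h :: "'v \<Rightarrow> int"
  define glue where "glue = (\<lambda>(k, u) v. if v \<in> V then k v else u v :: int)"
  \<comment> \<open>On the boundary of \<open>V\<close> the values \<xi> restore what
    \<open>out\<close> erased; the remaining edges do not meet the rest of \<open>V\<close>.\<close>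
  define w_out where "w_out u = (\<Prod>e\<in>snd D - ?E. if \<forall>v\<in>e. \<forall>w\<in>e. (if v \<in> V then \<xi> v else u v) = (if w \<in> V then \<xi> w else u w)
     then c e else 1)" for u :: "'v \<Rightarrow> int"
  have I: "fin_subgraph adj ?I"
    using D V finite_subset by (auto simp: fin_subgraph_def induced_def)
  have finI: "finite (hconfs adj ?I (\<lambda>v. {\<xi> v}))" by (rule finite_hconfs[OF I]) simp
  have ED: "?E \<subseteq> snd D"
  proof
    fix e assume "e \<in> ?E"
    then obtain v w where "e = {v, w}" "adj v w" "v \<in> V" by (auto elim!: edge_cases)
    then show "e \<in> snd D" using inner by simp
  qed
  have finD: "finite (snd D)" by (rule fin_subgraph_edges[OF D])
  have bV: "?b \<subseteq> V" by (auto simp: bdry_def induced_def)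
  have not_bd: "v \<notin> bdry adj D" if "v \<in> V" for v using that inner by (auto simp: bdry_def)
  have touch: "v \<in> ?b" if "e \<in> snd D - ?E" "v \<in> e" "v \<in> V" for e v
  proof -
    have "e \<in> G_edges adj" using that D by (auto simp: fin_subgraph_def)
    then obtain x y where xy: "e = {x, y}" "x \<noteq> y" "adj x y" by (rule edge_cases)
    define w where "w = (if v = x then y else x)"
    have w: "e = {v, w}" "adj v w" using xy that(2) adj_sym by (auto simp: w_def)
    then show ?thesis using that by (auto simp: bdry_def induced_def)
  qed
  have inn_mem: "inn h \<in> hconfs adj ?I (\<lambda>v. {\<xi> v})" if "h \<in> R" for h
  proof -
    have "\<bar>h v - h w\<bar> \<le> 2" if "e \<in> ?E" "v \<in> e" "w \<in> e" for e v w
      using \<open>h \<in> R\<close> that ED unfolding R_def hconfs_def by blast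
    then show ?thesis using \<open>h \<in> R\<close> V bV unfolding hconfs_def R_def inn_def
      by (auto simp: induced_def subset_iff)
  qed
  have glue_mem: "glue (k, out h) \<in> R" if k: "k \<in> hconfs adj ?I (\<lambda>v. {\<xi> v})" and h: "h \<in> R" for k h
  proof -
    have kb: "k v = \<xi> v" if "v \<in> ?b" for v using k that by (auto simp: hconfs_def)
    have hb: "h v = \<xi> v" if "v \<in> ?b" for v using h that by (auto simp: R_def)
    have g: "glue (k, out h) v = (if v \<in> V then k v else h v)" for v by (simp add: glue_def out_def)
    have "\<bar>glue (k, out h) v - glue (k, out h) w\<bar> \<le> 2" if e: "e \<in> snd D" "v \<in> e" "w \<in> e" for e v w
    proof (cases "e \<in> ?E")
      case True
      then have "\<bar>k v - k w\<bar> \<le> 2" using k e unfolding hconfs_def induced_def by auto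
      then show ?thesis using True e unfolding g by (auto simp: subset_iff)
    next
      case False
      have "\<bar>h v - h w\<bar> \<le> 2" using h e unfolding R_def hconfs_def by blast
      moreover have "glue (k, out h) u = h u" if "u \<in> e" for u
        unfolding g using touch[of e u] e False that kb hb by auto
      ultimately show ?thesis using e by simp
    qed
    moreover have "odd (k v)" if "v \<in> V" for v using k that by (auto simp: hconfs_def induced_def)
    ultimately show ?thesis using h V kb bV not_bd unfolding R_def hconfs_def g by (auto simp: g)
  qed
  have weight: "hweight c D h = hweight c ?I (inn h) * w_out (out h)" if h: "h \<in> R" for h
  proof -
    have "hweight c D h = (\<Prod>e\<in>snd D - ?E. if \<forall>v\<in>e. \<forall>w\<in>e. h v = h w then c e else 1)
        * (\<Prod>e\<in>?E. if \<forall>v\<in>e. \<forall>w\<in>e. h v = h w then c e else 1)"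
      unfolding hweight_def by (rule prod.subset_diff[OF ED finD])
    also have "(\<Prod>e\<in>snd D - ?E. if \<forall>v\<in>e. \<forall>w\<in>e. h v = h w then c e else 1) = w_out (out h)"
      unfolding w_out_def
    proof (rule prod.cong)
      fix e assume e: "e \<in> snd D - ?E"
      have "(if v \<in> V then \<xi> v else out h v) = h v" if "v \<in> e" for v
        using touch[OF e that] h by (auto simp: out_def R_def)
      then have "(\<forall>v\<in>e. \<forall>w\<in>e. h v = h w) \<longleftrightarrow>
         (\<forall>v\<in>e. \<forall>w\<in>e. (if v \<in> V then \<xi> v else out h v) = (if w \<in> V then \<xi> w else out h w))"
        by (intro ball_cong) auto
      then show "(if \<forall>v\<in>e. \<forall>w\<in>e. h v = h w then c e else 1)
        = (if \<forall>v\<in>e. \<forall>w\<in>e. (if v \<in> V then \<xi> v else out h v) = (if w \<in> V then \<xi> w else out h w) then c e else 1)"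
        by (simp only:)
    qed simp
    also have "(\<Prod>e\<in>?E. if \<forall>v\<in>e. \<forall>w\<in>e. h v = h w then c e else 1) = hweight c ?I (inn h)"
      unfolding hweight_def induced_def snd_conv
    proof (rule prod.cong)
      fix e assume e: "e \<in> ?E"
      then have "(\<forall>v\<in>e. \<forall>w\<in>e. h v = h w) \<longleftrightarrow> (\<forall>v\<in>e. \<forall>w\<in>e. inn h v = inn h w)"
        by (intro ball_cong) (auto simp: inn_def subset_iff)
      then show "(if \<forall>v\<in>e. \<forall>w\<in>e. h v = h w then c e else 1)
        = (if \<forall>v\<in>e. \<forall>w\<in>e. inn h v = inn h w then c e else 1)"
        by (simp only:)
    qed simp
    finally show ?thesis by (simp only: mult.commute)
  qed
  have factor: "(\<Sum>h\<in>R. hweight c D h * f (inn h))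
    = (\<Sum>k\<in>hconfs adj ?I (\<lambda>v. {\<xi> v}). hweight c ?I k * f k) * (\<Sum>u\<in>out ` R. w_out u)" for f :: "('v \<Rightarrow> int) \<Rightarrow> real"
  proof -
    have "(\<Sum>h\<in>R. hweight c D h * f (inn h))
       = (\<Sum>(k, u)\<in>hconfs adj ?I (\<lambda>v. {\<xi> v}) \<times> out ` R. hweight c ?I k * f k * w_out u)"
    proof (rule sum.reindex_bij_witness[where i = glue and j = "\<lambda>h. (inn h, out h)"], goal_cases)
      case (1 h)
      then show ?case by (auto simp: glue_def inn_def out_def)
    next
      case (2 h)
      then show ?case using inn_mem by auto
    next
      case (3 p)
      then obtain k h where p: "p = (k, out h)" "k \<in> hconfs adj ?I (\<lambda>v. {\<xi> v})" "h \<in> R" by auto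
      have "k v = 1" if "v \<notin> V" for v using p(2) that by (auto simp: hconfs_def induced_def)
      then show ?case unfolding p(1) by (auto simp: glue_def inn_def out_def fun_eq_iff)
    next
      case (4 p)
      then show ?case using glue_mem by auto
    next
      case (5 h)
      then show ?case using weight by (simp add: mult_ac)
    qed
    then show ?thesis by (simp add: sum.cartesian_product[symmetric] sum_product)
  qed
  let ?Z = "\<Sum>h\<in>hconfs adj D pm1. hweight c D h"
  let ?ZI = "\<Sum>k\<in>hconfs adj ?I (\<lambda>v. {\<xi> v}). hweight c ?I k"
  let ?i = "\<lambda>h. if \<forall>v\<in>V. h v = \<eta> v then 1 else 0 :: real"
  let ?B = "\<Sum>u\<in>out ` R. w_out u"
  have finH: "finite (hconfs adj D pm1)" by (rule finite_hconfs_pm1[OF D])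
  have restrict: "(\<Sum>h\<in>hconfs adj D pm1. hweight c D h * (if P h \<and> (\<forall>v\<in>?b. h v = \<xi> v) then 1 else 0))
    = (\<Sum>h\<in>R. hweight c D h * (if P h then 1 else 0))" for P
    unfolding R_def using finH by (intro sum.mono_neutral_cong_right) auto
  have 1: "hprob adj c D pm1 (\<lambda>h. (\<forall>v\<in>V. h v = \<eta> v) \<and> (\<forall>v\<in>?b. h v = \<xi> v))
     = (\<Sum>k\<in>hconfs adj ?I (\<lambda>v. {\<xi> v}). hweight c ?I k * ?i k) * ?B / ?Z"
    unfolding hprob_def hexp_def restrict factor[symmetric] by (simp add: inn_def)
  have 2: "hprob adj c D pm1 (\<lambda>h. \<forall>v\<in>?b. h v = \<xi> v) = ?ZI * ?B / ?Z"
    using restrict[of "\<lambda>_. True"] factor[of "\<lambda>_. 1"] unfolding hprob_def hexp_def by simp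
  show ?thesis
  proof (cases "hconfs adj ?I (\<lambda>v. {\<xi> v}) = {}")
    \<comment> \<open>Nothing inside \<open>V\<close> is compatible with \<xi>, and both
      probabilities on the domain are 0.\<close>
    case True
    then show ?thesis unfolding 1 2 by simp
  next
    case False
    then have "?ZI > 0" using finI hweight_pos[OF I] by (intro sum_pos) auto
    moreover have "hprob adj c ?I (\<lambda>v. {\<xi> v}) (\<lambda>h. \<forall>v\<in>V. h v = \<eta> v)
      = (\<Sum>k\<in>hconfs adj ?I (\<lambda>v. {\<xi> v}). hweight c ?I k * ?i k) / ?ZI"
      by (simp add: hprob_def hexp_def)
    ultimately show ?thesis unfolding 1 2 by simp
  qed
qed

end

section \<open>Limits of probability mass functions on integer-valued functions\<close>

text \<open>Scheffe: since the pointwise limit still has mass 1, the convergence holds in L1, and a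
  bounded integrand costs only the factor B.\<close>

lemma pmf_tendsto_expectation:
  fixes q :: "nat \<Rightarrow> 'a pmf" and F :: "'a \<Rightarrow> real"
  assumes lim: "\<And>x. (\<lambda>n. pmf (q n) x) \<longlonglongrightarrow> pmf Q x" and B: "\<And>x. \<bar>F x\<bar> \<le> B"
  shows "(\<lambda>n. measure_pmf.expectation (q n) F) \<longlonglongrightarrow> measure_pmf.expectation Q F"
proof -
  let ?M = "count_space (UNIV :: 'a set)"
  have int: "integrable ?M (pmf p)" for p :: "'a pmf" by (rule integrable_pmf)
  have one: "(\<integral>\<^sup>+ x. norm (pmf p x) \<partial>?M) = 1" for p :: "'a pmf"
    using nn_integral_pmf[where A = UNIV and p = p] by (simp add: emeasure_pmf_UNIV)
  have L1: "(\<lambda>n. \<integral>\<^sup>+ x. norm (pmf (q n) x - pmf Q x) \<partial>?M) \<longlonglongrightarrow> 0"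
    by (rule Scheffe_lemma1) (use lim int in \<open>simp_all only: one Limsup_const[OF sequentially_bot] order_refl, simp_all\<close>)
  have intd: "integrable ?M (\<lambda>x. pmf (q n) x - pmf Q x)" for n using int by simp
  have eqd: "(\<integral>\<^sup>+ x. norm (pmf (q n) x - pmf Q x) \<partial>?M) = ennreal (\<integral>x. \<bar>pmf (q n) x - pmf Q x\<bar> \<partial>?M)" for n
    using intd[of n] by (subst nn_integral_eq_integral) auto
  have L2: "(\<lambda>n. \<integral>x. \<bar>pmf (q n) x - pmf Q x\<bar> \<partial>?M) \<longlonglongrightarrow> 0"
    using L1 unfolding eqd by (simp add: tendsto_ennreal_iff[of _ _ 0, simplified] flip: ennreal_0)
  have ex: "measure_pmf.expectation p F = (\<integral>x. pmf p x * F x \<partial>?M)" for p :: "'a pmf"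
    unfolding measure_pmf_eq_density by (subst integral_density) auto
  have intF: "integrable ?M (\<lambda>x. pmf p x * F x)" for p :: "'a pmf"
  proof (rule Bochner_Integration.integrable_bound[where f = "\<lambda>x. B * pmf p x"])
    show "AE x in ?M. norm (pmf p x * F x) \<le> norm (B * pmf p x)"
    proof (rule AE_I2)
      fix x
      have "0 \<le> B" using B[of x] by linarith
      then show "norm (pmf p x * F x) \<le> norm (B * pmf p x)"
        using B[of x] by (simp add: abs_mult mult.commute mult_right_mono)
    qed
  qed (use int in auto)
  have bound: "\<bar>measure_pmf.expectation (q n) F - measure_pmf.expectation Q F\<bar>
      \<le> B * (\<integral>x. \<bar>pmf (q n) x - pmf Q x\<bar> \<partial>?M)" for n
  proof -
    have "measure_pmf.expectation (q n) F - measure_pmf.expectation Q F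
       = (\<integral>x. (pmf (q n) x - pmf Q x) * F x \<partial>?M)"
      unfolding ex using intF by (simp add: left_diff_distrib)
    also have "\<bar>\<dots>\<bar> \<le> (\<integral>x. B * \<bar>pmf (q n) x - pmf Q x\<bar> \<partial>?M)"
    proof (rule integral_abs_bound[THEN order_trans], rule integral_mono)
      show "integrable ?M (\<lambda>x. \<bar>(pmf (q n) x - pmf Q x) * F x\<bar>)"
        using intF by (simp add: left_diff_distrib)
      show "integrable ?M (\<lambda>x. B * \<bar>pmf (q n) x - pmf Q x\<bar>)" using intd[of n] by simp
      fix x show "\<bar>(pmf (q n) x - pmf Q x) * F x\<bar> \<le> B * \<bar>pmf (q n) x - pmf Q x\<bar>"
        using B[of x] by (simp add: abs_mult mult.commute mult_right_mono)
    qed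
    also have "\<dots> = B * (\<integral>x. \<bar>pmf (q n) x - pmf Q x\<bar> \<partial>?M)" by simp
    finally show ?thesis .
  qed
  have "(\<lambda>n. measure_pmf.expectation (q n) F - measure_pmf.expectation Q F) \<longlonglongrightarrow> 0"
  proof (rule Lim_null_comparison)
    show "\<forall>\<^sub>F n in sequentially. norm (measure_pmf.expectation (q n) F - measure_pmf.expectation Q F)
      \<le> B * (\<integral>x. \<bar>pmf (q n) x - pmf Q x\<bar> \<partial>?M)" using bound by simp
    show "(\<lambda>n. B * (\<integral>x. \<bar>pmf (q n) x - pmf Q x\<bar> \<partial>?M)) \<longlonglongrightarrow> 0"
      using tendsto_mult_left[OF L2, of B] by simp
  qed
  then show ?thesis by (simp add: LIM_zero_iff)
qed

lemma pmf_tendsto_prob: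
  fixes q :: "nat \<Rightarrow> 'a pmf"
  assumes "\<And>x. (\<lambda>n. pmf (q n) x) \<longlonglongrightarrow> pmf Q x"
  shows "(\<lambda>n. measure_pmf.prob (q n) A) \<longlonglongrightarrow> measure_pmf.prob Q A"
  using pmf_tendsto_expectation[OF assms, where F = "indicator A" and B = 1] by (simp add: indicator_def)

text \<open>Fatou bounds the mass of the pointwise limit by 1; finite sets carrying mass 1 -
  \<epsilon> uniformly in n prevent any loss.\<close>

lemma tight_pmf_limit:
  fixes q :: "nat \<Rightarrow> 'a pmf"
  assumes conv: "\<And>x. convergent (\<lambda>n. pmf (q n) x)"
    and tight: "\<And>\<epsilon>. \<epsilon> > 0 \<Longrightarrow> \<exists>A. finite A \<and> (\<forall>n. measure_pmf.prob (q n) A \<ge> 1 - \<epsilon>)"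
  shows "\<exists>Q. \<forall>x. (\<lambda>n. pmf (q n) x) \<longlonglongrightarrow> pmf Q x"
proof -
  define p where "p x = lim (\<lambda>n. pmf (q n) x)" for x
  have p: "(\<lambda>n. pmf (q n) x) \<longlonglongrightarrow> p x" for x
    using conv[of x] by (simp add: p_def convergent_LIMSEQ_iff)
  have p0: "0 \<le> p x" for x by (rule LIMSEQ_le_const[OF p]) auto
  let ?M = "count_space (UNIV :: 'a set)"
  have "(\<integral>\<^sup>+ x. ennreal (p x) \<partial>?M) = (\<integral>\<^sup>+ x. liminf (\<lambda>n. ennreal (pmf (q n) x)) \<partial>?M)"
  proof (rule nn_integral_cong)
    fix x
    have "(\<lambda>n. ennreal (pmf (q n) x)) \<longlonglongrightarrow> ennreal (p x)" using p by (rule tendsto_ennrealI)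
    then show "ennreal (p x) = liminf (\<lambda>n. ennreal (pmf (q n) x))"
      by (rule lim_imp_Liminf[OF sequentially_bot, symmetric])
  qed
  also have "\<dots> \<le> liminf (\<lambda>n. \<integral>\<^sup>+ x. ennreal (pmf (q n) x) \<partial>?M)"
    by (rule nn_integral_liminf) simp
  also have "\<dots> = 1"
    by (simp add: nn_integral_pmf[where A = UNIV] emeasure_pmf_UNIV Liminf_const)
  finally have le: "(\<integral>\<^sup>+ x. ennreal (p x) \<partial>?M) \<le> 1" .
  have ge: "1 \<le> (\<integral>\<^sup>+ x. ennreal (p x) \<partial>?M) + ennreal \<epsilon>" if "\<epsilon> > 0" for \<epsilon>
  proof -
    obtain A where A: "finite A" "\<And>n. measure_pmf.prob (q n) A \<ge> 1 - \<epsilon>" using tight[of \<epsilon>] \<open>\<epsilon> > 0\<close> by auto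
    have "(\<lambda>n. \<Sum>x\<in>A. pmf (q n) x) \<longlonglongrightarrow> (\<Sum>x\<in>A. p x)" by (intro tendsto_sum p)
    then have "1 - \<epsilon> \<le> (\<Sum>x\<in>A. p x)"
      by (rule LIMSEQ_le_const) (use A in \<open>simp add: measure_measure_pmf_finite\<close>)
    then have "1 \<le> (\<Sum>x\<in>A. p x) + \<epsilon>" by simp
    then have "ennreal 1 \<le> ennreal ((\<Sum>x\<in>A. p x) + \<epsilon>)" by (rule ennreal_leI)
    also have "\<dots> = (\<Sum>x\<in>A. ennreal (p x)) + ennreal \<epsilon>"
      using that p0 by (simp add: sum_nonneg)
    also have "(\<Sum>x\<in>A. ennreal (p x)) = (\<integral>\<^sup>+ x\<in>A. ennreal (p x) \<partial>?M)"
      using A(1) by (simp add: nn_integral_count_space_indicator[symmetric] nn_integral_count_space_finite)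
    also have "\<dots> \<le> (\<integral>\<^sup>+ x. ennreal (p x) \<partial>?M)"
      by (intro nn_integral_mono) (auto simp: indicator_def)
    finally show ?thesis by simp
  qed
  have "1 \<le> (\<integral>\<^sup>+ x. ennreal (p x) \<partial>?M)"
    by (rule ennreal_le_epsilon) (use ge in auto)
  with le have "(\<integral>\<^sup>+ x. ennreal (p x) \<partial>?M) = 1" by (rule antisym)
  then have "pmf (embed_pmf p) x = p x" for x by (intro pmf_embed_pmf p0)
  then show ?thesis using p by (intro exI[of _ "embed_pmf p"]) simp
qed

lemma fun_tendsto_if_eventually_eq:
  fixes g :: "nat \<Rightarrow> 'v \<Rightarrow> 'a::topological_space"
  assumes "\<And>v. \<forall>\<^sub>F k in sequentially. g k v = h v"
  shows "g \<longlonglongrightarrow> h"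
proof -
  have "limitin (product_topology (\<lambda>_. euclidean) UNIV) g h sequentially"
    unfolding limitin_componentwise
    by (auto intro!: tendsto_eventually assms)
  then show ?thesis by (simp add: euclidean_product_topology)
qed


text \<open>Singletons generate the topology. With this, measurability of maps into
  \<open>nat \<Rightarrow> int\<close> can be checked coordinate by coordinate.\<close>

instance int :: second_countable_topology
proof
  let ?B = "range (\<lambda>x. {x}) :: int set set"
  have "generate_topology ?B U" for U
  proof -
    have "generate_topology ?B (\<Union>x\<in>U. {x})"
      by (intro generate_topology_Union generate_topology.Basis) auto
    then show ?thesis by simp
  qed
  then have top: "open = generate_topology ?B"
    by (auto simp: fun_eq_iff discrete_topology_class.open_discrete)
  show "\<exists>B :: int set set. countable B \<and> open = generate_topology B"
    by (rule exI[of _ ?B], rule conjI[OF _ top]) simp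
qed

lemma open_cylinder:
  fixes \<eta> :: "'v \<Rightarrow> int"
  assumes "finite J"
  shows "open {h. \<forall>v\<in>J. h v = \<eta> v}"
proof -
  have "open ((\<lambda>h. h v) -` {\<eta> v})" for v
    by (intro open_vimage discrete_topology_class.open_discrete continuous_on_product_coordinates)
  then have "open (\<Inter>v\<in>J. (\<lambda>h. h v) -` {\<eta> v})" using assms by (intro open_INT) auto
  also have "(\<Inter>v\<in>J. (\<lambda>h. h v) -` {\<eta> v}) = {h. \<forall>v\<in>J. h v = \<eta> v}" by auto
  finally show ?thesis .
qed

section \<open>A limit measure by Kolmogorov extension\<close>

lemma prefix_tight:
  fixes P :: "nat \<Rightarrow> (nat \<Rightarrow> int) pmf"
  assumes tight: "\<And>i \<epsilon>. \<epsilon> > 0 \<Longrightarrow> \<exists>K. \<forall>n. measure_pmf.prob (P n) {h. \<bar>h i\<bar> > K} \<le> \<epsilon>" and "\<epsilon> > 0"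
  shows "\<exists>A. finite A \<and> (\<forall>n. measure_pmf.prob (map_pmf (\<lambda>h. map h [0..<k]) (P n)) A \<ge> 1 - \<epsilon>)"
proof -
  \<comment> \<open>The share of each of the k coordinates in a union bound; the divisor k + 1 keeps
    it positive for k = 0.\<close>
  let ?d = "\<epsilon> / (real k + 1)"
  have "?d > 0" using \<open>\<epsilon> > 0\<close> by simp
  then have "\<exists>K. \<forall>n. measure_pmf.prob (P n) {h. \<bar>h i\<bar> > K} \<le> ?d" for i using tight by blast
  then obtain K where K: "\<And>i n. measure_pmf.prob (P n) {h. \<bar>h i\<bar> > K i} \<le> ?d" by metis
  define M where "M = (\<Sum>i<k. \<bar>K i\<bar>)"
  define A where "A = {xs. set xs \<subseteq> {-M..M} \<and> length xs = k}"
  have "finite A" unfolding A_def by (rule finite_lists_length_eq) simp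
  moreover have "measure_pmf.prob (map_pmf (\<lambda>h. map h [0..<k]) (P n)) A \<ge> 1 - \<epsilon>" for n
  proof -
    let ?B = "\<Union>i<k. {h. \<bar>h i\<bar> > K i}"
    have "measure_pmf.prob (P n) ?B \<le> (\<Sum>i<k. measure_pmf.prob (P n) {h. \<bar>h i\<bar> > K i})"
      by (rule measure_pmf.finite_measure_subadditive_finite) auto
    also have "\<dots> \<le> (\<Sum>i<k. ?d)" by (intro sum_mono K)
    also have "\<dots> \<le> \<epsilon>" using \<open>\<epsilon> > 0\<close> by (simp add: field_simps)
    finally have "1 - \<epsilon> \<le> 1 - measure_pmf.prob (P n) ?B" by simp
    also have "\<dots> = measure_pmf.prob (P n) (- ?B)"
      using measure_pmf.prob_compl[of ?B "P n"] by (simp add: Compl_eq_Diff_UNIV)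
    also have "\<dots> \<le> measure_pmf.prob (P n) ((\<lambda>h. map h [0..<k]) -` A)"
    proof (rule measure_pmf.finite_measure_mono)
      show "- ?B \<subseteq> (\<lambda>h. map h [0..<k]) -` A"
      proof
        fix h assume h: "h \<in> - ?B"
        have "h i \<in> {-M..M}" if "i < k" for i
        proof -
          have "\<bar>K i\<bar> \<le> M" unfolding M_def by (rule member_le_sum) (use that in auto)
          moreover have "\<bar>h i\<bar> \<le> K i" using h that by force
          ultimately show ?thesis by auto
        qed
        then show "h \<in> (\<lambda>h. map h [0..<k]) -` A" by (auto simp: A_def)
      qed
    qed simp
    finally show ?thesis by simp
  qed
  ultimately show ?thesis by blast
qed

text \<open>Limits of the laws of prefixes form a consistent family. They are read as laws of real
  coordinates, where the extension theorem for Polish spaces applies, and the extended measure is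
  carried back to integer sequences by taking floors.\<close>

lemma limit_measure_on_sequences:
  fixes P :: "nat \<Rightarrow> (nat \<Rightarrow> int) pmf"
  assumes conv: "\<And>k xs. convergent (\<lambda>n. pmf (map_pmf (\<lambda>h. map h [0..<k]) (P n)) xs)"
    and tight: "\<And>i \<epsilon>. \<epsilon> > 0 \<Longrightarrow> \<exists>K. \<forall>n. measure_pmf.prob (P n) {h. \<bar>h i\<bar> > K} \<le> \<epsilon>"
  obtains \<mu> Q where "prob_space \<mu>" "sets \<mu> = sets borel"
    "\<And>k xs. (\<lambda>n. pmf (map_pmf (\<lambda>h. map h [0..<k]) (P n)) xs) \<longlonglongrightarrow> pmf (Q k) xs"
    "\<And>k. (\<lambda>h. map h [0..<k]) \<in> measurable \<mu> (count_space UNIV)"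
    "\<And>k. distr \<mu> (count_space UNIV) (\<lambda>h. map h [0..<k]) = measure_pmf (Q k)"
proof -
  let ?X = "\<lambda>k h. map h [0..<k] :: int list"
  have "\<exists>Q. \<forall>xs. (\<lambda>n. pmf (map_pmf (?X k) (P n)) xs) \<longlonglongrightarrow> pmf Q xs" for k
    by (rule tight_pmf_limit[OF conv]) (rule prefix_tight[OF tight])
  then obtain Q where Q: "\<And>k xs. (\<lambda>n. pmf (map_pmf (?X k) (P n)) xs) \<longlonglongrightarrow> pmf (Q k) xs" by metis
  have Qprob: "(\<lambda>n. measure_pmf.prob (P n) {h. ?X k h \<in> A}) \<longlonglongrightarrow> measure_pmf.prob (Q k) A" for k A
    using pmf_tendsto_prob[OF Q, of k A] by (simp add: vimage_def)
  \<comment> \<open>Both sides are limits of the same probabilities under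
    \<open>P n\<close>.\<close>
  have Qtake: "map_pmf (take k) (Q m) = Q k" if "k \<le> m" for k m
  proof (rule pmf_eqI)
    fix xs
    have "{h. ?X m h \<in> take k -` {xs}} = {h. ?X k h \<in> {xs}}" using that by (auto simp: take_map)
    then show "pmf (map_pmf (take k) (Q m)) xs = pmf (Q k) xs"
      using Qprob[of m "take k -` {xs}"] Qprob[of k "{xs}"]
      by (simp add: pmf_map LIMSEQ_unique measure_pmf_single)
  qed
  \<comment> \<open>A prefix length that reaches past every index in \<open>J\<close>; the inserted
    0 covers the empty set.\<close>
  define up where "up J = Suc (Max (insert 0 J))" for J :: "nat set"
  have up: "i < up J" if "finite J" "i \<in> J" for i J
    unfolding up_def using that by (simp add: less_Suc_eq_le)
  have up_mono: "up J \<le> up H" if "finite H" "J \<subseteq> H" for J H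
    unfolding up_def using that finite_subset by (auto intro!: Max_mono)
  define r where "r J xs = (\<lambda>i\<in>J. real_of_int (xs ! i))" for J :: "nat set" and xs
  define PJ where "PJ J = distr (measure_pmf (Q (up J))) (PiM J (\<lambda>_. borel)) (r J)" for J
  have rm: "r J \<in> measurable (measure_pmf p) (PiM J (\<lambda>_. borel))" for J p
    by (auto simp: r_def space_PiM measurable_pmf_measure1)
  have PJ_H: "PJ J = distr (measure_pmf (Q (up H))) (PiM J (\<lambda>_. borel)) (r J)" if "finite H" "J \<subseteq> H" for J H
  proof -
    have fJ: "finite J" using that finite_subset by auto
    have "PJ J = distr (measure_pmf (map_pmf (take (up J)) (Q (up H)))) (PiM J (\<lambda>_. borel)) (r J)"
      unfolding PJ_def Qtake[OF up_mono[OF that]] ..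
    also have "\<dots> = distr (measure_pmf (Q (up H))) (PiM J (\<lambda>_. borel)) (r J \<circ> take (up J))"
      unfolding map_pmf_rep_eq by (rule distr_distr) (auto simp: r_def space_PiM)
    also have "r J \<circ> take (up J) = r J" using up[OF fJ] by (auto simp: r_def fun_eq_iff)
    finally show ?thesis .
  qed
  interpret polish_projective "UNIV :: nat set" PJ
  proof (intro polish_projective.intro projective_family.intro)
    fix J H :: "nat set" assume JH: "J \<subseteq> H" "finite H" "H \<subseteq> UNIV"
    have "distr (PJ H) (PiM J (\<lambda>_. borel)) (\<lambda>f. restrict f J)
       = distr (measure_pmf (Q (up H))) (PiM J (\<lambda>_. borel)) ((\<lambda>f. restrict f J) \<circ> r H)"
      unfolding PJ_def by (rule distr_distr[OF measurable_restrict_subset[OF JH(1)] rm])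
    also have "(\<lambda>f. restrict f J) \<circ> r H = r J" using JH(1) by (auto simp: r_def fun_eq_iff)
    finally show "PJ J = distr (PJ H) (PiM J (\<lambda>_. borel)) (\<lambda>f. restrict f J)"
      using PJ_H[OF JH(2,1)] by (simp only:)
  next
    fix J :: "nat set"
    show "prob_space (PJ J)"
      unfolding PJ_def by (rule measure_pmf.prob_space_distr[OF rm])
  qed
  define fl where "fl g = (\<lambda>i. \<lfloor>g i\<rfloor>)" for g :: "nat \<Rightarrow> real"
  have flm: "fl \<in> measurable lim borel"
  proof (rule measurable_coordinatewise_then_product)
    fix i
    have "(\<lambda>g. g i) \<in> measurable lim (borel :: real measure)"
      unfolding measurable_cong_sets[OF sets_lim refl] by (rule measurable_component_singleton) simp
    then have "(\<lambda>g. \<lfloor>g i\<rfloor>) \<in> measurable lim (count_space UNIV)"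
      by (rule measurable_compose[OF _ measurable_real_floor])
    then show "(\<lambda>g. fl g i) \<in> borel_measurable lim"
      unfolding fl_def by (rule measurable_compose) simp
  qed
  define \<mu> where "\<mu> = distr lim borel fl"
  have Xopen: "{h :: nat \<Rightarrow> int. ?X k h = xs} \<in> sets borel" for k xs
  proof (cases "length xs = k")
    case True
    then have "{h :: nat \<Rightarrow> int. ?X k h = xs} = {h. \<forall>i\<in>{..<k}. h i = xs ! i}"
      by (auto simp: list_eq_iff_nth_eq)
    then show ?thesis using open_cylinder[of "{..<k}" "\<lambda>i. xs ! i"] by simp
  next
    case False
    then have "{h :: nat \<Rightarrow> int. ?X k h = xs} = {}" by auto
    then show ?thesis by (simp only: sets.empty_sets)
  qed
  have Xm: "?X k \<in> measurable borel (count_space UNIV)" for k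
    unfolding measurable_count_space_eq2_countable
    using Xopen by (auto simp: vimage_def)
  have sets_mu: "sets \<mu> = sets borel" by (simp add: \<mu>_def)
  have Xm': "?X k \<in> measurable \<mu> (count_space UNIV)" for k
    using Xm[of k] by (simp add: measurable_cong_sets[OF sets_mu refl])
  have "distr \<mu> (count_space UNIV) (?X k) = measure_pmf (Q k)" for k
  proof (rule measure_eqI_countable[where A = UNIV])
    fix xs :: "int list"
    let ?J = "{..<k}"
    let ?S = "{f \<in> space (PiM ?J (\<lambda>_. borel :: real measure)). map (\<lambda>i. \<lfloor>f i\<rfloor>) [0..<k] = xs}"
    have S: "?S \<in> sets (PiM ?J (\<lambda>_. borel))"
    proof (cases "length xs = k")
      case True
      then have "?S = {f \<in> space (PiM ?J (\<lambda>_. borel :: real measure)). \<forall>i\<in>?J. \<lfloor>f i\<rfloor> = xs ! i}"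
        by (auto simp: list_eq_iff_nth_eq)
      also have "\<dots> \<in> sets (PiM ?J (\<lambda>_. borel))"
        by measurable
      finally show ?thesis .
    next
      case False
      then have "?S = {}" by auto
      then show ?thesis by (simp only: sets.empty_sets)
    qed
    have "emeasure (distr \<mu> (count_space UNIV) (?X k)) {xs} = emeasure \<mu> {h. ?X k h = xs}"
      by (subst emeasure_distr[OF Xm']) (auto simp: \<mu>_def vimage_def)
    also have "\<dots> = emeasure lim {g. ?X k (fl g) = xs}"
      unfolding \<mu>_def by (subst emeasure_distr[OF flm Xopen]) (auto simp: vimage_def space_PiM)
    also have "{g. ?X k (fl g) = xs} = prod_emb UNIV (\<lambda>_. borel) ?J ?S"
      unfolding prod_emb_def by (auto simp: space_PiM fl_def)
    also have "emeasure lim \<dots> = emeasure (PJ ?J) ?S"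
      by (rule emeasure_lim_emb) (use S in auto)
    also have "\<dots> = emeasure (measure_pmf (Q (up ?J))) {ys. map (\<lambda>i. ys ! i) [0..<k] = xs}"
      unfolding PJ_def by (subst emeasure_distr[OF rm S])
        (rule arg_cong[where f = "emeasure _"], auto simp: r_def space_PiM)
    also have "\<dots> = ennreal (measure_pmf.prob (Q k) {xs})"
    proof -
      have "{h. ?X (up ?J) h \<in> {ys. map (\<lambda>i. ys ! i) [0..<k] = xs}} = {h. ?X k h \<in> {xs}}"
        using up[of ?J] by auto
      then have "measure_pmf.prob (Q (up ?J)) {ys. map (\<lambda>i. ys ! i) [0..<k] = xs} = measure_pmf.prob (Q k) {xs}"
        using Qprob[of "up ?J" "{ys. map (\<lambda>i. ys ! i) [0..<k] = xs}"] Qprob[of k "{xs}"]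
        by (simp only: LIMSEQ_unique)
      then show ?thesis by (simp add: measure_pmf.emeasure_eq_measure)
    qed
    also have "\<dots> = emeasure (measure_pmf (Q k)) {xs}" by (simp add: measure_pmf.emeasure_eq_measure)
    finally show "emeasure (distr \<mu> (count_space UNIV) (?X k)) {xs} = emeasure (measure_pmf (Q k)) {xs}" .
  qed auto
  moreover have "prob_space \<mu>" unfolding \<mu>_def by (rule P.prob_space_distr[OF flm])
  ultimately show thesis using that[of \<mu> Q] sets_mu Q Xm' by blast
qed

section \<open>Weak convergence to the limit measure\<close>

text \<open>Functions of a prefix converge in expectation by Scheffe. Approximation from below turns
  this into a lower bound for any bounded continuous function, and the same bound for its negative
  is the upper one.\<close>

lemma weak_limit_on_sequences:
  fixes P :: "nat \<Rightarrow> (nat \<Rightarrow> int) pmf"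
  assumes mu: "prob_space \<mu>" "sets \<mu> = sets borel"
    and Q: "\<And>k xs. (\<lambda>n. pmf (map_pmf (\<lambda>h. map h [0..<k]) (P n)) xs) \<longlonglongrightarrow> pmf (Q k) xs"
    and Xm: "\<And>k. (\<lambda>h. map h [0..<k]) \<in> measurable \<mu> (count_space UNIV)"
    and distr: "\<And>k. distr \<mu> (count_space UNIV) (\<lambda>h. map h [0..<k]) = measure_pmf (Q k)"
    and f: "continuous_on UNIV f" "\<And>h. \<bar>f h\<bar> \<le> (B :: real)"
  shows "(\<lambda>n. measure_pmf.expectation (P n) f) \<longlonglongrightarrow> integral\<^sup>L \<mu> f"
proof -
  interpret prob_space \<mu> by (rule mu(1))
  have half: "\<forall>\<^sub>F n in sequentially. measure_pmf.expectation (P n) f > integral\<^sup>L \<mu> f - \<epsilon>"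
    if e: "\<epsilon> > 0" and f: "continuous_on UNIV f" "\<And>h. \<bar>f h\<bar> \<le> B" for f :: "(nat \<Rightarrow> int) \<Rightarrow> real" and \<epsilon>
  proof -
    \<comment> \<open>Approximate \<open>f\<close> from below by its infimum over the functions sharing the first \<open>k\<close> values.\<close>
    define F where "F k xs = (if \<exists>g. map g [0..<k] = xs then INF g\<in>{g. map g [0..<k] = xs}. f g else 0)" for k xs
    have bdd: "bdd_below (f ` S)" for S using f(2) by (intro bdd_belowI[of _ "-B"]) (auto simp: abs_le_iff minus_le_iff)
    have F_le: "F k (map h [0..<k]) \<le> f h" for k h
    proof -
      have "F k (map h [0..<k]) = (INF g\<in>{g. map g [0..<k] = map h [0..<k]}. f g)"
        unfolding F_def by (rule if_P) blast
      also have "\<dots> \<le> f h" using bdd by (intro cINF_lower) auto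
      finally show ?thesis .
    qed
    have F_bd: "\<bar>F k xs\<bar> \<le> B" for k xs
    proof (cases "\<exists>g. map g [0..<k] = xs")
      case True
      then obtain g where g: "map g [0..<k] = xs" by blast
      have "- B \<le> F k xs" unfolding F_def if_P[OF True]
        using g f(2) by (intro cINF_greatest) (auto simp: abs_le_iff minus_le_iff)
      moreover have "F k xs \<le> B" using F_le[of k g] f(2)[of g] g by (auto simp: abs_le_iff)
      ultimately show ?thesis by (simp add: abs_le_iff)
    next
      case False
      then have "F k xs = 0" unfolding F_def by (rule if_not_P)
      then show ?thesis using f(2)[of "\<lambda>_. 0"] by simp
    qed
    have F_lim: "(\<lambda>k. F k (map h [0..<k])) \<longlonglongrightarrow> f h" for h
    proof -
      \<comment> \<open>Near-minimisers agree with h on longer and longer prefixes, so they converge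
        to h and continuity bounds the infima from below.\<close>
      have "\<exists>g. map g [0..<k] = map h [0..<k] \<and> f g < F k (map h [0..<k]) + 1 / (real k + 1)" for k
      proof -
        have "F k (map h [0..<k]) < F k (map h [0..<k]) + 1 / (real k + 1)" by simp
        moreover have "F k (map h [0..<k]) = (INF g\<in>{g. map g [0..<k] = map h [0..<k]}. f g)"
          unfolding F_def by (rule if_P) blast
        ultimately have "(INF g\<in>{g. map g [0..<k] = map h [0..<k]}. f g) < F k (map h [0..<k]) + 1 / (real k + 1)"
          by simp
        then show ?thesis
          by (subst (asm) cINF_less_iff) (use bdd in auto)
      qed
      then obtain g where g: "\<And>k. map (g k) [0..<k] = map h [0..<k]"
        "\<And>k. f (g k) < F k (map h [0..<k]) + 1 / (real k + 1)" by metis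
      have "g \<longlonglongrightarrow> h"
      proof (rule fun_tendsto_if_eventually_eq)
        fix i
        have "g k i = h i" if "i < k" for k using g(1)[of k] that by (auto simp: list_eq_iff_nth_eq)
        then show "\<forall>\<^sub>F k in sequentially. g k i = h i"
          by (intro eventually_sequentiallyI[of "Suc i"]) auto
      qed
      then have "(\<lambda>k. f (g k)) \<longlonglongrightarrow> f h"
        using f(1) by (simp add: continuous_on_tendsto_compose)
      moreover have "(\<lambda>k. 1 / (real k + 1)) \<longlonglongrightarrow> 0"
        using LIMSEQ_inverse_real_of_nat by (simp add: inverse_eq_divide add.commute)
      ultimately have "(\<lambda>k. f (g k) - 1 / (real k + 1)) \<longlonglongrightarrow> f h - 0" by (rule tendsto_diff)
      then have lo: "(\<lambda>k. f (g k) - 1 / (real k + 1)) \<longlonglongrightarrow> f h" by simp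
      show ?thesis
      proof (rule tendsto_sandwich[OF _ _ lo tendsto_const])
        show "\<forall>\<^sub>F k in sequentially. f (g k) - 1 / (real k + 1) \<le> F k (map h [0..<k])"
          using g(2) by (auto intro!: always_eventually less_imp_le simp: diff_less_eq)
        show "\<forall>\<^sub>F k in sequentially. F k (map h [0..<k]) \<le> f h"
          using F_le by auto
      qed
    qed
    have fm: "f \<in> borel_measurable \<mu>"
      using borel_measurable_continuous_onI[OF f(1)] by (simp add: measurable_cong_sets[OF mu(2) refl])
    have Fm: "(\<lambda>h. F k (map h [0..<k])) \<in> borel_measurable \<mu>" for k
      by (rule measurable_compose[OF Xm]) simp
    have "(\<lambda>k. \<integral>h. F k (map h [0..<k]) \<partial>\<mu>) \<longlonglongrightarrow> integral\<^sup>L \<mu> f"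
      by (rule integral_dominated_convergence[where w = "\<lambda>_. B"]) (use fm Fm F_lim F_bd in auto)
    then have "\<forall>\<^sub>F k in sequentially. integral\<^sup>L \<mu> f - \<epsilon> < (\<integral>h. F k (map h [0..<k]) \<partial>\<mu>)"
      by (rule order_tendstoD) (use e in simp)
    then obtain k where k: "integral\<^sup>L \<mu> f - \<epsilon> < (\<integral>h. F k (map h [0..<k]) \<partial>\<mu>)"
      by (auto simp: eventually_sequentially)
    have "(\<integral>h. F k (map h [0..<k]) \<partial>\<mu>) = measure_pmf.expectation (Q k) (F k)"
      unfolding distr[symmetric] by (rule integral_distr[OF Xm, symmetric]) simp
    moreover have "(\<lambda>n. measure_pmf.expectation (map_pmf (\<lambda>h. map h [0..<k]) (P n)) (F k))
        \<longlonglongrightarrow> measure_pmf.expectation (Q k) (F k)"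
      by (rule pmf_tendsto_expectation[OF Q F_bd])
    ultimately have "\<forall>\<^sub>F n in sequentially. integral\<^sup>L \<mu> f - \<epsilon>
        < measure_pmf.expectation (map_pmf (\<lambda>h. map h [0..<k]) (P n)) (F k)"
      using k by (intro order_tendstoD(1)) auto
    then show ?thesis
    proof (rule eventually_mono)
      fix n assume "integral\<^sup>L \<mu> f - \<epsilon> < measure_pmf.expectation (map_pmf (\<lambda>h. map h [0..<k]) (P n)) (F k)"
      also have "\<dots> = measure_pmf.expectation (P n) (\<lambda>h. F k (map h [0..<k]))" by simp
      also have "\<dots> \<le> measure_pmf.expectation (P n) f"
      proof (rule integral_mono)
        show "integrable (measure_pmf (P n)) (\<lambda>h. F k (map h [0..<k]))"
          by (rule measure_pmf.integrable_const_bound[where B = B]) (use F_bd in auto)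
        show "integrable (measure_pmf (P n)) f"
          by (rule measure_pmf.integrable_const_bound[where B = B]) (use f in auto)
      qed (rule F_le)
      finally show "integral\<^sup>L \<mu> f - \<epsilon> < measure_pmf.expectation (P n) f" .
    qed
  qed
  show ?thesis
  proof (rule order_tendstoI)
    fix a assume "a < integral\<^sup>L \<mu> f"
    then show "\<forall>\<^sub>F n in sequentially. a < measure_pmf.expectation (P n) f"
      using half[of "integral\<^sup>L \<mu> f - a" f] f by simp
  next
    fix a assume "integral\<^sup>L \<mu> f < a"
    then show "\<forall>\<^sub>F n in sequentially. measure_pmf.expectation (P n) f < a"
      using half[of "a - integral\<^sup>L \<mu> f" "\<lambda>h. - f h"] f by (simp add: continuous_on_minus)
  qed
qed

text \<open>The measure is built on sequences and transported along an enumeration of the vertices;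
  relabelling coordinates is continuous, so weak convergence comes along.\<close>

lemma weak_limit_exists:
  fixes P :: "nat \<Rightarrow> ('v \<Rightarrow> int) pmf"
  assumes V: "countable (UNIV :: 'v set)" "infinite (UNIV :: 'v set)"
    and conv: "\<And>J \<eta>. finite J \<Longrightarrow> convergent (\<lambda>n. measure_pmf.prob (P n) {h. \<forall>v\<in>J. h v = \<eta> v})"
    and tight: "\<And>v \<epsilon>. \<epsilon> > 0 \<Longrightarrow> \<exists>K. \<forall>n. measure_pmf.prob (P n) {h. \<bar>h v\<bar> > K} \<le> \<epsilon>"
  obtains \<mu> where "prob_space \<mu>" "sets \<mu> = sets borel"
    "\<And>f :: ('v \<Rightarrow> int) \<Rightarrow> real. continuous_on UNIV f \<Longrightarrow> bounded (range f) \<Longrightarrow>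
      (\<lambda>n. measure_pmf.expectation (P n) f) \<longlonglongrightarrow> integral\<^sup>L \<mu> f"
proof -
  obtain b :: "'v \<Rightarrow> nat" where b: "bij b" using V by (metis countableE_infinite)
  define i where "i = inv b"
  have ib: "i (b v) = v" and bi: "b (i m) = m" for v m
    using b by (simp_all add: i_def bij_is_inj bij_is_surj surj_f_inv_f)
  define P' where "P' n = map_pmf (\<lambda>h m. h (i m)) (P n)" for n
  have conv': "convergent (\<lambda>n. pmf (map_pmf (\<lambda>h. map h [0..<k]) (P' n)) xs)" for k xs
  proof (cases "length xs = k")
    case True
    have "{h. map (\<lambda>m. h (i m)) [0..<k] = xs} = {h. \<forall>v\<in>i ` {..<k}. h v = xs ! b v}"
      using True by (auto simp: list_eq_iff_nth_eq bi)
    then have "pmf (map_pmf (\<lambda>h. map h [0..<k]) (P' n)) xs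
        = measure_pmf.prob (P n) {h. \<forall>v\<in>i ` {..<k}. h v = xs ! b v}" for n
      unfolding P'_def map_pmf_comp pmf_map by (simp add: vimage_def)
    then show ?thesis using conv[of "i ` {..<k}"] by simp
  next
    case False
    then have "(\<lambda>h. map (\<lambda>m. h (i m)) [0..<k]) -` {xs} = {}" by auto
    then have "pmf (map_pmf (\<lambda>h. map h [0..<k]) (P' n)) xs = 0" for n
      unfolding P'_def map_pmf_comp pmf_map by (simp only: measure_empty)
    then show ?thesis by (simp add: convergent_const)
  qed
  have tight': "\<exists>K. \<forall>n. measure_pmf.prob (P' n) {h. \<bar>h m\<bar> > K} \<le> \<epsilon>" if "\<epsilon> > 0" for m \<epsilon>
    using tight[of \<epsilon> "i m"] that by (simp add: P'_def vimage_def)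
  obtain \<mu>' Q where \<mu>': "prob_space \<mu>'" "sets \<mu>' = sets borel"
    and Q: "\<And>k xs. (\<lambda>n. pmf (map_pmf (\<lambda>h. map h [0..<k]) (P' n)) xs) \<longlonglongrightarrow> pmf (Q k) xs"
    and X: "\<And>k. (\<lambda>h. map h [0..<k]) \<in> measurable \<mu>' (count_space UNIV)"
    and distr: "\<And>k. distr \<mu>' (count_space UNIV) (\<lambda>h. map h [0..<k]) = measure_pmf (Q k)"
    by (rule limit_measure_on_sequences[where P = P', OF conv' tight']) blast+
  let ?T = "\<lambda>(g :: nat \<Rightarrow> int) v. g (b v)"
  have T: "continuous_on UNIV ?T"
    by (intro continuous_on_coordinatewise_then_product continuous_on_product_coordinates)
  have Tm: "?T \<in> measurable \<mu>' borel"
    using borel_measurable_continuous_onI[OF T] by (simp add: measurable_cong_sets[OF \<mu>'(2) refl])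
  define \<mu> where "\<mu> = distr \<mu>' borel ?T"
  show thesis
  proof (rule that[of \<mu>])
    show "prob_space \<mu>" unfolding \<mu>_def by (rule prob_space.prob_space_distr[OF \<mu>'(1) Tm])
    show "sets \<mu> = sets borel" by (simp add: \<mu>_def)
    fix f :: "('v \<Rightarrow> int) \<Rightarrow> real" assume f: "continuous_on UNIV f" "bounded (range f)"
    obtain B where B: "\<And>h. \<bar>f h\<bar> \<le> B" using f(2) by (auto simp: bounded_iff)
    have cont: "continuous_on UNIV (\<lambda>g. f (?T g))"
      by (rule continuous_on_compose2[OF f(1) T]) simp
    have "(\<lambda>n. measure_pmf.expectation (P' n) (\<lambda>g. f (?T g))) \<longlonglongrightarrow> integral\<^sup>L \<mu>' (\<lambda>g. f (?T g))"
      by (rule weak_limit_on_sequences[OF \<mu>' Q X distr cont B])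
    moreover have "measure_pmf.expectation (P' n) (\<lambda>g. f (?T g)) = measure_pmf.expectation (P n) f" for n
      by (simp add: P'_def ib)
    moreover have "integral\<^sup>L \<mu> f = integral\<^sup>L \<mu>' (\<lambda>g. f (?T g))"
      unfolding \<mu>_def by (rule integral_distr[OF Tm borel_measurable_continuous_onI[OF f(1)]])
    ultimately show "(\<lambda>n. measure_pmf.expectation (P n) f) \<longlonglongrightarrow> integral\<^sup>L \<mu> f" by simp
  qed
qed

text \<open>The integers are discrete, so a preimage is a union of open cylinders over
  \<open>J\<close>.\<close>

lemma continuous_on_local:
  fixes f :: "('v \<Rightarrow> int) \<Rightarrow> real"
  assumes J: "finite J" and f: "\<And>h k. (\<And>v. v \<in> J \<Longrightarrow> h v = k v) \<Longrightarrow> f h = f k"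
  shows "continuous_on UNIV f"
  unfolding continuous_on_open_vimage[OF open_UNIV]
proof (intro allI impI)
  fix B :: "real set" assume "open B"
  have eq: "f -` B \<inter> UNIV = (\<Union>h\<in>f -` B. {g. \<forall>v\<in>J. g v = h v})"
  proof (intro equalityI subsetI)
    fix g assume "g \<in> (\<Union>h\<in>f -` B. {g. \<forall>v\<in>J. g v = h v})"
    then obtain h where "f h \<in> B" "\<forall>v\<in>J. g v = h v" by auto
    then show "g \<in> f -` B \<inter> UNIV" using f[of g h] by auto
  qed auto
  show "open (f -` B \<inter> UNIV)"
    unfolding eq by (intro open_UN ballI open_cylinder J)
qed

section \<open>Exhaustions and monotone convergence\<close>

lemma finite_subset_chain:
  assumes "finite A" "A \<subseteq> (\<Union>n. B n)" "\<And>n. B n \<subseteq> B (Suc n)"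
  shows "\<forall>\<^sub>F n in sequentially. A \<subseteq> B n"
proof -
  have inc: "B m \<subseteq> B n" if "m \<le> n" for m n using lift_Suc_mono_le[of B, OF assms(3) that] .
  have "\<forall>\<^sub>F n in sequentially. a \<in> B n" if "a \<in> A" for a
  proof -
    obtain m where "a \<in> B m" using assms(2) \<open>a \<in> A\<close> by auto
    then show ?thesis using inc by (auto intro!: eventually_sequentiallyI[of m])
  qed
  then have "\<forall>\<^sub>F n in sequentially. \<forall>a\<in>A. a \<in> B n" using assms(1) by (intro eventually_ball_finite) auto
  then show ?thesis by (simp add: subset_iff Ball_def)
qed

context lipschitz_graph
begin

lemma exhaustion_fin_subgraph: "increasing_exhaustion adj D \<Longrightarrow> fin_subgraph adj (D n)"
  by (simp add: increasing_exhaustion_def fin_conn_imp_fin_subgraph)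

lemma exhaustion_absorbs:
  assumes D: "increasing_exhaustion adj D" and D': "fin_subgraph adj D'"
  shows "\<forall>\<^sub>F n in sequentially. fst D' \<subseteq> fst (D n) \<and> snd D' \<subseteq> snd (D n)"
proof (rule eventually_conj)
  show "\<forall>\<^sub>F n in sequentially. fst D' \<subseteq> fst (D n)"
    by (rule finite_subset_chain) (use D D' in \<open>auto simp: increasing_exhaustion_def fin_subgraph_def\<close>)
  show "\<forall>\<^sub>F n in sequentially. snd D' \<subseteq> snd (D n)"
    by (rule finite_subset_chain[OF fin_subgraph_edges[OF D']])
      (use D D' in \<open>auto simp: increasing_exhaustion_def fin_subgraph_def\<close>)
qed

lemma exhaustion_mono:
  assumes D: "increasing_exhaustion adj D" and "m \<le> n"
  shows "fst (D m) \<subseteq> fst (D n)" "snd (D m) \<subseteq> snd (D n)"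
  using lift_Suc_mono_le[of "\<lambda>n. fst (D n)", OF _ assms(2)] lift_Suc_mono_le[of "\<lambda>n. snd (D n)", OF _ assms(2)]
    D by (auto simp: increasing_exhaustion_def)

text \<open>Balls around a vertex, finite by local finiteness, with all edges inside them. One
  exhaustion is needed both to carry variance bounds between vertices and to refute
  delocalization.\<close>

lemma exhaustion_exists: "\<exists>D. increasing_exhaustion adj D"
proof -
  fix x0 :: 'v
  define B where "B = rec_nat {x0} (\<lambda>_ S. S \<union> {w. \<exists>v\<in>S. adj v w})"
  have B0: "B 0 = {x0}" and BS: "B (Suc n) = B n \<union> {w. \<exists>v\<in>B n. adj v w}" for n
    by (simp_all add: B_def)
  let ?D = "\<lambda>n. induced adj (B n)"
  have fin: "finite (B n)" for n
  proof (induction n)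
    case (Suc n)
    have "{w. \<exists>v\<in>B n. adj v w} = (\<Union>v\<in>B n. {w. adj v w})" by auto
    then show ?case using Suc locally_finite by (simp add: BS)
  qed (simp add: B0)
  let ?R = "\<lambda>n a b. {a, b} \<in> snd (?D n)"
  have edge: "?R n a b" if "a \<in> B n" "b \<in> B n" "adj a b" for n a b
    using that by (auto simp: induced_def G_edges_def)
  have reach: "(?R n)\<^sup>*\<^sup>* x0 w" if "w \<in> B n" for n w
    using that
  proof (induction n arbitrary: w)
    case (Suc n)
    have mono: "(?R (Suc n))\<^sup>*\<^sup>* x0 v" if "v \<in> B n" for v
      using Suc.IH[OF that]
      by (rule rtranclp_mono[THEN predicate2D, rotated]) (auto simp: induced_def BS)
    show ?case
    proof (cases "w \<in> B n")
      case False
      then obtain v where v: "v \<in> B n" "adj v w" using Suc.prems by (auto simp: BS)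
      then have "?R (Suc n) v w" using Suc.prems by (intro edge) (auto simp: BS)
      then show ?thesis using mono[OF v(1)] by (rule rtranclp.rtrancl_into_rtrancl[rotated])
    qed (rule mono)
  qed (simp add: B0)
  have "symp (?R n)" for n by (rule sympI) (simp add: insert_commute)
  then have sym: "(?R n)\<^sup>*\<^sup>* w x0" if "w \<in> B n" for n w
    using reach[OF that] by (metis symp_rtranclp sympD)
  have x0: "x0 \<in> B n" for n by (induction n) (auto simp: B0 BS)
  have fc: "fin_conn_subgraph adj (?D n)" for n
    unfolding fin_conn_subgraph_def
    using fin x0[of n] rtranclp_trans[OF sym reach] by (auto simp: induced_def)
  have inc: "B m \<subseteq> B n" if "m \<le> n" for m n using lift_Suc_mono_le[of B, OF _ that] by (auto simp: BS)
  have all: "\<exists>n. w \<in> B n" for w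
    using connected[of x0 w]
  proof induction
    case (step y z)
    then obtain n where "y \<in> B n" by blast
    then have "z \<in> B (Suc n)" using step(2) by (auto simp: BS)
    then show ?case by blast
  qed (use x0 in auto)
  have "e \<in> (\<Union>n. snd (?D n))" if "e \<in> G_edges adj" for e
  proof -
    obtain v w where vw: "e = {v, w}" "v \<noteq> w" "adj v w" using \<open>e \<in> G_edges adj\<close> by (rule edge_cases)
    obtain m n where "v \<in> B m" "w \<in> B n" using all by meson
    then have "v \<in> B (max m n)" "w \<in> B (max m n)" using inc[of m "max m n"] inc[of n "max m n"] by auto
    then have "e \<in> snd (?D (max m n))" using vw that by (auto simp: induced_def)
    then show ?thesis by blast
  qed
  then have "(\<Union>n. snd (?D n)) = G_edges adj" by (auto simp: induced_def)
  then have "increasing_exhaustion adj ?D"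
    unfolding increasing_exhaustion_def using fc all by (auto simp: induced_def BS)
  then show ?thesis by blast
qed

section \<open>Second moments and tightness\<close>

abbreviation second_moment :: "'v set \<times> 'v set set \<Rightarrow> 'v \<Rightarrow> real" where
  "second_moment D x \<equiv> hexp adj c D pm1 (\<lambda>h. (real_of_int (h x))\<^sup>2)"

lemma second_moment_mono:
  assumes "fin_subgraph adj D" "fin_subgraph adj D'" "fst D \<subseteq> fst D'" "snd D \<subseteq> snd D'" "x \<in> fst D"
  shows "second_moment D x \<le> second_moment D' x"
proof -
  \<comment> \<open>Truncation at 0 makes the square monotone on all integer-valued functions and
    changes nothing on absolute values.\<close>
  let ?\<phi> = "\<lambda>a. (real_of_int (max 0 (a x)))\<^sup>2"
  have "(\<lambda>h. (real_of_int (h x))\<^sup>2) = char_obs {} ?\<phi>"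
    by (auto simp: char_obs_def fun_eq_iff)
  moreover have "mono ?\<phi>"
  proof (rule monoI)
    fix a b :: "'v \<Rightarrow> int" assume "a \<le> b"
    then have "a x \<le> b x" by (rule le_funD)
    then show "?\<phi> a \<le> ?\<phi> b" by (intro power_mono) auto
  qed
  ultimately show ?thesis using assms by (auto intro!: hexp_mono)
qed

text \<open>Tightness at level 1/4 starts the geometric decay with the same step j in all domains of
  the exhaustion. Every finite domain lies in one of them, and monotonicity does the rest.\<close>

lemma tight_imp_var_loc:
  assumes D: "increasing_exhaustion adj D" and t: "tight_at adj c D x"
  shows "var_loc adj c x"
proof -
  obtain K :: int where K: "\<And>n. hprob adj c (D n) pm1 (\<lambda>h. \<bar>h x\<bar> > K) \<le> 1 / 4"
    using t[unfolded tight_at_def, rule_format, of "1/4"] by auto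
  \<comment> \<open>With \<open>j \<ge> K\<close>, the event \<open>h x \<ge> 1 + 2 * j\<close>
    implies \<open>\<bar>h x\<bar> > K\<close>.\<close>
  define j where "j = max 1 K"
  show ?thesis unfolding var_loc_def
  proof (rule bdd_aboveI[of _ "moment_bound j"], safe)
    fix D' assume D': "fin_conn_subgraph adj D'" "x \<in> fst D'"
    have s': "fin_subgraph adj D'" by (rule fin_conn_imp_fin_subgraph[OF D'(1)])
    obtain n where n: "fst D' \<subseteq> fst (D n)" "snd D' \<subseteq> snd (D n)"
      using eventually_happens[OF exhaustion_absorbs[OF D s']] by auto
    note s = exhaustion_fin_subgraph[OF D, of n]
    have "tail (D n) x (1 + 2 * j) \<le> hprob adj c (D n) pm1 (\<lambda>h. \<bar>h x\<bar> > K)"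
      unfolding tail_def by (rule hprob_le[OF s]) (auto simp: j_def)
    then have "tail (D n) x (1 + 2 * j) \<le> 1 / 4" using K[of n] by linarith
    then have "second_moment (D n) x \<le> moment_bound j"
      by (intro second_moment_bound[OF s]) (use n D' in \<open>auto simp: j_def\<close>)
    then show "second_moment D' x \<le> moment_bound j"
      using second_moment_mono[OF s' s n D'(2)] by linarith
  qed
qed

text \<open>Heights at x and y differ by at most twice the length of a path between them, once the
  exhaustion contains its edges.\<close>

lemma exhaustion_lipschitz:
  assumes D: "increasing_exhaustion adj D"
  shows "\<exists>k. \<forall>\<^sub>F n in sequentially. \<forall>h\<in>hconfs adj (D n) pm1. \<bar>h x - h y\<bar> \<le> k"
  using connected[of x y]
proof induction
  case base
  show ?case by (intro exI[of _ 0]) simp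
next
  case (step y z)
  then obtain k where k: "\<forall>\<^sub>F n in sequentially. \<forall>h\<in>hconfs adj (D n) pm1. \<bar>h x - h y\<bar> \<le> k" by blast
  have "fin_subgraph adj ({y, z}, {{y, z}})" using step(2) by (auto simp: fin_subgraph_def G_edges_def)
  from exhaustion_absorbs[OF D this] have "\<forall>\<^sub>F n in sequentially. {y, z} \<in> snd (D n)"
    by (rule eventually_mono) auto
  with k have "\<forall>\<^sub>F n in sequentially. \<forall>h\<in>hconfs adj (D n) pm1. \<bar>h x - h z\<bar> \<le> k + 2"
  proof (rule eventually_elim2)
    fix n assume n: "\<forall>h\<in>hconfs adj (D n) pm1. \<bar>h x - h y\<bar> \<le> k" "{y, z} \<in> snd (D n)"
    show "\<forall>h\<in>hconfs adj (D n) pm1. \<bar>h x - h z\<bar> \<le> k + 2"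
    proof
      fix h assume h: "h \<in> hconfs adj (D n) pm1"
      then have "\<bar>h y - h z\<bar> \<le> 2" using n(2) unfolding hconfs_def by blast
      then show "\<bar>h x - h z\<bar> \<le> k + 2" using n(1)[rule_format, OF h] by linarith
    qed
  qed
  then show ?case by blast
qed

text \<open>A domain around y need not contain x or a path to it, so it is first enlarged to a
  member of an exhaustion.\<close>

lemma var_loc_transfer:
  assumes x: "var_loc adj c x"
  shows "var_loc adj c y"
proof -
  obtain D where D: "increasing_exhaustion adj D" using exhaustion_exists by blast
  obtain M where M: "\<And>D'. fin_conn_subgraph adj D' \<Longrightarrow> x \<in> fst D' \<Longrightarrow> second_moment D' x \<le> M"
    using x unfolding var_loc_def bdd_above_def by blast
  obtain k where k: "\<forall>\<^sub>F n in sequentially. \<forall>h\<in>hconfs adj (D n) pm1. \<bar>h y - h x\<bar> \<le> k"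
    using exhaustion_lipschitz[OF D] by blast
  show ?thesis unfolding var_loc_def
  proof (rule bdd_aboveI[of _ "2 * M + 2 * (real_of_int k)\<^sup>2"], safe)
    fix D' assume D': "fin_conn_subgraph adj D'" "y \<in> fst D'"
    have s': "fin_subgraph adj D'" by (rule fin_conn_imp_fin_subgraph[OF D'(1)])
    have sx: "fin_subgraph adj ({x}, {})" by (simp add: fin_subgraph_def)
    have "\<forall>\<^sub>F n in sequentially. (\<forall>h\<in>hconfs adj (D n) pm1. \<bar>h y - h x\<bar> \<le> k)
       \<and> (fst D' \<subseteq> fst (D n) \<and> snd D' \<subseteq> snd (D n)) \<and> x \<in> fst (D n)"
      using k exhaustion_absorbs[OF D s'] exhaustion_absorbs[OF D sx] by eventually_elim auto
    then obtain n where n: "\<forall>h\<in>hconfs adj (D n) pm1. \<bar>h y - h x\<bar> \<le> k"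
      "fst D' \<subseteq> fst (D n)" "snd D' \<subseteq> snd (D n)" "x \<in> fst (D n)"
      using eventually_happens by force
    note s = exhaustion_fin_subgraph[OF D, of n]
    have "second_moment D' y \<le> second_moment (D n) y"
      by (rule second_moment_mono[OF s' s n(2,3) D'(2)])
    also have "\<dots> \<le> hexp adj c (D n) pm1 (\<lambda>h. 2 * (real_of_int (h x))\<^sup>2 + 2 * (real_of_int k)\<^sup>2)"
    proof (rule hexp_le[OF s])
      fix h assume "h \<in> hconfs adj (D n) pm1"
      then have "\<bar>real_of_int (h y) - real_of_int (h x)\<bar> \<le> real_of_int k" using n(1)
        by (metis of_int_abs of_int_diff of_int_le_iff)
      then have "(real_of_int (h y) - real_of_int (h x))\<^sup>2 \<le> (real_of_int k)\<^sup>2"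
        by (metis abs_ge_zero power2_abs power_mono)
      \<comment> \<open>The parallelogram law, which gives (h y)^2 \<le> 2 (h x)^2 + 2 (h y - h
        x)^2.\<close>
      moreover have "(real_of_int (h y))\<^sup>2 + (real_of_int (h y) - 2 * real_of_int (h x))\<^sup>2
          = 2 * (real_of_int (h x))\<^sup>2 + 2 * (real_of_int (h y) - real_of_int (h x))\<^sup>2"
        by (simp add: power2_eq_square algebra_simps)
      ultimately show "(real_of_int (h y))\<^sup>2 \<le> 2 * (real_of_int (h x))\<^sup>2 + 2 * (real_of_int k)\<^sup>2"
        using zero_le_power2[of "real_of_int (h y) - 2 * real_of_int (h x)"] by linarith
    qed
    also have "\<dots> = 2 * second_moment (D n) x + 2 * (real_of_int k)\<^sup>2"
      by (simp add: hexp_add hexp_scale hexp_const[OF s])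
    also have "\<dots> \<le> 2 * M + 2 * (real_of_int k)\<^sup>2"
      using M[of "D n"] D n(4) by (simp add: increasing_exhaustion_def)
    finally show "second_moment D' y \<le> 2 * M + 2 * (real_of_int k)\<^sup>2" .
  qed
qed

lemma var_loc_imp_tight:
  assumes D: "increasing_exhaustion adj D" and x: "var_loc adj c x"
  shows "tight_at adj c D x"
  unfolding tight_at_def
proof (intro allI impI)
  fix \<epsilon> :: real assume e: "\<epsilon> > 0"
  obtain M0 where M0: "\<And>D'. fin_conn_subgraph adj D' \<Longrightarrow> x \<in> fst D' \<Longrightarrow> second_moment D' x \<le> M0"
    using x unfolding var_loc_def bdd_above_def by blast
  \<comment> \<open>The maximum with 1 covers the early domains without \<open>x\<close>, where
    \<open>h x = 1\<close>.\<close>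
  define M where "M = max M0 1"
  have M: "second_moment (D n) x \<le> M" for n
  proof (cases "x \<in> fst (D n)")
    case True
    then show ?thesis using M0[of "D n"] D by (auto simp: M_def increasing_exhaustion_def)
  next
    case False
    then have "second_moment (D n) x = hexp adj c (D n) pm1 (\<lambda>_. 1)"
      by (intro hexp_cong) (auto simp: hconfs_def)
    then show ?thesis using hexp_const[OF exhaustion_fin_subgraph[OF D]] by (simp add: M_def)
  qed
  \<comment> \<open>As K >= 1, \<open>K < \<bar>h x\<bar>\<close> gives
    \<open>K \<le> (h x)\<^sup>2\<close>, so dividing the second moment by K bounds the
    probability.\<close>
  define K where "K = max 1 \<lceil>M / \<epsilon>\<rceil>"
  have K: "1 \<le> K" "M / \<epsilon> \<le> real_of_int K" unfolding K_def by linarith+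
  have "hprob adj c (D n) pm1 (\<lambda>h. \<bar>h x\<bar> > K) \<le> \<epsilon>" for n
  proof -
    note s = exhaustion_fin_subgraph[OF D, of n]
    have "hprob adj c (D n) pm1 (\<lambda>h. \<bar>h x\<bar> > K)
        \<le> hexp adj c (D n) pm1 (\<lambda>h. 1 / real_of_int K * (real_of_int (h x))\<^sup>2)"
      unfolding hprob_def
    proof (rule hexp_le[OF s])
      fix h :: "'v \<Rightarrow> int"
      show "(if K < \<bar>h x\<bar> then 1 else 0) \<le> 1 / real_of_int K * (real_of_int (h x))\<^sup>2"
      proof (cases "K < \<bar>h x\<bar>")
        case True
        have "K * 1 \<le> \<bar>h x\<bar> * \<bar>h x\<bar>" using True K(1) by (intro mult_mono) auto
        then have "K \<le> (h x)\<^sup>2" by (simp add: power2_eq_square)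
        then have "real_of_int K \<le> (real_of_int (h x))\<^sup>2" by (metis of_int_le_iff of_int_power)
        then show ?thesis using True K(1) by (simp add: field_simps)
      next
        case False
        then show ?thesis using K(1) by simp
      qed
    qed
    also have "\<dots> = 1 / real_of_int K * second_moment (D n) x" by (rule hexp_scale)
    also have "\<dots> \<le> 1 / real_of_int K * M" using M K(1) by (intro mult_left_mono) auto
    also have "\<dots> \<le> \<epsilon>" using K e by (simp add: field_simps)
    finally show ?thesis .
  qed
  then show "\<exists>K. \<forall>n. hprob adj c (D n) pm1 (\<lambda>h. K < \<bar>h x\<bar>) \<le> \<epsilon>" by blast
qed

end

section \<open>Infinite-volume limits\<close>

context lipschitz_graph
begin

section \<open>Convergence of cylinder probabilities\<close>

lemma hexp_char_obs_convergent:
  assumes D: "increasing_exhaustion adj D" and A: "finite A" and J: "finite J"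
    and \<phi>: "mono \<phi>" "\<And>a. 0 \<le> \<phi> a" "\<And>a. \<phi> a \<le> 1"
    and dep: "\<And>a b. (\<And>v. v \<in> J \<Longrightarrow> a v = b v) \<Longrightarrow> \<phi> a = \<phi> b"
  shows "convergent (\<lambda>n. hexp adj c (D n) pm1 (char_obs A \<phi>))"
proof -
  have "fin_subgraph adj (A \<union> J, {})" using A J by (simp add: fin_subgraph_def)
  \<comment> \<open>Monotonicity in the domain requires \<open>A\<close> and \<open>J\<close> to lie
    inside it, so only the sequence from n0 on is monotone.\<close>
  from exhaustion_absorbs[OF D this] obtain n0 where n0: "\<And>n. n \<ge> n0 \<Longrightarrow> A \<union> J \<subseteq> fst (D n)"
    by (auto simp: eventually_sequentially)
  let ?f = "\<lambda>n. hexp adj c (D (n + n0)) pm1 (char_obs A \<phi>)"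
  have "convergent ?f"
  proof (rule Bseq_monoseq_convergent)
    have bd: "\<bar>char_obs A \<phi> h\<bar> \<le> 1" for h
    proof -
      have "\<bar>\<Prod>v\<in>A. real_of_int (sgn (h v))\<bar> \<le> 1"
        unfolding abs_prod by (intro prod_le_1) (auto simp: sgn_if)
      then have "\<bar>\<Prod>v\<in>A. real_of_int (sgn (h v))\<bar> * \<bar>\<phi> (\<lambda>v. \<bar>h v\<bar>)\<bar> \<le> 1 * 1"
        using \<phi> by (intro mult_mono) auto
      then show ?thesis by (simp add: char_obs_def abs_mult)
    qed
    have "\<bar>?f n\<bar> \<le> 1" for n
    proof -
      note s = exhaustion_fin_subgraph[OF D, of "n + n0"]
      have "?f n \<le> hexp adj c (D (n + n0)) pm1 (\<lambda>_. 1)" "hexp adj c (D (n + n0)) pm1 (\<lambda>_. -1) \<le> ?f n"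
        by (rule hexp_le[OF s]; use bd in \<open>simp add: abs_le_iff minus_le_iff\<close>)+
      then show ?thesis by (simp add: hexp_const[OF s] abs_le_iff)
    qed
    then show "Bseq ?f" by (intro BseqI'[of _ 1]) simp
    have "incseq ?f"
    proof (rule incseq_SucI)
      fix n
      show "?f n \<le> ?f (Suc n)"
        by (rule hexp_mono[OF exhaustion_fin_subgraph[OF D] exhaustion_fin_subgraph[OF D]])
          (use n0[of "n + n0"] \<phi> exhaustion_mono[OF D, of "n + n0" "Suc n + n0"] in \<open>auto intro!: dep\<close>)
    qed
    then show "monoseq ?f" by (auto simp: monoseq_iff)
  qed
  then show ?thesis by (simp add: convergent_ignore_initial_segment[of "\<lambda>n. hexp adj c (D n) pm1 (char_obs A \<phi>)" n0, symmetric])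
qed

text \<open>Vertices move one at a time from the indicator product into the observable. For odd
  heights the indicator of \<open>h x = \<eta> x\<close> is a difference of two threshold indicators
  of \<open>\<bar>h x\<bar>\<close>, times half of 1 plus the product of the signs of
  \<open>\<eta> x\<close> and \<open>h x\<close>. Expanding gives four observables of the same kind,
  with \<open>x\<close> in or out of \<open>A\<close> and \<phi> multiplied by an increasing
  indicator; hence the generalisation over \<open>A\<close> and \<phi>.\<close>

lemma cylinder_obs_convergent:
  assumes D: "increasing_exhaustion adj D" and J: "finite J"
    and "finite A" "A \<inter> J = {}" "finite I"
    and "mono \<phi>" "\<And>a. 0 \<le> \<phi> a" "\<And>a. \<phi> a \<le> 1"
    and "\<And>a b. (\<And>v. v \<in> I \<Longrightarrow> a v = b v) \<Longrightarrow> \<phi> a = \<phi> b"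
  shows "convergent (\<lambda>n. hexp adj c (D n) pm1 (\<lambda>h. char_obs A \<phi> h * (\<Prod>v\<in>J. of_bool (h v = \<eta> v))))"
  using J assms(3-)
proof (induction J arbitrary: A \<phi> I rule: finite_induct)
  case empty
  from hexp_char_obs_convergent[OF D empty(1,3,4,5,6,7)] show ?case by simp
next
  case (insert x J)
  let ?P = "\<lambda>h. \<Prod>v\<in>J. of_bool (h v = \<eta> v) :: real"
  let ?k = "\<bar>\<eta> x\<bar>"
  let ?s = "real_of_int (sgn (\<eta> x))"
  let ?\<phi> = "\<lambda>k a. \<phi> a * of_bool (k \<le> a x)"
  have conv: "convergent (\<lambda>n. hexp adj c (D n) pm1 (\<lambda>h. char_obs B (?\<phi> k) h * ?P h))"
    if "B = A \<or> B = insert x A" for B k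
  proof (rule insert.IH[where I = "insert x I"])
    show "finite B" "B \<inter> J = {}" "finite (insert x I)" using insert.hyps insert.prems(1-3) that by auto
    show "0 \<le> ?\<phi> k a" "?\<phi> k a \<le> 1" for a using insert.prems(5,6) by simp_all
    show "mono (?\<phi> k)"
    proof (rule monoI)
      fix a b :: "'v \<Rightarrow> int" assume "a \<le> b"
      have "\<phi> a \<le> \<phi> b" by (rule monoD[OF insert.prems(4) \<open>a \<le> b\<close>])
      moreover have "a x \<le> b x" by (rule le_funD[OF \<open>a \<le> b\<close>])
      ultimately show "?\<phi> k a \<le> ?\<phi> k b" using insert.prems(5) by auto
    qed
    fix a b :: "'v \<Rightarrow> int" assume eq: "\<And>v. v \<in> insert x I \<Longrightarrow> a v = b v"
    have "\<phi> a = \<phi> b" by (rule insert.prems(7)) (rule eq, simp)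
    moreover have "a x = b x" by (rule eq) simp
    ultimately show "?\<phi> k a = ?\<phi> k b" by simp
  qed
  have eq: "char_obs A \<phi> h * (\<Prod>v\<in>insert x J. of_bool (h v = \<eta> v)) =
      1/2 * (char_obs A (?\<phi> ?k) h * ?P h) + (-1/2) * (char_obs A (?\<phi> (?k + 1)) h * ?P h)
    + ((?s/2) * (char_obs (insert x A) (?\<phi> ?k) h * ?P h) + (-?s/2) * (char_obs (insert x A) (?\<phi> (?k + 1)) h * ?P h))"
    if h: "h \<in> hconfs adj (D n) pm1" for h n
  proof -
    have "odd (h x)" using h by (cases "x \<in> fst (D n)") (auto simp: hconfs_def)
    then have hx: "h x \<noteq> 0" by auto
    have x: "x \<notin> A" "finite A" using insert.prems(1,2) by auto
    have ins: "(\<Prod>v\<in>insert x A. real_of_int (sgn (h v))) = real_of_int (sgn (h x)) * (\<Prod>v\<in>A. real_of_int (sgn (h v)))"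
      using x by simp
    have ind: "of_bool (h x = \<eta> x) = (of_bool (?k \<le> \<bar>h x\<bar>) - of_bool (?k + 1 \<le> \<bar>h x\<bar>)) * (1 + ?s * real_of_int (sgn (h x))) / (2 :: real)"
    proof (cases "\<bar>h x\<bar> = ?k")
      case True
      then show ?thesis using hx by (auto simp: abs_if sgn_if split: if_splits)
    next
      case False
      then have "h x \<noteq> \<eta> x" by auto
      moreover have "?k \<le> \<bar>h x\<bar> \<longleftrightarrow> ?k + 1 \<le> \<bar>h x\<bar>" using False by linarith
      ultimately show ?thesis by simp
    qed
    have pr: "(\<Prod>v\<in>insert x J. of_bool (h v = \<eta> v)) = of_bool (h x = \<eta> x) * ?P h"
      using insert.hyps by simp
    have "(X * F) * ((p - q) * (1 + s * t) / 2 * R)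
      = 1/2 * (X * (F * p) * R) + (-1/2) * (X * (F * q) * R)
        + ((s/2) * ((t * X) * (F * p) * R) + (-s/2) * ((t * X) * (F * q) * R))" for X F p q s t R :: real
      by (simp add: field_simps)
    then show ?thesis unfolding char_obs_def ins pr ind .
  qed
  have "convergent (\<lambda>n. 1/2 * hexp adj c (D n) pm1 (\<lambda>h. char_obs A (?\<phi> ?k) h * ?P h)
     + (-1/2) * hexp adj c (D n) pm1 (\<lambda>h. char_obs A (?\<phi> (?k + 1)) h * ?P h)
    + ((?s/2) * hexp adj c (D n) pm1 (\<lambda>h. char_obs (insert x A) (?\<phi> ?k) h * ?P h)
     + (-?s/2) * hexp adj c (D n) pm1 (\<lambda>h. char_obs (insert x A) (?\<phi> (?k + 1)) h * ?P h)))"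
    by (intro convergent_add convergent_mult convergent_const conv) auto
  moreover have "hexp adj c (D n) pm1 (\<lambda>h. char_obs A \<phi> h * (\<Prod>v\<in>insert x J. of_bool (h v = \<eta> v)))
    = 1/2 * hexp adj c (D n) pm1 (\<lambda>h. char_obs A (?\<phi> ?k) h * ?P h)
     + (-1/2) * hexp adj c (D n) pm1 (\<lambda>h. char_obs A (?\<phi> (?k + 1)) h * ?P h)
    + ((?s/2) * hexp adj c (D n) pm1 (\<lambda>h. char_obs (insert x A) (?\<phi> ?k) h * ?P h)
     + (-?s/2) * hexp adj c (D n) pm1 (\<lambda>h. char_obs (insert x A) (?\<phi> (?k + 1)) h * ?P h))" for n
    unfolding hexp_scale[symmetric] hexp_add[symmetric] by (rule hexp_cong) (rule eq)
  ultimately show ?case by simp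
qed

lemma cylinder_prob_convergent:
  assumes D: "increasing_exhaustion adj D" and J: "finite J"
  shows "convergent (\<lambda>n. hprob adj c (D n) pm1 (\<lambda>h. \<forall>v\<in>J. h v = \<eta> v))"
proof -
  have "(if \<forall>v\<in>J. h v = \<eta> v then 1 else 0 :: real) = char_obs {} (\<lambda>_. 1) h * (\<Prod>v\<in>J. of_bool (h v = \<eta> v))" for h
    using J by (auto simp: char_obs_def intro!: prod_zero)
  then show ?thesis
    using cylinder_obs_convergent[OF D J, of "{}" "{}" "\<lambda>_. 1" \<eta>] by (simp add: hprob_def monoI)
qed

section \<open>Finite-volume laws as probability mass functions\<close>

definition hpmf :: "'v set \<times> 'v set set \<Rightarrow> ('v \<Rightarrow> int) pmf" where
  "hpmf D = embed_pmf (\<lambda>h. if h \<in> hconfs adj D pm1 then hweight c D h / (\<Sum>h\<in>hconfs adj D pm1. hweight c D h) else 0)"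

lemma expectation_hpmf:
  assumes D: "fin_subgraph adj D"
  shows "measure_pmf.expectation (hpmf D) f = hexp adj c D pm1 f"
proof -
  let ?H = "hconfs adj D pm1"
  let ?Z = "\<Sum>h\<in>?H. hweight c D h"
  let ?p = "\<lambda>h. if h \<in> ?H then hweight c D h / ?Z else 0"
  have Z: "?Z > 0" by (rule partition_pos[OF D])
  have p0: "0 \<le> ?p h" for h using Z hweight_pos[OF D, of h] by simp
  have fin: "finite ?H" by (rule finite_hconfs_pm1[OF D])
  have "(\<integral>\<^sup>+ h. ennreal (?p h) \<partial>count_space UNIV) = (\<Sum>h\<in>?H. ennreal (?p h))"
    using fin by (intro nn_integral_count_space') auto
  also have "\<dots> = ennreal (\<Sum>h\<in>?H. ?p h)" by (intro sum_ennreal p0)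
  also have "(\<Sum>h\<in>?H. ?p h) = 1" using Z by (simp add: sum_divide_distrib[symmetric])
  finally have "pmf (hpmf D) h = ?p h" for h
    unfolding hpmf_def by (intro pmf_embed_pmf p0) simp
  then show ?thesis
    using integral_measure_pmf_real[OF fin, of "hpmf D" f]
    by (auto simp: set_pmf_iff hexp_def sum_divide_distrib mult.commute split: if_splits)
qed

lemma prob_hpmf:
  assumes "fin_subgraph adj D"
  shows "measure_pmf.prob (hpmf D) {h. P h} = hprob adj c D pm1 P"
proof -
  have "measure_pmf.prob (hpmf D) {h. P h} = measure_pmf.expectation (hpmf D) (indicator {h. P h})" by simp
  also have "(indicator {h. P h} :: _ \<Rightarrow> real) = (\<lambda>h. if P h then 1 else 0)" by (auto simp: indicator_def)
  finally show ?thesis unfolding hprob_def expectation_hpmf[OF assms] .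
qed

section \<open>The Gibbs property of weak limits\<close>

text \<open>The indicator of an event on finitely many coordinates is continuous, hence a legitimate
  test function.\<close>

lemma local_prob_tendsto:
  assumes mu: "prob_space \<mu>" "sets \<mu> = sets borel" and weak: "weak_conv_to (\<lambda>n. hexp adj c (D n) pm1) \<mu>"
    and J: "finite J" and R: "\<And>h k. (\<And>v. v \<in> J \<Longrightarrow> h v = k v) \<Longrightarrow> R h = R k"
  shows "(\<lambda>n. hprob adj c (D n) pm1 R) \<longlonglongrightarrow> measure \<mu> {h. R h}" and "{h. R h} \<in> sets \<mu>"
proof -
  interpret prob_space \<mu> by fact
  let ?f = "\<lambda>h. if R h then 1 else 0 :: real"
  have cont: "continuous_on UNIV ?f" by (rule continuous_on_local[OF J]) (metis R)
  have "{h. R h} = ?f -` {1/2<..} \<inter> UNIV" by (auto split: if_splits)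
  moreover have "open (?f -` {1/2<..} \<inter> UNIV)"
    by (rule cont[unfolded continuous_on_open_vimage[OF open_UNIV], rule_format, OF open_greaterThan])
  ultimately show ms: "{h. R h} \<in> sets \<mu>" using mu(2) by simp
  have "bounded (range ?f)" by (intro boundedI[of _ 1]) auto
  with cont weak have "(\<lambda>n. hprob adj c (D n) pm1 R) \<longlonglongrightarrow> integral\<^sup>L \<mu> ?f"
    unfolding weak_conv_to_def hprob_def by blast
  also have "?f = indicator {h. R h}" by (auto simp: indicator_def)
  also have "integral\<^sup>L \<mu> (indicator {h. R h} :: _ \<Rightarrow> real) = measure \<mu> {h. R h}" using ms by simp
  finally show "(\<lambda>n. hprob adj c (D n) pm1 R) \<longlonglongrightarrow> measure \<mu> {h. R h}" .
qed

text \<open>Oddness, the Lipschitz bound and the Markov identity concern finitely many vertices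
  each. They hold exactly in \<open>D n\<close> as soon as it contains the edges involved, and
  countability of the vertices combines the almost sure statements.\<close>

lemma weak_limit_lipschitz_gibbs:
  assumes D: "increasing_exhaustion adj D"
    and mu: "prob_space \<mu>" "sets \<mu> = sets borel" and weak: "weak_conv_to (\<lambda>n. hexp adj c (D n) pm1) \<mu>"
  shows "lipschitz_gibbs adj c \<mu>"
proof -
  interpret prob_space \<mu> by fact
  note lp = local_prob_tendsto[OF mu weak]
  have sp: "space \<mu> = UNIV" using sets_eq_imp_space_eq[OF mu(2)] by simp
  have null: "AE h in \<mu>. \<not> R h"
    if "finite J" "\<And>h k. (\<And>v. v \<in> J \<Longrightarrow> h v = k v) \<Longrightarrow> R h = R k"
      "\<forall>\<^sub>F n in sequentially. hprob adj c (D n) pm1 R = 0" for J R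
  proof -
    have "(\<lambda>n. hprob adj c (D n) pm1 R) \<longlonglongrightarrow> 0" using that(3) by (rule tendsto_eventually)
    with lp(1)[OF that(1,2)] have "measure \<mu> {h. R h} = 0" by (rule LIMSEQ_unique)
    with lp(2)[OF that(1,2)] have "{h. R h} \<in> null_sets \<mu>"
      by (simp add: null_sets_def emeasure_eq_measure)
    then show ?thesis by (rule AE_I') auto
  qed
  have zero: "hprob adj c (D n) pm1 R = 0" if "\<And>h. h \<in> hconfs adj (D n) pm1 \<Longrightarrow> \<not> R h" for n R
  proof -
    have "hprob adj c (D n) pm1 R = hexp adj c (D n) pm1 (\<lambda>_. 0)"
      unfolding hprob_def by (rule hexp_cong) (use that in auto)
    then show ?thesis by (simp add: hexp_def)
  qed
  have odd: "AE h in \<mu>. odd (h v)" for v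
  proof -
    have "AE h in \<mu>. \<not> even (h v)"
    proof (rule null[of "{v}"])
      have "odd (h v)" if "h \<in> hconfs adj (D n) pm1" for h n
        using that by (cases "v \<in> fst (D n)") (auto simp: hconfs_def)
      then show "\<forall>\<^sub>F n in sequentially. hprob adj c (D n) pm1 (\<lambda>h. even (h v)) = 0"
        by (intro always_eventually allI zero) simp
    qed auto
    then show ?thesis by simp
  qed
  have lip: "AE h in \<mu>. adj v w \<longrightarrow> \<bar>h v - h w\<bar> \<le> 2" for v w
  proof (cases "adj v w")
    case True
    have "AE h in \<mu>. \<not> \<not> \<bar>h v - h w\<bar> \<le> 2"
    proof (rule null[of "{v, w}"])
      have "fin_subgraph adj ({v, w}, {{v, w}})" using True by (auto simp: fin_subgraph_def G_edges_def)
      from exhaustion_absorbs[OF D this]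
      show "\<forall>\<^sub>F n in sequentially. hprob adj c (D n) pm1 (\<lambda>h. \<not> \<bar>h v - h w\<bar> \<le> 2) = 0"
      proof (rule eventually_mono)
        fix n assume "fst ({v, w}, {{v, w}}) \<subseteq> fst (D n) \<and> snd ({v, w}, {{v, w}}) \<subseteq> snd (D n)"
        then have "{v, w} \<in> snd (D n)" by simp
        then have "\<bar>h v - h w\<bar> \<le> 2" if "h \<in> hconfs adj (D n) pm1" for h
          using that unfolding hconfs_def by blast
        then show "hprob adj c (D n) pm1 (\<lambda>h. \<not> \<bar>h v - h w\<bar> \<le> 2) = 0" by (intro zero) simp
      qed
    qed auto
    then show ?thesis by simp
  qed simp
  have "AE h in \<mu>. \<forall>v\<in>UNIV. odd (h v)"
    unfolding AE_ball_countable[OF countable_V] by (intro ballI odd)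
  moreover have "AE h in \<mu>. \<forall>v\<in>UNIV. \<forall>w\<in>UNIV. adj v w \<longrightarrow> \<bar>h v - h w\<bar> \<le> 2"
    unfolding AE_ball_countable[OF countable_V] by (intro ballI lip)
  ultimately have ae: "AE h in \<mu>. (\<forall>v. odd (h v)) \<and> (\<forall>v w. adj v w \<longrightarrow> \<bar>h v - h w\<bar> \<le> 2)"
    by simp
  have "measure \<mu> {h. (\<forall>v\<in>V. h v = \<eta> v) \<and> (\<forall>v\<in>bdry adj (induced adj V). h v = \<xi> v)}
           = measure \<mu> {h. \<forall>v\<in>bdry adj (induced adj V). h v = \<xi> v}
             * hprob adj c (induced adj V) (\<lambda>v. {\<xi> v}) (\<lambda>h. \<forall>v\<in>V. h v = \<eta> v)"
    if "fin_conn_subgraph adj (induced adj V)" for V \<xi> \<eta>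
  proof -
    let ?b = "bdry adj (induced adj V)"
    have V: "finite V" using that by (simp add: fin_conn_subgraph_def induced_def)
    have bV: "?b \<subseteq> V" by (auto simp: bdry_def induced_def)
    \<comment> \<open>Once \<open>D n\<close> contains \<open>V\<close>, its neighbours and all
      edges at \<open>V\<close>, the finite-volume Markov identity applies.\<close>
    let ?N = "V \<union> (\<Union>v\<in>V. {w. adj v w})"
    have "fin_subgraph adj (?N, {{v, w} | v w. v \<in> V \<and> adj v w})"
      using V locally_finite by (auto simp: fin_subgraph_def G_edges_def)
    from exhaustion_absorbs[OF D this]
    have ev: "\<forall>\<^sub>F n in sequentially. hprob adj c (D n) pm1 (\<lambda>h. (\<forall>v\<in>V. h v = \<eta> v) \<and> (\<forall>v\<in>?b. h v = \<xi> v))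
      = hprob adj c (D n) pm1 (\<lambda>h. \<forall>v\<in>?b. h v = \<xi> v)
        * hprob adj c (induced adj V) (\<lambda>v. {\<xi> v}) (\<lambda>h. \<forall>v\<in>V. h v = \<eta> v)" (is "\<forall>\<^sub>F n in _. ?ev n")
    proof (rule eventually_mono)
      fix n assume n: "fst (?N, {{v, w} | v w. v \<in> V \<and> adj v w}) \<subseteq> fst (D n)
        \<and> snd (?N, {{v, w} | v w. v \<in> V \<and> adj v w}) \<subseteq> snd (D n)"
      show "?ev n"
      proof (rule hprob_markov[OF exhaustion_fin_subgraph[OF D]])
        show "V \<subseteq> fst (D n)" using n by simp
        fix v w assume "v \<in> V" "adj v w"
        then have "{v, w} \<in> {{v, w} | v w. v \<in> V \<and> adj v w}" by blast
        then show "{v, w} \<in> snd (D n)" using n unfolding snd_conv by (meson subsetD)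
      qed
    qed
    have "(\<lambda>n. hprob adj c (D n) pm1 (\<lambda>h. (\<forall>v\<in>V. h v = \<eta> v) \<and> (\<forall>v\<in>?b. h v = \<xi> v)))
       \<longlonglongrightarrow> measure \<mu> {h. (\<forall>v\<in>V. h v = \<eta> v) \<and> (\<forall>v\<in>?b. h v = \<xi> v)}"
      by (rule lp(1)[OF V]) (use bV in \<open>auto simp: subset_iff\<close>)
    moreover have "(\<lambda>n. hprob adj c (D n) pm1 (\<lambda>h. \<forall>v\<in>?b. h v = \<xi> v)
        * hprob adj c (induced adj V) (\<lambda>v. {\<xi> v}) (\<lambda>h. \<forall>v\<in>V. h v = \<eta> v))
       \<longlonglongrightarrow> measure \<mu> {h. \<forall>v\<in>?b. h v = \<xi> v}
        * hprob adj c (induced adj V) (\<lambda>v. {\<xi> v}) (\<lambda>h. \<forall>v\<in>V. h v = \<eta> v)"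
      by (intro tendsto_mult_right lp(1)[OF V]) (use bV in \<open>auto simp: subset_iff\<close>)
    ultimately show ?thesis
      using LIMSEQ_unique tendsto_cong[OF ev] by blast
  qed
  then show ?thesis unfolding lipschitz_gibbs_def using mu ae by (simp add: sp)
qed

section \<open>Implications between localization, delocalization and bounded variance\<close>

lemma var_loc_imp_gibbs_loc:
  assumes "var_loc adj c x"
  shows "gibbs_loc adj c"
  unfolding gibbs_loc_def
proof (intro allI impI)
  fix D assume D: "increasing_exhaustion adj D"
  note s = exhaustion_fin_subgraph[OF D]
  obtain \<mu> where mu: "prob_space \<mu>" "sets \<mu> = sets borel"
    and lim: "\<And>f :: ('v \<Rightarrow> int) \<Rightarrow> real. continuous_on UNIV f \<Longrightarrow> bounded (range f) \<Longrightarrow>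
      (\<lambda>n. measure_pmf.expectation (hpmf (D n)) f) \<longlonglongrightarrow> integral\<^sup>L \<mu> f"
  proof (rule weak_limit_exists[OF countable_V infinite_V, where P = "\<lambda>n. hpmf (D n)"])
    show "convergent (\<lambda>n. measure_pmf.prob (hpmf (D n)) {h. \<forall>v\<in>J. h v = \<eta> v})" if "finite J" for J \<eta>
      unfolding prob_hpmf[OF s] by (rule cylinder_prob_convergent[OF D that])
    show "\<exists>K. \<forall>n. measure_pmf.prob (hpmf (D n)) {h. K < \<bar>h v\<bar>} \<le> \<epsilon>" if "\<epsilon> > 0" for v \<epsilon>
      using var_loc_imp_tight[OF D var_loc_transfer[OF assms]] that
      unfolding tight_at_def prob_hpmf[OF s] by blast
  qed blast
  have "weak_conv_to (\<lambda>n. hexp adj c (D n) pm1) \<mu>"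
    unfolding weak_conv_to_def using lim unfolding expectation_hpmf[OF s] by blast
  then show "\<exists>\<mu>. lipschitz_gibbs adj c \<mu> \<and> weak_conv_to (\<lambda>n. hexp adj c (D n) pm1) \<mu>"
    using weak_limit_lipschitz_gibbs[OF D mu] by blast
qed

text \<open>A weak limit that is a probability measure forces tightness: a level with small tail
  under the limit works for all late domains, and each of the finitely many early ones has bounded
  heights.\<close>

lemma gibbs_loc_imp_not_deloc:
  assumes "gibbs_loc adj c"
  shows "\<not> gibbs_deloc adj c"
proof -
  fix x :: 'v
  obtain D where D: "increasing_exhaustion adj D" using exhaustion_exists by blast
  note s = exhaustion_fin_subgraph[OF D]
  obtain \<mu> where mu: "lipschitz_gibbs adj c \<mu>" and weak: "weak_conv_to (\<lambda>n. hexp adj c (D n) pm1) \<mu>"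
    using assms D unfolding gibbs_loc_def by blast
  have mu': "prob_space \<mu>" "sets \<mu> = sets borel" using mu by (auto simp: lipschitz_gibbs_def)
  interpret prob_space \<mu> by fact
  have lp: "(\<lambda>n. hprob adj c (D n) pm1 (\<lambda>h. K < \<bar>h x\<bar>)) \<longlonglongrightarrow> measure \<mu> {h. K < \<bar>h x\<bar>}"
    "{h. K < \<bar>h x\<bar>} \<in> sets \<mu>" for K
    by (rule local_prob_tendsto[OF mu' weak, of "{x}"]; simp)+
  have "tight_at adj c D x" unfolding tight_at_def
  proof (intro allI impI)
    fix \<epsilon> :: real assume e: "\<epsilon> > 0"
    have "(\<lambda>m. measure \<mu> {h. int m < \<bar>h x\<bar>}) \<longlonglongrightarrow> measure \<mu> (\<Inter>m. {h. int m < \<bar>h x\<bar>})"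
      by (rule finite_Lim_measure_decseq) (use lp in \<open>auto simp: decseq_def\<close>)
    moreover have "(\<Inter>m. {h :: 'v \<Rightarrow> int. int m < \<bar>h x\<bar>}) = {}"
    proof -
      have "\<not> int (nat \<bar>h x\<bar>) < \<bar>h x\<bar>" for h :: "'v \<Rightarrow> int" by simp
      then show ?thesis by blast
    qed
    ultimately have "(\<lambda>m. measure \<mu> {h. int m < \<bar>h x\<bar>}) \<longlonglongrightarrow> 0" by simp
    then have "\<forall>\<^sub>F m in sequentially. measure \<mu> {h. int m < \<bar>h x\<bar>} < \<epsilon>"
      by (rule order_tendstoD) (rule e)
    then obtain m where m: "measure \<mu> {h. int m < \<bar>h x\<bar>} < \<epsilon>" by (auto simp: eventually_sequentially)
    have "\<forall>\<^sub>F n in sequentially. hprob adj c (D n) pm1 (\<lambda>h. int m < \<bar>h x\<bar>) < \<epsilon>"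
      by (rule order_tendstoD(2)[OF lp(1) m])
    then obtain n0 where n0: "\<And>n. n \<ge> n0 \<Longrightarrow> hprob adj c (D n) pm1 (\<lambda>h. int m < \<bar>h x\<bar>) < \<epsilon>"
      by (auto simp: eventually_sequentially)
    have "\<exists>N. \<forall>h\<in>hconfs adj (D n) pm1. \<bar>h x\<bar> \<le> N" for n
      using hconfs_bounded[OF s[of n], of pm1] by (force simp: pm1_def)
    then obtain N where N: "\<And>n h. h \<in> hconfs adj (D n) pm1 \<Longrightarrow> \<bar>h x\<bar> \<le> N n" by metis
    define K where "K = int m + (\<Sum>n<n0. \<bar>N n\<bar>)"
    have "hprob adj c (D n) pm1 (\<lambda>h. K < \<bar>h x\<bar>) \<le> \<epsilon>" for n
    proof (cases "n < n0")
      case True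
      then have "\<bar>N n\<bar> \<le> (\<Sum>n<n0. \<bar>N n\<bar>)" by (intro member_le_sum) auto
      then have "\<not> K < \<bar>h x\<bar>" if "h \<in> hconfs adj (D n) pm1" for h
        using N[OF that] by (auto simp: K_def)
      then have "hprob adj c (D n) pm1 (\<lambda>h. K < \<bar>h x\<bar>) \<le> hprob adj c (D n) pm1 (\<lambda>_. False)"
        by (intro hprob_le[OF s]) auto
      also have "\<dots> = 0" by (simp add: hprob_def hexp_def)
      finally show ?thesis using e by simp
    next
      case False
      have "hprob adj c (D n) pm1 (\<lambda>h. K < \<bar>h x\<bar>) \<le> hprob adj c (D n) pm1 (\<lambda>h. int m < \<bar>h x\<bar>)"
      proof (rule hprob_le[OF s])
        have "0 \<le> (\<Sum>n<n0. \<bar>N n\<bar>)" by (simp add: sum_nonneg)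
        then show "int m < \<bar>h x\<bar>" if "K < \<bar>h x\<bar>" for h using that unfolding K_def by linarith
      qed
      then show ?thesis using n0[of n] False by simp
    qed
    then show "\<exists>K. \<forall>n. hprob adj c (D n) pm1 (\<lambda>h. K < \<bar>h x\<bar>) \<le> \<epsilon>" by blast
  qed
  then show ?thesis using D by (auto simp: gibbs_deloc_def)
qed

lemma not_deloc_imp_var_loc: "\<not> gibbs_deloc adj c \<Longrightarrow> var_loc adj c x"
  using tight_imp_var_loc var_loc_transfer by (auto simp: gibbs_deloc_def)

end

theorem theorem5p3:
  fixes adj :: "'v \<Rightarrow> 'v \<Rightarrow> bool" and c :: "'v set \<Rightarrow> real"
  assumes "countable (UNIV :: 'v set)" and "infinite (UNIV :: 'v set)"
    and "\<forall>v w. adj v w \<longrightarrow> adj w v" and "\<forall>v. \<not> adj v v"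
    and "\<forall>v. finite {w. adj v w}"
    and "\<forall>v w. adj\<^sup>*\<^sup>* v w"
    and "\<forall>e\<in>G_edges adj. c e \<ge> 1"
  shows "(gibbs_loc adj c \<longleftrightarrow> \<not> gibbs_deloc adj c)
    \<and> (gibbs_loc adj c \<longleftrightarrow> (\<exists>x. var_loc adj c x))
    \<and> (gibbs_loc adj c \<longleftrightarrow> (\<forall>x. var_loc adj c x))
    \<and> (gibbs_deloc adj c \<longleftrightarrow> (\<exists>x. \<not> var_loc adj c x))
    \<and> (gibbs_deloc adj c \<longleftrightarrow> (\<forall>x. \<not> var_loc adj c x))"
proof -
  interpret lipschitz_graph adj c
    by unfold_locales (use assms in auto)
  \<comment> \<open>The implications close a cycle: localization excludes delocalization, its
    failure bounds the variance at every vertex, and a bound at a single vertex gives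
    localization.\<close>
  show ?thesis
    using var_loc_imp_gibbs_loc gibbs_loc_imp_not_deloc not_deloc_imp_var_loc by blast
qed

end
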